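(* Let $G$ be a game structure of imperfect information with observation set $\mathcal{O}$, let $\mathcal{T}\subseteq\mathcal{O}$ be a set of observations, and let $\ell$ be a state of $G$. Whether $\ell$ is an almost-winning state in $G$ for the Büchi objective $\mathsf{Buchi}(\mathcal{T})$ can be decided in EXPTIME.
   Context: A game structure of imperfect information is $G=\langle L,l_0,\Sigma,\Delta,\mathcal{O},\gamma\rangle$: $L$ finite set of states, $l_0$ initial state, $\Sigma$ finite alphabet, $\Delta\subseteq L\times\Sigma\times L$ with every state having a $\sigma$-successor for each $\sigma$, $\mathcal{O}$ finite set of observations, $\gamma:\mathcal{O}\to2^L\setminus\{\emptyset\}$ with $\{\gamma(o)\}$ a partition of $L$. In each round Player 1 chooses a letter and Player 2 a successor state. The observation sequence of a play $\ell_0\sigma_0\ell_1\dots$ is $o_0\sigma_0o_1\dots$ with $\ell_i\in\gamma(o_i)$. A randomized Player-1 strategy maps finite prefixes to probability distributions on $\Sigma$ and is observation-based if it agrees on prefixes with equal observation sequences; Player-2 randomized strategies map prefixes and letters to distributions over successors. $G_\ell$ is $G$ with initial state $\ell$. A state $\ell$ is almost winning for $\phi$ if Player 1 has a randomized observation-based strategy $\alpha$ in $G_\ell$ such that for all randomized Player-2 strategies $\beta$ the probability that the play satisfies $\phi$ is $1$. $\mathsf{Buchi}(\mathcal{T})$: some observation in $\mathcal{T}$ occurs infinitely often in the observation sequence. *)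

theory Defs
  imports "HOL-Probability.Probability"
begin

section \<open>Game structures of imperfect information\<close>

record ('s, 'a, 'o) game_structure =
  states :: "'s set"
  initial :: 's
  alphabet :: "'a set"
  transitions :: "('s \<times> 'a \<times> 's) set"
  observations :: "'o set"
  gamma :: "'o \<Rightarrow> 's set"

definition is_game_structure :: "('s, 'a, 'o) game_structure \<Rightarrow> bool" where
  "is_game_structure G \<longleftrightarrow>
     finite (states G) \<and> initial G \<in> states G \<and> finite (alphabet G) \<and>
     transitions G \<subseteq> states G \<times> alphabet G \<times> states G \<and>
     (\<forall>l\<in>states G. \<forall>\<sigma>\<in>alphabet G. \<exists>l'. (l, \<sigma>, l') \<in> transitions G) \<and>
     finite (observations G) \<and>
     (\<forall>b\<in>observations G. gamma G b \<noteq> {}) \<and>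
     disjoint_family_on (gamma G) (observations G) \<and>
     (\<Union>b\<in>observations G. gamma G b) = states G"

abbreviation start_in :: "('s, 'a, 'o) game_structure \<Rightarrow> 's \<Rightarrow> ('s, 'a, 'o) game_structure" where
  "start_in G l \<equiv> G\<lparr>initial := l\<rparr>"

definition obs_of :: "('s, 'a, 'o) game_structure \<Rightarrow> 's \<Rightarrow> 'o" where
  "obs_of G l = (THE b. b \<in> observations G \<and> l \<in> gamma G b)"

section \<open>Plays, prefixes and strategies\<close>

text \<open>A play \<open>l\<^sub>0 \<sigma>\<^sub>0 l\<^sub>1 \<sigma>\<^sub>1 \<dots>\<close> is the function mapping \<open>i\<close> to \<open>(l\<^sub>i, \<sigma>\<^sub>i)\<close>. A finite prefix
  \<open>l\<^sub>0 \<sigma>\<^sub>0 \<dots> \<sigma>\<^sub>n\<^sub>-\<^sub>1 l\<^sub>n\<close> is the pair of the list of its completed rounds \<open>(l\<^sub>i, \<sigma>\<^sub>i)\<close>, \<open>i < n\<close>,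
  and its last state \<open>l\<^sub>n\<close>.\<close>

type_synonym ('s, 'a) play = "nat \<Rightarrow> 's \<times> 'a"
type_synonym ('s, 'a) prefix = "('s \<times> 'a) list \<times> 's"
type_synonym ('s, 'a) strategy1 = "('s, 'a) prefix \<Rightarrow> 'a pmf"
type_synonym ('s, 'a) strategy2 = "('s, 'a) prefix \<Rightarrow> 'a \<Rightarrow> 's pmf"

definition prefixes :: "('s, 'a, 'o) game_structure \<Rightarrow> ('s, 'a) prefix set" where
  "prefixes G = {(h, l). let ls = map fst h @ [l] in
     hd ls = initial G \<and> set ls \<subseteq> states G \<and>
     (\<forall>i<length h. (ls ! i, snd (h ! i), ls ! Suc i) \<in> transitions G)}"

definition obs_prefix :: "('s, 'a, 'o) game_structure \<Rightarrow> ('s, 'a) prefix \<Rightarrow> ('o, 'a) prefix" where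
  "obs_prefix G = (\<lambda>(h, l). (map (\<lambda>(l', \<sigma>). (obs_of G l', \<sigma>)) h, obs_of G l))"

text \<open>Strategies are total functions. Their values on arguments that are not prefixes of plays are
  also required to be distributions on letters resp. on successors of the last state; this does
  not restrict the strategies, since these values influence no play.\<close>

definition randomized_strategy1 :: "('s, 'a, 'o) game_structure \<Rightarrow> ('s, 'a) strategy1 \<Rightarrow> bool" where
  "randomized_strategy1 G \<alpha> \<longleftrightarrow> (\<forall>p. set_pmf (\<alpha> p) \<subseteq> alphabet G)"

definition observation_based :: "('s, 'a, 'o) game_structure \<Rightarrow> ('s, 'a) strategy1 \<Rightarrow> bool" where
  "observation_based G \<alpha> \<longleftrightarrow>
     (\<forall>p\<in>prefixes G. \<forall>p'\<in>prefixes G. obs_prefix G p = obs_prefix G p' \<longrightarrow> \<alpha> p = \<alpha> p')"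

definition randomized_strategy2 :: "('s, 'a, 'o) game_structure \<Rightarrow> ('s, 'a) strategy2 \<Rightarrow> bool" where
  "randomized_strategy2 G \<beta> \<longleftrightarrow>
     (\<forall>h. \<forall>l\<in>states G. \<forall>\<sigma>\<in>alphabet G. set_pmf (\<beta> (h, l) \<sigma>) \<subseteq> {l'. (l, \<sigma>, l') \<in> transitions G})"

section \<open>The probability measure on plays\<close>

definition next_state :: "('s, 'a, 'o) game_structure \<Rightarrow> ('s, 'a) strategy2 \<Rightarrow> ('s \<times> 'a) list \<Rightarrow> 's pmf" where
  "next_state G \<beta> h =
     (if h = [] then return_pmf (initial G)
      else case last h of (l, \<sigma>) \<Rightarrow> \<beta> (butlast h, l) \<sigma>)"

text \<open>The distribution of \<open>(l\<^sub>n, \<sigma>\<^sub>n)\<close> given the rounds \<open>(l\<^sub>i, \<sigma>\<^sub>i)\<close> with \<open>i < n\<close>.\<close>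

definition next_round ::
  "('s, 'a, 'o) game_structure \<Rightarrow> ('s, 'a) strategy1 \<Rightarrow> ('s, 'a) strategy2 \<Rightarrow>
   ('s \<times> 'a) list \<Rightarrow> ('s \<times> 'a) pmf" where
  "next_round G \<alpha> \<beta> h = bind_pmf (next_state G \<beta> h) (\<lambda>l. map_pmf (Pair l) (\<alpha> (h, l)))"

abbreviation rounds_space :: "('s, 'a, 'o) game_structure \<Rightarrow> nat \<Rightarrow> ('s \<times> 'a) measure" where
  "rounds_space G \<equiv> \<lambda>_. count_space (states G \<times> alphabet G)"

definition round_kernel ::
  "('s, 'a, 'o) game_structure \<Rightarrow> ('s, 'a) strategy1 \<Rightarrow> ('s, 'a) strategy2 \<Rightarrow>
   nat \<Rightarrow> ('s, 'a) play \<Rightarrow> ('s \<times> 'a) measure" where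
  "round_kernel G \<alpha> \<beta> n \<pi> =
     restrict_space (measure_pmf (next_round G \<alpha> \<beta> (map \<pi> [0..<n]))) (states G \<times> alphabet G)"

text \<open>The Ionescu-Tulcea extension of the round kernels, i.e. the unique probability measure on
  infinite plays that has the prescribed values on cylinders.\<close>

definition outcome_measure ::
  "('s, 'a, 'o) game_structure \<Rightarrow> ('s, 'a) strategy1 \<Rightarrow> ('s, 'a) strategy2 \<Rightarrow>
   ('s, 'a) play measure" where
  "outcome_measure G \<alpha> \<beta> =
     projective_family.lim UNIV (Ionescu_Tulcea.CI (round_kernel G \<alpha> \<beta>) (rounds_space G)) (rounds_space G)"

lemma set_next_round:
  assumes G: "is_game_structure G"
    and \<alpha>: "randomized_strategy1 G \<alpha>" and \<beta>: "randomized_strategy2 G \<beta>"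
    and h: "set h \<subseteq> states G \<times> alphabet G"
  shows "set_pmf (next_round G \<alpha> \<beta> h) \<subseteq> states G \<times> alphabet G"
proof -
  have "set_pmf (next_state G \<beta> h) \<subseteq> states G"
  proof (cases "h = []")
    case True
    then show ?thesis
      using G by (simp add: next_state_def is_game_structure_def)
  next
    case False
    obtain l \<sigma> where l: "last h = (l, \<sigma>)" by fastforce
    with False h have "l \<in> states G" "\<sigma> \<in> alphabet G"
      using last_in_set by fastforce+
    then have "set_pmf (\<beta> (butlast h, l) \<sigma>) \<subseteq> {l'. (l, \<sigma>, l') \<in> transitions G}"
      using \<beta> by (simp add: randomized_strategy2_def)
    then show ?thesis
      using False l G by (auto simp: next_state_def is_game_structure_def)
  qed
  then show ?thesis
    using \<alpha> by (fastforce simp: next_round_def randomized_strategy1_def)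
qed

lemma Ionescu_Tulcea_round_kernel:
  assumes G: "is_game_structure G"
    and \<alpha>: "randomized_strategy1 G \<alpha>" and \<beta>: "randomized_strategy2 G \<beta>"
  shows "Ionescu_Tulcea (round_kernel G \<alpha> \<beta>) (rounds_space G)"
proof -
  let ?S = "states G \<times> alphabet G"
  have fin: "finite ?S"
    using G by (simp add: is_game_structure_def)
  have PiM: "PiM {0..<i} (rounds_space G) = count_space (PiE {0..<i} (\<lambda>_. ?S))" for i
    using fin by (intro count_space_PiM_finite) (auto intro: countable_finite)
  have prob: "prob_space (round_kernel G \<alpha> \<beta> i x)" if "x \<in> PiE {0..<i} (\<lambda>_. ?S)" for i x
  proof -
    have "set (map x [0..<i]) \<subseteq> ?S"
      using that by (auto simp: PiE_iff)
    note sub = set_next_round[OF G \<alpha> \<beta> this]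
    have "emeasure (measure_pmf (next_round G \<alpha> \<beta> (map x [0..<i]))) ?S = 1"
      using sub by (intro measure_pmf.emeasure_eq_1_AE) (auto simp: AE_measure_pmf_iff)
    then show ?thesis
      unfolding round_kernel_def
      by (intro prob_spaceI) (simp add: emeasure_restrict_space space_restrict_space)
  qed
  have sets: "sets (round_kernel G \<alpha> \<beta> i x) = sets (count_space ?S)" for i x
    unfolding round_kernel_def by (auto simp: sets_restrict_space)
  show ?thesis
  proof (rule Ionescu_Tulcea.intro)
    fix i
    show "round_kernel G \<alpha> \<beta> i \<in> PiM {0..<i} (rounds_space G) \<rightarrow>\<^sub>M subprob_algebra (rounds_space G i)"
      unfolding PiM using prob sets
      by (auto simp: space_subprob_algebra prob_space_imp_subprob_space)
  next
    fix i x
    assume "x \<in> space (PiM {0..<i} (rounds_space G))"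
    then show "prob_space (round_kernel G \<alpha> \<beta> i x)"
      using prob unfolding PiM by simp
  qed
qed

section \<open>Objectives and almost-winning states\<close>

definition Buchi :: "('s, 'a, 'o) game_structure \<Rightarrow> 'o set \<Rightarrow> ('s, 'a) play set" where
  "Buchi G T = {\<pi>. \<exists>b\<in>T. \<exists>\<^sub>\<infinity>i. obs_of G (fst (\<pi> i)) = b}"

definition almost_winning :: "('s, 'a, 'o) game_structure \<Rightarrow> ('s, 'a) play set \<Rightarrow> 's \<Rightarrow> bool" where
  "almost_winning G \<phi> l \<longleftrightarrow>
     (\<exists>\<alpha>. randomized_strategy1 (start_in G l) \<alpha> \<and> observation_based (start_in G l) \<alpha> \<and>
       (\<forall>\<beta>. randomized_strategy2 (start_in G l) \<beta> \<longrightarrow>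
          measure (outcome_measure (start_in G l) \<alpha> \<beta>)
            (\<phi> \<inter> space (outcome_measure (start_in G l) \<alpha> \<beta>)) = 1))"

section \<open>Deterministic multi-tape Turing machines and EXPTIME\<close>

text \<open>States are the numbers below \<open>num_states\<close> and tape symbols those below \<open>num_symbols\<close>.
  Symbol \<open>0\<close> is the blank; the input bits \<open>False\<close> and \<open>True\<close> are the symbols \<open>1\<close> and \<open>2\<close>.
  The transition function maps the state and the scanned symbols (one per tape) to the new state
  and, for each tape, the symbol to be written and the head movement.\<close>

datatype head_move = Move_Left | Stay | Move_Right

record turing_machine =
  num_tapes :: nat
  num_states :: nat
  num_symbols :: nat
  start_state :: nat
  accept_state :: nat
  reject_state :: nat
  delta :: "nat \<Rightarrow> nat list \<Rightarrow> nat \<times> (nat \<times> head_move) list"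

definition is_turing_machine :: "turing_machine \<Rightarrow> bool" where
  "is_turing_machine M \<longleftrightarrow>
     num_tapes M \<ge> 1 \<and> num_symbols M \<ge> 3 \<and>
     start_state M < num_states M \<and> accept_state M < num_states M \<and>
     reject_state M < num_states M \<and> accept_state M \<noteq> reject_state M \<and>
     (\<forall>q<num_states M. \<forall>xs. length xs = num_tapes M \<and> set xs \<subseteq> {..<num_symbols M} \<longrightarrow>
        (case delta M q xs of (q', ws) \<Rightarrow>
           q' < num_states M \<and> length ws = num_tapes M \<and> fst ` set ws \<subseteq> {..<num_symbols M}))"

text \<open>A configuration consists of the state and, for each (two-way infinite) tape, its contents and
  head position.\<close>

type_synonym tm_config = "nat \<times> ((int \<Rightarrow> nat) \<times> int) list"

fun head_shift :: "head_move \<Rightarrow> int" where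
  "head_shift Move_Left = -1"
| "head_shift Stay = 0"
| "head_shift Move_Right = 1"

fun update_tape :: "(int \<Rightarrow> nat) \<times> int \<Rightarrow> nat \<times> head_move \<Rightarrow> (int \<Rightarrow> nat) \<times> int" where
  "update_tape (f, p) (x, d) = (f(p := x), p + head_shift d)"

definition tm_step :: "turing_machine \<Rightarrow> tm_config \<Rightarrow> tm_config" where
  "tm_step M = (\<lambda>(q, ts).
     if q = accept_state M \<or> q = reject_state M then (q, ts)
     else case delta M q (map (\<lambda>(f, p). f p) ts) of (q', ws) \<Rightarrow> (q', map2 update_tape ts ws))"

definition input_tape :: "bool list \<Rightarrow> int \<Rightarrow> nat" where
  "input_tape w p = (if 0 \<le> p \<and> p < int (length w) then if w ! nat p then 2 else 1 else 0)"

definition start_config :: "turing_machine \<Rightarrow> bool list \<Rightarrow> tm_config" where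
  "start_config M w =
     (start_state M, (input_tape w, 0) # replicate (num_tapes M - 1) (\<lambda>_. 0, 0))"

definition decides_in_time :: "turing_machine \<Rightarrow> bool list set \<Rightarrow> (nat \<Rightarrow> nat) \<Rightarrow> bool" where
  "decides_in_time M A t \<longleftrightarrow>
     (\<forall>w. \<exists>n\<le>t (length w). fst ((tm_step M ^^ n) (start_config M w)) =
        (if w \<in> A then accept_state M else reject_state M))"

definition DTIME :: "(nat \<Rightarrow> nat) \<Rightarrow> bool list set set" where
  "DTIME t = {A. \<exists>M c. is_turing_machine M \<and> decides_in_time M A (\<lambda>n. c * t n)}"

definition EXPTIME :: "bool list set set" where
  "EXPTIME = (\<Union>k. DTIME (\<lambda>n. 2 ^ (n ^ k)))"

section \<open>The decision problem\<close>

text \<open>Instances are written down with respect to enumerations \<open>ls\<close>, \<open>xs\<close>, \<open>os\<close> of the states, the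
  letters and the observations: the sizes of these sets in unary, the initial state, the incidence
  tables of \<open>\<Delta>\<close> and \<open>\<gamma>\<close>, the set \<open>T\<close>, and the state \<open>l\<close>. Since every state has a successor for
  each letter, the table of \<open>\<Delta>\<close> is at most \<open>|L|\<close> times longer than a list of the elements of \<open>\<Delta>\<close>,
  so the code has length polynomial in the size of an explicit listing.\<close>

definition unary :: "nat \<Rightarrow> bool list" where
  "unary n = replicate n True @ [False]"

definition encode_instance ::
  "'s list \<Rightarrow> 'a list \<Rightarrow> 'o list \<Rightarrow> ('s, 'a, 'o) game_structure \<Rightarrow> 'o set \<Rightarrow> 's \<Rightarrow> bool list" where
  "encode_instance ls xs os G T l =
     unary (length ls) @ unary (length xs) @ unary (length os) @
     [s = initial G. s \<leftarrow> ls] @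
     [(s, \<sigma>, s') \<in> transitions G. s \<leftarrow> ls, \<sigma> \<leftarrow> xs, s' \<leftarrow> ls] @
     [s \<in> gamma G b. b \<leftarrow> os, s \<leftarrow> ls] @
     [b \<in> T. b \<leftarrow> os] @
     [s = l. s \<leftarrow> ls]"

definition Buchi_instance ::
  "'s list \<Rightarrow> 'a list \<Rightarrow> 'o list \<Rightarrow> ('s, 'a, 'o) game_structure \<Rightarrow> 'o set \<Rightarrow> 's \<Rightarrow> bool" where
  "Buchi_instance ls xs os G T l \<longleftrightarrow>
     is_game_structure G \<and> T \<subseteq> observations G \<and> l \<in> states G \<and>
     distinct ls \<and> set ls = states G \<and> distinct xs \<and> set xs = alphabet G \<and>
     distinct os \<and> set os = observations G"

text \<open>The language of codes of positive instances. Codes do not depend on the names of states,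
  letters and observations, so it suffices to let these be natural numbers.\<close>

definition almost_winning_Buchi_problem :: "bool list set" where
  "almost_winning_Buchi_problem =
     {encode_instance ls xs os G T l | ls xs os (G :: (nat, nat, nat) game_structure) T l.
        Buchi_instance ls xs os G T l \<and> almost_winning G (Buchi G T) l}"

end

theory Submission
  imports Defs
begin

text \<open>The belief of Player 1 is the set of states that are consistent with the observations so far; a letter
  is allowed for a set \<open>Y\<close> of beliefs if it leads from the current belief to beliefs in \<open>Y\<close> only. The
  winning beliefs form the greatest fixpoint \<open>Y\<close> of the operator that keeps a belief if, for each of its
  states, playing the allowed letters uniformly at random reaches the target with positive probability
  against every opponent, which is a least fixpoint. On the winning beliefs this strategy visits
  the target within a bounded number of rounds with probability bounded away from \<open>0\<close>, hence infinitely
  often almost surely. Conversely, every belief that arises under an almost-winning strategy is winning: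
  otherwise an opponent who moves at random until a bad prefix is possible and avoids the target
  from then on would win with positive probability.

  In a code \<open>w\<close> of a game, states, letters, and beliefs are numbers below \<open>N = 2 ^ length w\<close>. So the nested
  fixpoint is definable over \<open>{..<N}\<close> by first-order definitions that are iterated \<open>N\<close> times. A Turing
  machine evaluates them in time polynomial in \<open>N\<close>: variables are head positions, and
  relations are arrays of \<open>N ^ 3\<close> truth values.\<close>

section \<open>Structured programs on tapes\<close>

text \<open>Player 1 does not see the state, so one distribution on letters must serve all states of
  the belief at once, although the letter that makes progress may differ from state to state.
  Randomising resolves this: every allowed letter has positive probability, in particular the one
  that helps the actual state, and a letter that does not help still leads to a winning belief, so
  the attempt can be repeated. This is why the fixpoint is nested and why its inner stages consist
  of pairs of a belief and a state. On the machine side, time polynomial in \<open>N\<close> pays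
  for a sweep over all cells whenever one truth value is looked up, so tapes without random access
  are good enough. The only primitives are the order and the bits of the input; addition,
  multiplication and binary digits are iterated definitions themselves. The single number
  \<open>N\<close> bounds the positions in \<open>w\<close>, the bit masks of beliefs and the
  lengths of the chains of both fixpoints: with \<open>n\<close> states the inner chain has at most
  \<open>n * 2 ^ n \<le> 2 ^ (2 * n)\<close> strict steps, and a code has more than
  \<open>2 * n\<close> bits.\<close>

datatype 't prog =
    Move "'t \<Rightarrow> head_move"
  | Write "'t set" "('t \<Rightarrow> nat) \<Rightarrow> nat"
  | Seq "'t prog" "'t prog"  (infixr \<open>;;\<close> 60)
  | Branch "('t \<Rightarrow> nat) \<Rightarrow> bool" "'t prog" "'t prog"
  | While "('t \<Rightarrow> nat) \<Rightarrow> bool" "'t prog"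

type_synonym 't tapes = "('t \<Rightarrow> int \<Rightarrow> nat) \<times> ('t \<Rightarrow> int)"

definition scan :: "'t tapes \<Rightarrow> 't \<Rightarrow> nat" where
  "scan \<sigma> t = fst \<sigma> t (snd \<sigma> t)"

text \<open>The control state is the stack of programs that remain to be executed. Only finitely many
  stacks are reachable from a program, so they can serve as the states of a Turing machine.\<close>

fun next_control :: "'t prog list \<Rightarrow> ('t \<Rightarrow> nat) \<Rightarrow> 't prog list \<times> ('t \<Rightarrow> nat \<times> head_move)" where
  "next_control [] s = ([], \<lambda>t. (s t, Stay))"
| "next_control (Move d # K) s = (K, \<lambda>t. (s t, d t))"
| "next_control (Write V g # K) s = (K, \<lambda>t. (if t \<in> V then g s else s t, Stay))"
| "next_control ((p ;; q) # K) s = (p # q # K, \<lambda>t. (s t, Stay))"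
| "next_control (Branch c p q # K) s = ((if c s then p else q) # K, \<lambda>t. (s t, Stay))"
| "next_control (While c p # K) s = ((if c s then p # While c p # K else K), \<lambda>t. (s t, Stay))"

definition tape_update :: "('t \<Rightarrow> nat \<times> head_move) \<Rightarrow> 't tapes \<Rightarrow> 't tapes" where
  "tape_update a \<sigma> = (\<lambda>t. (fst \<sigma> t)(snd \<sigma> t := fst (a t)), \<lambda>t. snd \<sigma> t + head_shift (snd (a t)))"

definition control_step :: "'t prog list \<times> 't tapes \<Rightarrow> 't prog list \<times> 't tapes" where
  "control_step = (\<lambda>(K, \<sigma>). (fst (next_control K (scan \<sigma>)), tape_update (snd (next_control K (scan \<sigma>))) \<sigma>))"

lemma tape_update_stay [simp]: "tape_update (\<lambda>t. (scan \<sigma> t, Stay)) \<sigma> = \<sigma>"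
  by (simp add: tape_update_def scan_def)

text \<open>The step count is chosen before the continuation \<open>K\<close>, so a run can be
  pasted under any stack. The number \<open>n\<close> is only an upper bound, which lets time
  estimates be weakened freely.\<close>

definition run :: "'t prog \<Rightarrow> 't tapes \<Rightarrow> nat \<Rightarrow> 't tapes \<Rightarrow> bool" where
  "run p \<sigma> n \<tau> \<longleftrightarrow> (\<exists>m\<le>n. \<forall>K. (control_step ^^ m) (p # K, \<sigma>) = (K, \<tau>))"

lemma run_mono: "run p \<sigma> n \<tau> \<Longrightarrow> n \<le> m \<Longrightarrow> run p \<sigma> m \<tau>"
  unfolding run_def by (meson le_trans)

lemma run_Move: "run (Move d) \<sigma> 1 (fst \<sigma>, \<lambda>t. snd \<sigma> t + head_shift (d t))"
  unfolding run_def
  by (rule exI[of _ 1]) (simp add: control_step_def tape_update_def scan_def)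

lemma run_Write:
  "run (Write V g) \<sigma> 1 (\<lambda>t. if t \<in> V then (fst \<sigma> t)(snd \<sigma> t := g (scan \<sigma>)) else fst \<sigma> t, snd \<sigma>)"
  unfolding run_def
  by (rule exI[of _ 1]) (auto simp: control_step_def tape_update_def scan_def fun_eq_iff)

lemma control_step_Cons [simp]:
  "control_step ((p ;; q) # K, \<sigma>) = (p # q # K, \<sigma>)"
  "control_step (Branch c p q # K, \<sigma>) = ((if c (scan \<sigma>) then p else q) # K, \<sigma>)"
  "control_step (While c p # K, \<sigma>) = ((if c (scan \<sigma>) then p # While c p # K else K), \<sigma>)"
  by (simp_all add: control_step_def)

lemma run_Seq:
  assumes "run p \<sigma> m \<tau>" "run q \<tau> n \<rho>"
  shows "run (p ;; q) \<sigma> (m + n + 1) \<rho>"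
proof -
  obtain m' n' where m: "m' \<le> m" "\<And>K. (control_step ^^ m') (p # K, \<sigma>) = (K, \<tau>)"
    and n: "n' \<le> n" "\<And>K. (control_step ^^ n') (q # K, \<tau>) = (K, \<rho>)"
    using assms unfolding run_def by blast
  have "(control_step ^^ (n' + m' + 1)) ((p ;; q) # K, \<sigma>) = (K, \<rho>)" for K
    unfolding funpow_add by (simp add: m n)
  then show ?thesis
    unfolding run_def using m(1) n(1) by (intro exI[of _ "n' + m' + 1"]) auto
qed

lemma run_Branch:
  assumes "run (if c (scan \<sigma>) then p else q) \<sigma> n \<tau>"
  shows "run (Branch c p q) \<sigma> (n + 1) \<tau>"
proof -
  obtain m where m: "m \<le> n" "\<And>K. (control_step ^^ m) ((if c (scan \<sigma>) then p else q) # K, \<sigma>) = (K, \<tau>)"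
    using assms unfolding run_def by blast
  have "(control_step ^^ (m + 1)) (Branch c p q # K, \<sigma>) = (K, \<tau>)" for K
    unfolding funpow_add using m(2)[of K] by simp
  then show ?thesis
    unfolding run_def using m(1) by (intro exI[of _ "m + 1"]) auto
qed

lemma run_While_exit: "\<not> c (scan \<sigma>) \<Longrightarrow> run (While c p) \<sigma> 1 \<sigma>"
  unfolding run_def by (rule exI[of _ 1]) simp

lemma run_While_step:
  assumes "c (scan \<sigma>)" "run p \<sigma> m \<tau>" "run (While c p) \<tau> n \<rho>"
  shows "run (While c p) \<sigma> (m + n + 1) \<rho>"
proof -
  obtain m' n' where m: "m' \<le> m" "\<And>K. (control_step ^^ m') (p # K, \<sigma>) = (K, \<tau>)"
    and n: "n' \<le> n" "\<And>K. (control_step ^^ n') (While c p # K, \<tau>) = (K, \<rho>)"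
    using assms unfolding run_def by blast
  have "(control_step ^^ (n' + m' + 1)) (While c p # K, \<sigma>) = (K, \<rho>)" for K
    unfolding funpow_add using assms(1) by (simp add: m n)
  then show ?thesis
    unfolding run_def using m(1) n(1) by (intro exI[of _ "n' + m' + 1"]) auto
qed

lemma run_While:
  assumes "\<And>k. k < n \<Longrightarrow> c (scan (\<sigma> k))"
    and "\<And>k. k < n \<Longrightarrow> run p (\<sigma> k) m (\<sigma> (Suc k))"
    and "\<not> c (scan (\<sigma> n))"
  shows "run (While c p) (\<sigma> 0) (n * (m + 1) + 1) (\<sigma> n)"
proof -
  \<comment> \<open>Induction on the number \<open>j\<close> of rounds still to come, because
    \<open>run_While_step\<close> adds a round in front.\<close>
  have "run (While c p) (\<sigma> (n - j)) (j * (m + 1) + 1) (\<sigma> n)" if "j \<le> n" for j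
    using that
  proof (induction j)
    case 0
    then show ?case using run_While_exit[of c "\<sigma> n", OF assms(3)] by simp
  next
    case (Suc j)
    have "Suc (n - Suc j) = n - j" using Suc by simp
    then have "run p (\<sigma> (n - Suc j)) m (\<sigma> (n - j))"
      using assms(2)[of "n - Suc j"] Suc by simp
    moreover have "run (While c p) (\<sigma> (n - j)) (j * (m + 1) + 1) (\<sigma> n)"
      using Suc by simp
    ultimately show ?case
      using run_While_step[of c "\<sigma> (n - Suc j)" p m "\<sigma> (n - j)" "j * (m + 1) + 1" "\<sigma> n"] assms(1) Suc
      by (simp add: algebra_simps)
  qed
  from this[of n] show ?thesis by simp
qed

subsection \<open>Compilation to Turing machines\<close>

text \<open>The programs below live on infinitely many tapes, a Turing machine has finitely many. It
  is enough to restrict what is read to \<open>T\<close>: whatever happens on other tapes can then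
  influence neither the control nor the tapes in \<open>T\<close>.\<close>

definition depends_on :: "'t set \<Rightarrow> (('t \<Rightarrow> nat) \<Rightarrow> 'b) \<Rightarrow> bool" where
  "depends_on T g \<longleftrightarrow> (\<forall>s s'. (\<forall>t\<in>T. s t = s' t) \<longrightarrow> g s = g s')"

text \<open>The bound \<open>3\<close> is the number of tape symbols of the compiled
  machine.\<close>

fun wf_prog :: "'t set \<Rightarrow> 't prog \<Rightarrow> bool" where
  "wf_prog T (Move d) = True"
| "wf_prog T (Write V g) = (depends_on T g \<and> (\<forall>s. (\<forall>t. s t < 3) \<longrightarrow> g s < 3))"
| "wf_prog T (p ;; q) = (wf_prog T p \<and> wf_prog T q)"
| "wf_prog T (Branch c p q) = (depends_on T c \<and> wf_prog T p \<and> wf_prog T q)"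
| "wf_prog T (While c p) = (depends_on T c \<and> wf_prog T p)"

text \<open>The stacks met while \<open>p\<close> is executed and before \<open>K\<close> itself
  comes up; hence the extra case \<open>{K}\<close> in \<open>next_control_controls\<close>. The set
  is finite because a loop always pushes the same copy of itself.\<close>

fun controls :: "'t prog \<Rightarrow> 't prog list \<Rightarrow> 't prog list set" where
  "controls (Move d) K = {Move d # K}"
| "controls (Write V g) K = {Write V g # K}"
| "controls (p ;; q) K = {(p ;; q) # K} \<union> controls p (q # K) \<union> controls q K"
| "controls (Branch c p q) K = {Branch c p q # K} \<union> controls p K \<union> controls q K"
| "controls (While c p) K = {While c p # K} \<union> controls p (While c p # K)"

lemma finite_controls: "finite (controls p K)"
  by (induction p arbitrary: K) auto

lemma controls_self: "p # K \<in> controls p K"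
  by (cases p) auto

lemma next_control_controls:
  "L \<in> controls p K \<Longrightarrow> fst (next_control L s) \<in> controls p K \<union> {K}"
proof (induction p arbitrary: K)
  case (Seq p q)
  then show ?case using controls_self[of p "q # K"] controls_self[of q K] by fastforce
next
  case (Branch c p q)
  from Branch.prems consider "L = Branch c p q # K" | "L \<in> controls p K" | "L \<in> controls q K"
    by auto
  then show ?case
    using Branch.IH(1)[of K] Branch.IH(2)[of K] controls_self[of p K] controls_self[of q K]
    by cases (auto)
next
  case (While c p)
  then show ?case using controls_self[of p "While c p # K"] by fastforce
qed auto

lemma controls_wf:
  "L \<in> controls p K \<Longrightarrow> wf_prog T p \<Longrightarrow> (\<forall>q\<in>set K. wf_prog T q) \<Longrightarrow> \<forall>q\<in>set L. wf_prog T q"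
proof (induction p arbitrary: K)
  case (Seq p q)
  from Seq.prems(1) consider "L = (p ;; q) # K" | "L \<in> controls p (q # K)" | "L \<in> controls q K" by auto
  then show ?case
    using Seq.prems(2,3) Seq.IH(1)[of "q # K"] Seq.IH(2)[of K] by cases simp_all
next
  case (Branch c p q)
  from Branch.prems(1) consider "L = Branch c p q # K" | "L \<in> controls p K" | "L \<in> controls q K" by auto
  then show ?case
    using Branch.prems(2,3) Branch.IH(1)[of K] Branch.IH(2)[of K] by cases simp_all
next
  case (While c p)
  from While.prems(1) consider "L = While c p # K" | "L \<in> controls p (While c p # K)" by auto
  then show ?case
    using While.prems(2,3) While.IH[of "While c p # K"] by cases simp_all
qed auto

definition symbols :: "'t list \<Rightarrow> nat list \<Rightarrow> 't \<Rightarrow> nat" where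
  "symbols ts xs t = (case map_of (zip ts xs) t of None \<Rightarrow> 0 | Some x \<Rightarrow> x)"

lemma symbols_map: "symbols ts (map f ts) = (\<lambda>t. if t \<in> set ts then f t else 0)"
  by (simp add: symbols_def map_of_zip_map fun_eq_iff)

lemma symbols_less: "set xs \<subseteq> {..<k} \<Longrightarrow> 0 < k \<Longrightarrow> symbols ts xs t < k"
  by (auto simp: symbols_def split: option.splits dest!: map_of_SomeD set_zip_rightD)

lemma next_control_cong:
  assumes "\<forall>q\<in>set K. wf_prog T q" "\<forall>t\<in>T. s t = s' t"
  shows "fst (next_control K s) = fst (next_control K s')"
    and "t \<in> T \<Longrightarrow> snd (next_control K s) t = snd (next_control K s') t"
  using assms
  by (induction K s rule: next_control.induct) (auto simp: depends_on_def)

lemma next_control_less: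
  assumes "\<forall>q\<in>set K. wf_prog T q" "\<And>t. s t < 3"
  shows "fst (snd (next_control K s) t) < 3"
  using assms
  by (induction K s rule: next_control.induct) auto

text \<open>The stacks in \<open>C\<close> are numbered by \<open>h\<close> and become machine
  states; \<open>k\<close> and \<open>k + 1\<close> are the halting states. The empty stack is an
  ordinary state from which one more step inspects \<open>flag\<close>, which turns the constant
  \<open>c\<close> into \<open>c + 1\<close>.\<close>

lemma DTIME_I:
  fixes p :: "'t prog"
  assumes ts: "distinct ts" "ts \<noteq> []" "hd ts = inp" and flag: "flag \<in> set ts"
    and wf: "wf_prog (set ts) p"
    and f: "\<And>n. f n \<ge> 1"
    and run: "\<And>w. \<exists>\<tau>. run p (\<lambda>t. if t = inp then input_tape w else (\<lambda>_. 0), \<lambda>_. 0) (c * f (length w)) \<tau> \<and>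
        (scan \<tau> flag = 1 \<longleftrightarrow> w \<in> A)"
  shows "A \<in> DTIME f"
proof -
  define C where "C = controls p [] \<union> {[]}"
  define k where "k = card C"
  have "finite C" by (simp add: C_def finite_controls)
  then obtain h where h: "bij_betw h C {0..<k}"
    using ex_bij_betw_finite_nat unfolding k_def by blast
  have hk: "h L < k" if "L \<in> C" for L
    using h that by (auto simp: bij_betw_def)
  have hinv [simp]: "inv_into C h (h L) = L" if "L \<in> C" for L
    using h that by (simp add: bij_betw_def)
  have invC: "inv_into C h q \<in> C" if "q < k" for q
    using h that by (metis atLeastLessThan_iff bij_betw_def inv_into_into zero_le)
  have Cwf: "\<forall>q\<in>set L. wf_prog (set ts) q" if "L \<in> C" for L
    using that controls_wf[of L p "[]" "set ts"] wf by (auto simp: C_def)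
  have Cnext: "fst (next_control L s) \<in> C" if "L \<in> C" for L s
    using that next_control_controls[of L p "[]" s] by (auto simp: C_def)
  have pC: "[p] \<in> C" by (simp add: C_def controls_self)
  \<comment> \<open>The second branch handles the empty stack; for halting states and numbers out of
    range it only has to return something well-formed.\<close>
  define D where "D q xs =
     (let s = symbols ts xs in
      if q < k \<and> inv_into C h q \<noteq> [] then
        (h (fst (next_control (inv_into C h q) s)), map (snd (next_control (inv_into C h q) s)) ts)
      else (if s flag = 1 then k else k + 1, map (\<lambda>t. (s t, Stay)) ts))" for q xs
  define M where "M = \<lparr>num_tapes = length ts, num_states = k + 2, num_symbols = 3,
     start_state = h [p], accept_state = k, reject_state = k + 1, delta = D\<rparr>"
  have "is_turing_machine M"
  proof -
    have "case D q xs of (q', ws) \<Rightarrow> q' < k + 2 \<and> length ws = length ts \<and> fst ` set ws \<subseteq> {..<3}"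
      if "set xs \<subseteq> {..<3}" for q xs
    proof (cases "q < k \<and> inv_into C h q \<noteq> []")
      case True
      with invC have L: "inv_into C h q \<in> C" by blast
      have "fst (snd (next_control (inv_into C h q) (symbols ts xs)) t) < 3" for t
        by (intro next_control_less[OF Cwf[OF L]] symbols_less[OF that]) simp
      then show ?thesis
        using True hk[OF Cnext[OF L]] by (auto simp: D_def Let_def less_Suc_eq)
    next
      case False
      then show ?thesis
        using symbols_less[OF that] by (auto simp: D_def Let_def)
    qed
    then show ?thesis
      using ts hk[OF pC] by (auto simp: is_turing_machine_def M_def Suc_le_eq)
  qed
  moreover have "decides_in_time M A (\<lambda>n. (c + 1) * f n)"
    unfolding decides_in_time_def
  proof
    fix w
    define conf where "conf = (\<lambda>(L, \<sigma>). (h L, map (\<lambda>t. (fst \<sigma> t, snd \<sigma> t)) ts) :: tm_config)"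
    \<comment> \<open>An empty stack stays put under \<open>control_step\<close>, while the machine
      would move on to a halting state. The idle steps are therefore dropped on the machine side,
      which gives some \<open>n \<le> m\<close> instead of \<open>n = m\<close>.\<close>
    have eqn: "\<exists>n\<le>m. (tm_step M ^^ n) (conf (L, \<sigma>)) = conf ((control_step ^^ m) (L, \<sigma>)) \<and>
      fst ((control_step ^^ m) (L, \<sigma>)) \<in> C"
      if "L \<in> C" for m L \<sigma>
    proof (induction m)
      case 0
      then show ?case using that by simp
    next
      case (Suc m)
      then obtain n where n: "n \<le> m" "(tm_step M ^^ n) (conf (L, \<sigma>)) = conf ((control_step ^^ m) (L, \<sigma>))"
         "fst ((control_step ^^ m) (L, \<sigma>)) \<in> C" by blast
      obtain L' \<sigma>' where L': "(control_step ^^ m) (L, \<sigma>) = (L', \<sigma>')"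
        by (meson surj_pair)
      with n have L'C: "L' \<in> C" by simp
      show ?case
      proof (cases "L' = []")
        case True
        then have "(control_step ^^ Suc m) (L, \<sigma>) = (L', \<sigma>')"
          using L' by (simp add: control_step_def)
        then show ?thesis using n L' by (metis le_Suc_eq)
      next
        case False
        let ?s = "symbols ts (map (scan \<sigma>') ts)"
        have s: "\<forall>t\<in>set ts. ?s t = scan \<sigma>' t" by (simp add: symbols_map)
        note cong = next_control_cong[OF Cwf[OF L'C] s]
        have "D (h L') (map (scan \<sigma>') ts) =
            (h (fst (next_control L' (scan \<sigma>'))), map (snd (next_control L' (scan \<sigma>'))) ts)"
          using hk[OF L'C] L'C False cong by (simp add: D_def Let_def)
        moreover have "map (\<lambda>(f, p). f p) (map (\<lambda>t. (fst \<sigma>' t, snd \<sigma>' t)) ts) = map (scan \<sigma>') ts"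
          by (simp add: scan_def)
        moreover have "update_tape (f, p) a = (f(p := fst a), p + head_shift (snd a))" for f p a
          by (cases a) simp
        ultimately have "tm_step M (conf (L', \<sigma>')) = conf (control_step (L', \<sigma>'))"
          using hk[OF L'C]
          by (simp add: tm_step_def conf_def M_def control_step_def tape_update_def
              map2_map_map del: map_map)
        then have "(tm_step M ^^ Suc n) (conf (L, \<sigma>)) = conf ((control_step ^^ Suc m) (L, \<sigma>))"
          using n(2) L' by simp
        moreover have "fst ((control_step ^^ Suc m) (L, \<sigma>)) \<in> C"
          using L' Cnext[OF L'C] by (simp add: control_step_def)
        ultimately show ?thesis using n(1) by (meson Suc_le_mono)
      qed
    qed
    let ?\<sigma> = "(\<lambda>t. if t = inp then input_tape w else (\<lambda>_. 0), \<lambda>_. 0) :: 't tapes"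
    obtain \<tau> m where m: "m \<le> c * f (length w)" "\<And>K. (control_step ^^ m) (p # K, ?\<sigma>) = (K, \<tau>)"
      and A: "scan \<tau> flag = 1 \<longleftrightarrow> w \<in> A"
      using run[of w] unfolding run_def by blast
    obtain n where n: "n \<le> m" "(tm_step M ^^ n) (conf ([p], ?\<sigma>)) = conf ([], \<tau>)" "[] \<in> C"
      using eqn[OF pC, of m ?\<sigma>] m(2)[of "[]"] by auto
    have "start_config M w = conf ([p], ?\<sigma>)"
    proof -
      obtain ts' where ts': "ts = inp # ts'" "inp \<notin> set ts'"
        using ts by (cases ts) auto
      then have "map (\<lambda>t. (fst ?\<sigma> t, snd ?\<sigma> t)) ts' = replicate (length ts') (\<lambda>_. 0, 0)"
        by (auto simp: map_replicate_const[symmetric] simp del: map_replicate_const intro!: map_cong)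
      then show ?thesis using ts' by (simp add: start_config_def conf_def M_def)
    qed
    moreover have "fst (tm_step M (conf ([], \<tau>))) = (if w \<in> A then k else k + 1)"
    proof -
      have "map (\<lambda>(f, p). f p) (map (\<lambda>t. (fst \<tau> t, snd \<tau> t)) ts) = map (scan \<tau>) ts"
        by (simp add: scan_def)
      moreover have "fst (D (h []) (map (scan \<tau>) ts)) = (if w \<in> A then k else k + 1)"
        using flag A n(3) by (simp add: D_def Let_def symbols_map)
      ultimately show ?thesis
        using hk[OF n(3)]
        by (simp add: tm_step_def conf_def M_def case_prod_beta del: map_map)
    qed
    ultimately have "fst ((tm_step M ^^ Suc n) (start_config M w)) = (if w \<in> A then k else k + 1)"
      using n(2) by simp
    \<comment> \<open>The extra step that reads the flag is paid for by
      \<open>f (length w) \<ge> 1\<close>.\<close>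
    moreover have "Suc n \<le> (c + 1) * f (length w)"
      using n(1) m(1) f[of "length w"] by simp
    ultimately show "\<exists>n\<le>(c + 1) * f (length w). fst ((tm_step M ^^ n) (start_config M w)) =
        (if w \<in> A then accept_state M else reject_state M)"
      by (intro exI[of _ "Suc n"]) (simp add: M_def)
  qed
  ultimately show ?thesis
    unfolding DTIME_def by blast
qed

section \<open>Evaluating first-order definitions on tapes\<close>

datatype tape = Inp | Flag | Flag2 | Scratch | Arr nat | Var nat

lemma all_tape: "(\<forall>t. P t) \<longleftrightarrow> P Inp \<and> P Flag \<and> P Flag2 \<and> P Scratch \<and> (\<forall>j. P (Arr j)) \<and> (\<forall>i. P (Var i))"
  by (metis tape.exhaust)

text \<open>\<open>flag\<close> carries truth values, \<open>flag2\<close> the value found during a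
  table lookup, and \<open>spos\<close> counts steps so that heads can be restored.
  \<open>apos\<close> and \<open>ipos\<close> are integers because these heads step to
  \<open>-1\<close>.\<close>

record mstate =
  env :: "nat \<Rightarrow> nat"
  cells :: "nat \<Rightarrow> nat \<Rightarrow> bool"
  flag :: bool
  flag2 :: bool
  apos :: "nat \<Rightarrow> int"
  spos :: nat
  ipos :: int

text \<open>The value of a variable is the head position on its tape; the tape of variable \<open>i\<close> carries
  the mark \<open>1\<close> at \<open>0\<close> and the mark \<open>2\<close> at \<open>m i\<close> (no mark \<open>2\<close> if \<open>m i = 0\<close>). An array has the
  mark \<open>2\<close> to the left of its cells.\<close>

fun contents :: "(nat \<Rightarrow> nat) \<Rightarrow> bool list \<Rightarrow> mstate \<Rightarrow> tape \<Rightarrow> int \<Rightarrow> nat" where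
  "contents m w S Inp = input_tape w"
| "contents m w S Flag = (\<lambda>p. if p = 0 \<and> flag S then 1 else 0)"
| "contents m w S Flag2 = (\<lambda>p. if p = 0 \<and> flag2 S then 1 else 0)"
| "contents m w S Scratch = (\<lambda>p. if p = 0 then 1 else 0)"
| "contents m w S (Arr j) = (\<lambda>p. if p = -1 then 2 else if 0 \<le> p \<and> cells S j (nat p) then 1 else 0)"
| "contents m w S (Var i) = (\<lambda>p. if p = 0 then 1 else if p = int (m i) then 2 else 0)"

fun heads :: "mstate \<Rightarrow> tape \<Rightarrow> int" where
  "heads S Inp = ipos S"
| "heads S Flag = 0"
| "heads S Flag2 = 0"
| "heads S Scratch = int (spos S)"
| "heads S (Arr j) = apos S j"
| "heads S (Var i) = int (env S i)"

definition conf :: "(nat \<Rightarrow> nat) \<Rightarrow> bool list \<Rightarrow> mstate \<Rightarrow> tape tapes" where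
  "conf m w S = (contents m w S, heads S)"

definition move :: "tape set \<Rightarrow> tape set \<Rightarrow> tape prog" where
  "move L R = Move (\<lambda>t. if t \<in> L then Move_Left else if t \<in> R then Move_Right else Stay)"

abbreviation skip :: "tape prog" where "skip \<equiv> move {} {}"

lemma scan_conf: "scan (conf m w S) t = contents m w S t (heads S t)"
  by (simp add: scan_def conf_def)

lemma scan_conf_simps [simp]:
  "scan (conf m w S) Flag = (if flag S then 1 else 0)"
  "scan (conf m w S) Flag2 = (if flag2 S then 1 else 0)"
  "scan (conf m w S) Scratch = (if spos S = 0 then 1 else 0)"
  "scan (conf m w S) (Var i) = (if env S i = 0 then 1 else if env S i = m i then 2 else 0)"
  "scan (conf m w S) Inp = input_tape w (ipos S)"
  "scan (conf m w S) (Arr j) = (if apos S j = -1 then 2 else if 0 \<le> apos S j \<and> cells S j (nat (apos S j))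
    then 1 else 0)"
  by (simp_all add: scan_conf)

lemma run_move:
  assumes "cells S' = cells S" "flag S' = flag S" "flag2 S' = flag2 S"
    and "\<forall>t. heads S' t = heads S t + (if t \<in> L then -1 else if t \<in> R then 1 else 0)"
  shows "run (move L R) (conf m w S) 1 (conf m w S')"
proof -
  have "contents m w S' t = contents m w S t" for t
    using assms by (cases t) auto
  then have "contents m w S' = contents m w S" by blast
  moreover have "heads S' = (\<lambda>t. heads S t + head_shift
    (if t \<in> L then Move_Left else if t \<in> R then Move_Right else Stay))"
    using assms(4) by (auto simp: fun_eq_iff)
  ultimately show ?thesis
    using run_Move[of _ "conf m w S"] by (simp add: conf_def move_def)
qed

lemma run_skip: "run skip (conf m w S) 1 (conf m w S)"
  by (rule run_move) auto

lemma run_write: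
  assumes "heads S' = heads S"
    and "\<forall>t. contents m' w S' t = (if t \<in> V then (contents m w S t)(heads S t := g (scan (conf m w S)))
      else contents m w S t)"
  shows "run (Write V g) (conf m w S) 1 (conf m' w S')"
proof -
  have "contents m' w S' = (\<lambda>t. if t \<in> V then (contents m w S t)(heads S t := g (scan (conf m w S)))
    else contents m w S t)"
    using assms(2) by (simp add: fun_eq_iff)
  then show ?thesis
    using run_Write[of V g "conf m w S"] assms(1)
    by (simp add: conf_def cong: if_cong)
qed

lemma run_write_Flag:
  "g (scan (conf m w S)) = (if b then 1 else 0) \<Longrightarrow>
    run (Write {Flag} g) (conf m w S) 1 (conf m w (S\<lparr>flag := b\<rparr>))"
  by (rule run_write) (auto simp: all_tape fun_eq_iff elim!: heads.elims)

lemma run_write_Flag2: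
  "g (scan (conf m w S)) = (if b then 1 else 0) \<Longrightarrow>
    run (Write {Flag2} g) (conf m w S) 1 (conf m w (S\<lparr>flag2 := b\<rparr>))"
  by (rule run_write) (auto simp: all_tape fun_eq_iff elim!: heads.elims)

lemma run_write_Arr:
  "g (scan (conf m w S)) = (if b then 1 else 0) \<Longrightarrow> 0 \<le> apos S j \<Longrightarrow>
    run (Write {Arr j} g) (conf m w S) 1
      (conf m w (S\<lparr>cells := (cells S)(j := (cells S j)(nat (apos S j) := b))\<rparr>))"
  by (rule run_write) (auto simp: all_tape fun_eq_iff elim!: heads.elims)

section \<open>Loops over the universe and over the cells of an array\<close>

definition rewind :: "nat \<Rightarrow> tape prog" where
  "rewind v = While (\<lambda>s. s (Var v) \<noteq> 1) (move {Var v} {})"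

lemma run_rewind:
  assumes "env S v \<le> n"
  shows "run (rewind v) (conf m w S) (2 * n + 1) (conf m w (S\<lparr>env := (env S)(v := 0)\<rparr>))"
proof -
  let ?\<sigma> = "\<lambda>k. conf m w (S\<lparr>env := (env S)(v := env S v - k)\<rparr>)"
  have "run (rewind v) (?\<sigma> 0) (env S v * (1 + 1) + 1) (?\<sigma> (env S v))"
    unfolding rewind_def
    by (rule run_While[where \<sigma> = ?\<sigma>], simp, rule run_move) (auto simp: all_tape)
  then have "run (rewind v) (conf m w S) (env S v * (1 + 1) + 1) (conf m w (S\<lparr>env := (env S)(v := 0)\<rparr>))"
    by simp
  then show ?thesis
    by (rule run_mono) (use assms in simp)
qed

definition For :: "nat \<Rightarrow> tape prog \<Rightarrow> tape prog" where
  "For v p = While (\<lambda>s. s (Var v) \<noteq> 2) (p ;; move {} {Var v}) ;; rewind v"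

text \<open>\<open>S k\<close> is the state after \<open>k\<close> rounds, up to the head of
  \<open>v\<close>. The premise \<open>N > 0\<close> matters: at \<open>0\<close> the mark
  \<open>1\<close> takes precedence, so for \<open>N = 0\<close> there would be no mark
  \<open>2\<close> to stop the loop.\<close>

lemma run_For:
  assumes body: "\<And>k. k < N \<Longrightarrow> run p (conf (\<lambda>_. N) w ((S k)\<lparr>env := (env (S k))(v := k)\<rparr>)) c
      (conf (\<lambda>_. N) w ((S (Suc k))\<lparr>env := (env (S (Suc k)))(v := k)\<rparr>))"
    and "N > 0"
  shows "run (For v p) (conf (\<lambda>_. N) w ((S 0)\<lparr>env := (env (S 0))(v := 0)\<rparr>)) (N * (c + 3) + 2 * N + 3)
     (conf (\<lambda>_. N) w ((S N)\<lparr>env := (env (S N))(v := 0)\<rparr>))"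
proof -
  let ?\<sigma> = "\<lambda>k. conf (\<lambda>_. N) w ((S k)\<lparr>env := (env (S k))(v := k)\<rparr>)"
  have step: "run (p ;; move {} {Var v}) (?\<sigma> k) (c + 1 + 1) (?\<sigma> (Suc k))" if "k < N" for k
    by (rule run_Seq[OF body[OF that]]) (rule run_move, auto simp: all_tape)
  have "run (While (\<lambda>s. s (Var v) \<noteq> 2) (p ;; move {} {Var v})) (?\<sigma> 0) (N * (c + 1 + 1 + 1) + 1) (?\<sigma> N)"
    by (rule run_While[where \<sigma> = ?\<sigma>, OF _ step]) (use assms(2) in auto)
  moreover have "run (rewind v) (?\<sigma> N) (2 * N + 1) (conf (\<lambda>_. N) w ((S N)\<lparr>env := (env (S N))(v := 0)\<rparr>))"
    using run_rewind[of "(S N)\<lparr>env := (env (S N))(v := N)\<rparr>" v N "\<lambda>_. N" w] by simp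
  ultimately show ?thesis
    unfolding For_def using run_mono[OF run_Seq] by (fastforce simp: algebra_simps)
qed

definition rewind_arr :: "nat \<Rightarrow> tape prog" where
  "rewind_arr j = While (\<lambda>s. s (Arr j) \<noteq> 2) (move {Arr j} {}) ;; move {} {Arr j}"

lemma run_rewind_arr:
  assumes "apos S j = int n"
  shows "run (rewind_arr j) (conf m w S) (2 * n + 5) (conf m w (S\<lparr>apos := (apos S)(j := 0)\<rparr>))"
proof -
  let ?\<sigma> = "\<lambda>k. conf m w (S\<lparr>apos := (apos S)(j := int n - int k)\<rparr>)"
  have "run (While (\<lambda>s. s (Arr j) \<noteq> 2) (move {Arr j} {})) (?\<sigma> 0) (Suc n * (1 + 1) + 1) (?\<sigma> (Suc n))"
    by (rule run_While[where \<sigma> = ?\<sigma>], simp, rule run_move) (auto simp: all_tape)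
  moreover have "?\<sigma> 0 = conf m w S" using assms by (simp flip: assms)
  moreover have "run (move {} {Arr j}) (?\<sigma> (Suc n)) 1 (conf m w (S\<lparr>apos := (apos S)(j := 0)\<rparr>))"
    by (rule run_move) (auto simp: all_tape)
  ultimately show ?thesis
    unfolding rewind_arr_def using run_mono[OF run_Seq] by (fastforce simp: algebra_simps)
qed

text \<open>The array head advances in step with three nested counters, so that at cell
  \<open>k\<close> the variables \<open>a\<close>, \<open>b\<close>, \<open>c\<close> are the
  base-\<open>N\<close> digits of \<open>k\<close>.\<close>

definition sweep :: "nat \<Rightarrow> nat \<Rightarrow> nat \<Rightarrow> nat \<Rightarrow> tape prog \<Rightarrow> tape prog" where
  "sweep a b c j p = For a (For b (For c (p ;; move {} {Arr j}))) ;; rewind_arr j"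

text \<open>\<open>f\<close> is the price of one \<open>For\<close> as a function of the price of
  its body; the remaining terms pay for the way back of the array head over \<open>N ^ 3\<close>
  cells.\<close>

definition sweep_cost :: "nat \<Rightarrow> nat \<Rightarrow> nat" where
  "sweep_cost N n = (let f = (\<lambda>c. N * (c + 3) + 2 * N + 3) in f (f (f (n + 2))) + 2 * N ^ 3 + 6)"

definition at_cell :: "nat \<Rightarrow> nat \<Rightarrow> nat \<Rightarrow> nat \<Rightarrow> nat \<Rightarrow> nat \<Rightarrow> mstate \<Rightarrow> mstate" where
  "at_cell N a b c j k S = S\<lparr>apos := (apos S)(j := int k),
     env := (env S)(a := k div N ^ 2, b := k div N mod N, c := k mod N)\<rparr>"

lemma run_sweep:
  assumes body: "\<And>k. k < N ^ 3 \<Longrightarrow> run p (conf (\<lambda>_. N) w (at_cell N a b c j k (S k))) n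
      (conf (\<lambda>_. N) w (at_cell N a b c j k (S (Suc k))))"
    and N: "N > 0" and abc: "a \<noteq> b" "a \<noteq> c" "b \<noteq> c"
  shows "run (sweep a b c j p) (conf (\<lambda>_. N) w (at_cell N a b c j 0 (S 0))) (sweep_cost N n)
     (conf (\<lambda>_. N) w (at_cell N a b c j 0 (S (N ^ 3))))"
proof -
  let ?f = "\<lambda>c. N * (c + 3) + 2 * N + 3"
  let ?at = "\<lambda>x y z k. (S k)\<lparr>apos := (apos (S k))(j := int k), env := (env (S k))(a := x, b := y, c := z)\<rparr>"
  have at: "at_cell N a b c j ((x * N + y) * N + z) (S k) =
    (S k)\<lparr>apos := (apos (S k))(j := int ((x * N + y) * N + z)), env := (env (S k))(a := x, b := y, c := z)\<rparr>"
    if "y < N" "z < N" for x y z k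
  proof -
    have "((x * N + y) * N + z) div N = x * N + y" using that N by simp
    moreover have "((x * N + y) * N + z) div N ^ 2 = x"
      using that N by (simp add: power2_eq_square div_mult2_eq)
    ultimately show ?thesis using that N by (simp add: at_cell_def)
  qed
  have inner: "run (p ;; move {} {Arr j}) (conf (\<lambda>_. N) w (?at x y z ((x * N + y) * N + z))) (n + 1 + 1)
      (conf (\<lambda>_. N) w (?at x y z (Suc ((x * N + y) * N + z))))"
    if "x < N" "y < N" "z < N" for x y z
  proof -
    have k: "(x * N + y) * N + z < N ^ 3"
    proof -
      have 1: "u * N + v < M * N" if "u < M" "v < N" for u v M
      proof -
        have "u * N + v < Suc u * N" using that by simp
        also have "\<dots> \<le> M * N" using that by (intro mult_le_mono) auto
        finally show ?thesis .
      qed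
      have "(x * N + y) * N + z < N * N * N" using 1 that by blast
      then show ?thesis by (simp add: power3_eq_cube)
    qed
    show ?thesis
      by (rule run_Seq[OF body[OF k, unfolded at[OF that(2,3)]]]) (rule run_move, auto simp: all_tape)
  qed
  have l1: "run (For c (p ;; move {} {Arr j})) (conf (\<lambda>_. N) w (?at x y 0 ((x * N + y) * N))) (?f (n + 2))
      (conf (\<lambda>_. N) w (?at x y 0 ((x * N + Suc y) * N)))" if "x < N" "y < N" for x y
    using run_For[of N "p ;; move {} {Arr j}" w "\<lambda>z. ?at x y 0 ((x * N + y) * N + z)" c "n + 2"]
      inner[OF that] N abc by (simp add: fun_upd_twist algebra_simps)
  have l2: "run (For b (For c (p ;; move {} {Arr j}))) (conf (\<lambda>_. N) w (?at x 0 0 (x * N * N)))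
    (?f (?f (n + 2)))
      (conf (\<lambda>_. N) w (?at x 0 0 (Suc x * N * N)))" if "x < N" for x
    using run_For[of N "For c (p ;; move {} {Arr j})" w "\<lambda>y. ?at x 0 0 ((x * N + y) * N)" b "?f (n + 2)"]
      l1[OF that] N abc by (simp add: fun_upd_twist algebra_simps)
  have l3: "run (For a (For b (For c (p ;; move {} {Arr j})))) (conf (\<lambda>_. N) w (?at 0 0 0 0))
    (?f (?f (?f (n + 2))))
      (conf (\<lambda>_. N) w (?at 0 0 0 (N * N * N)))"
    using run_For[of N "For b (For c (p ;; move {} {Arr j}))" w "\<lambda>x. ?at 0 0 0 (x * N * N)" a "?f (?f (n + 2))"]
      l2 N abc by (simp add: fun_upd_twist algebra_simps)
  have "run (rewind_arr j) (conf (\<lambda>_. N) w (?at 0 0 0 (N * N * N))) (2 * (N * N * N) + 5)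
      (conf (\<lambda>_. N) w (at_cell N a b c j 0 (S (N ^ 3))))"
  proof -
    let ?T = "?at 0 0 0 (N * N * N)"
    have eq: "?T\<lparr>apos := (apos ?T)(j := 0)\<rparr> = at_cell N a b c j 0 (S (N ^ 3))"
      by (simp add: at_cell_def power3_eq_cube)
    show ?thesis
      unfolding eq[symmetric] by (rule run_rewind_arr) simp
  qed
  from run_Seq[OF l3 this] have "run (sweep a b c j p) (conf (\<lambda>_. N) w (?at 0 0 0 0)) (sweep_cost N n)
      (conf (\<lambda>_. N) w (at_cell N a b c j 0 (S (N ^ 3))))"
    unfolding sweep_def sweep_cost_def Let_def by (rule run_mono) (simp add: power3_eq_cube)
  then show ?thesis by (simp add: at_cell_def)
qed


subsection \<open>Formulas\<close>

datatype fm =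
    Less nat nat
  | Input bool nat
  | Rel nat nat nat nat
  | Neg fm
  | And fm fm
  | Ex nat fm

text \<open>Variables range over \<open>{..<N}\<close>; the ternary relations on this set are stored as the arrays of
  their \<open>N ^ 3\<close> truth values.\<close>

definition rel :: "nat \<Rightarrow> (nat \<Rightarrow> nat \<Rightarrow> bool) \<Rightarrow> nat \<Rightarrow> nat \<Rightarrow> nat \<Rightarrow> nat \<Rightarrow> bool" where
  "rel N A j a b c = A j ((a * N + b) * N + c)"

primrec sem :: "nat \<Rightarrow> bool list \<Rightarrow> (nat \<Rightarrow> nat \<Rightarrow> bool) \<Rightarrow> (nat \<Rightarrow> nat) \<Rightarrow> fm \<Rightarrow> bool" where
  "sem N w A e (Less i j) = (e i < e j)"
| "sem N w A e (Input b i) = (e i < length w \<and> w ! e i = b)"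
| "sem N w A e (Rel j x y z) = rel N A j (e x) (e y) (e z)"
| "sem N w A e (Neg \<phi>) = (\<not> sem N w A e \<phi>)"
| "sem N w A e (And \<phi> \<psi>) = (sem N w A e \<phi> \<and> sem N w A e \<psi>)"
| "sem N w A e (Ex v \<phi>) = (\<exists>x<N. sem N w A (e(v := x)) \<phi>)"

primrec rels :: "fm \<Rightarrow> nat set" where
  "rels (Less i j) = {}"
| "rels (Input b i) = {}"
| "rels (Rel j x y z) = {j}"
| "rels (Neg \<phi>) = rels \<phi>"
| "rels (And \<phi> \<psi>) = rels \<phi> \<union> rels \<psi>"
| "rels (Ex v \<phi>) = rels \<phi>"

primrec fv :: "fm \<Rightarrow> nat set" where
  "fv (Less i j) = {i, j}"
| "fv (Input b i) = {i}"
| "fv (Rel j x y z) = {x, y, z}"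
| "fv (Neg \<phi>) = fv \<phi>"
| "fv (And \<phi> \<psi>) = fv \<phi> \<union> fv \<psi>"
| "fv (Ex v \<phi>) = fv \<phi> - {v}"

lemma sem_cong: "(\<And>v. v \<in> fv \<phi> \<Longrightarrow> e v = e' v) \<Longrightarrow> sem N w A e \<phi> = sem N w A e' \<phi>"
proof (induction \<phi> arbitrary: e e')
  case (Neg \<phi>)
  have "sem N w A e \<phi> = sem N w A e' \<phi>"
    by (rule Neg.IH) (use Neg.prems in auto)
  then show ?case by simp
next
  case (And \<phi> \<psi>)
  have "sem N w A e \<phi> = sem N w A e' \<phi>"
    by (rule And.IH(1)) (use And.prems in auto)
  moreover have "sem N w A e \<psi> = sem N w A e' \<psi>"
    by (rule And.IH(2)) (use And.prems in auto)
  ultimately show ?case by simp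
next
  case (Ex v \<phi>)
  have "sem N w A (e(v := x)) \<phi> = sem N w A (e'(v := x)) \<phi>" for x
    by (rule Ex.IH) (use Ex.prems in auto)
  then show ?case by simp
qed simp_all

text \<open>The variables \<open>0\<close>, \<open>1\<close>, \<open>2\<close> are reserved for the sweep that looks up the value of a relation.
  \<open>X\<close> is the set of variables whose heads may be away from their initial positions.\<close>

primrec wf_fm :: "nat set \<Rightarrow> fm \<Rightarrow> bool" where
  "wf_fm X (Less i j) = True"
| "wf_fm X (Input b i) = True"
| "wf_fm X (Rel j x y z) = ({x, y, z} \<inter> {0, 1, 2} = {} \<and> X \<inter> {0, 1, 2} = {})"
| "wf_fm X (Neg \<phi>) = wf_fm X \<phi>"
| "wf_fm X (And \<phi> \<psi>) = (wf_fm X \<phi> \<and> wf_fm X \<psi>)"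
| "wf_fm X (Ex v \<phi>) = (v \<notin> X \<and> wf_fm (insert v X) \<phi>)"

text \<open>Both heads walk left in step until one of them is at \<open>0\<close>;
  \<open>Scratch\<close> counts the steps and afterwards drives the heads back.\<close>

definition less_prog :: "nat \<Rightarrow> nat \<Rightarrow> tape prog" where
  "less_prog i j =
     While (\<lambda>s. s (Var i) \<noteq> 1 \<and> s (Var j) \<noteq> 1) (move {Var i, Var j} {Scratch}) ;;
     Write {Flag} (\<lambda>s. if s (Var i) = 1 \<and> s (Var j) \<noteq> 1 then 1 else 0) ;;
     While (\<lambda>s. s Scratch \<noteq> 1) (move {Scratch} {Var i, Var j})"

text \<open>The input head is moved to the position given by variable \<open>i\<close>. Beyond the
  end of the word it scans a blank, so both values of \<open>b\<close> give false there.\<close>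

definition input_prog :: "bool \<Rightarrow> nat \<Rightarrow> tape prog" where
  "input_prog b i =
     While (\<lambda>s. s (Var i) \<noteq> 1) (move {Var i} {Inp, Scratch}) ;;
     Write {Flag} (\<lambda>s. if s Inp = (if b then 2 else 1) then 1 else 0) ;;
     While (\<lambda>s. s Scratch \<noteq> 1) (move {Inp, Scratch} {Var i})"

definition neg_prog :: "tape prog \<Rightarrow> tape prog" where
  "neg_prog p = p ;; Write {Flag} (\<lambda>s. if s Flag = 1 then 0 else 1)"

definition and_prog :: "tape prog \<Rightarrow> tape prog \<Rightarrow> tape prog" where
  "and_prog p q = p ;; Branch (\<lambda>s. s Flag = 1) q skip"

definition eq_prog :: "nat \<Rightarrow> nat \<Rightarrow> tape prog" where
  "eq_prog i j = and_prog (neg_prog (less_prog i j)) (neg_prog (less_prog j i))"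

text \<open>The loop stops at the first witness, so the flag of the last test is already the answer
  and no second register is needed.\<close>

definition ex_prog :: "nat \<Rightarrow> tape prog \<Rightarrow> tape prog" where
  "ex_prog v p =
     Write {Flag} (\<lambda>_. 0) ;;
     While (\<lambda>s. s (Var v) \<noteq> 2 \<and> s Flag \<noteq> 1) (p ;; Branch (\<lambda>s. s Flag = 1) skip (move {} {Var v})) ;;
     rewind v"

text \<open>Lookup by exhaustive search: the cell whose coordinates agree with \<open>x\<close>,
  \<open>y\<close>, \<open>z\<close> is copied when the sweep passes it. The comparison overwrites
  \<open>Flag\<close> at every cell, so the value has to wait in \<open>Flag2\<close>.\<close>

definition rel_prog :: "nat \<Rightarrow> nat \<Rightarrow> nat \<Rightarrow> nat \<Rightarrow> tape prog" where
  "rel_prog j x y z =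
     sweep 0 1 2 j
       (and_prog (eq_prog 0 x) (and_prog (eq_prog 1 y) (eq_prog 2 z)) ;;
        Branch (\<lambda>s. s Flag = 1) (Write {Flag2} (\<lambda>s. if s (Arr j) = 1 then 1 else 0)) skip) ;;
     Write {Flag} (\<lambda>s. if s Flag2 = 1 then 1 else 0) ;; Write {Flag2} (\<lambda>_. 0)"

section \<open>Correctness and cost of the evaluation programs\<close>

lemma run_less:
  assumes "spos S = 0" "env S i \<le> N" "env S j \<le> N" "N > 0"
  shows "run (less_prog i j) (conf (\<lambda>_. N) w S) (4 * N + 5) (conf (\<lambda>_. N) w (S\<lparr>flag := env S i < env S j\<rparr>))"
proof -
  \<comment> \<open>The number of joint steps to the left: the smaller value is used up
    first.\<close>
  define n where "n = min (env S i) (env S j)"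
  have n: "n \<le> env S i" "n \<le> env S j" "n = env S i \<or> n = env S j" "n \<le> N"
    using assms by (auto simp: n_def)
  let ?e = "\<lambda>k. \<lambda>v. if v = i \<or> v = j then env S v - k else env S v"
  let ?S = "\<lambda>k. S\<lparr>env := ?e k, spos := k\<rparr>"
  let ?b = "env S i < env S j"
  have "run (While (\<lambda>s. s (Var i) \<noteq> 1 \<and> s (Var j) \<noteq> 1) (move {Var i, Var j} {Scratch}))
      (conf (\<lambda>_. N) w (?S 0)) (n * (1 + 1) + 1) (conf (\<lambda>_. N) w (?S n))"
    by (rule run_While[where \<sigma> = "\<lambda>k. conf (\<lambda>_. N) w (?S k)"], use n in simp, rule run_move)
       (use assms n in \<open>auto simp: all_tape\<close>)
  moreover have "run (Write {Flag} (\<lambda>s. if s (Var i) = 1 \<and> s (Var j) \<noteq> 1 then 1 else 0))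
      (conf (\<lambda>_. N) w (?S n)) 1 (conf (\<lambda>_. N) w ((?S n)\<lparr>flag := ?b\<rparr>))"
    by (rule run_write_Flag) (use assms n in auto)
  moreover have "run (While (\<lambda>s. s Scratch \<noteq> 1) (move {Scratch} {Var i, Var j}))
      (conf (\<lambda>_. N) w ((?S (n - 0))\<lparr>flag := ?b\<rparr>)) (n * (1 + 1) + 1) (conf (\<lambda>_. N) w ((?S (n - n))\<lparr>flag := ?b\<rparr>))"
    by (rule run_While[where \<sigma> = "\<lambda>k. conf (\<lambda>_. N) w ((?S (n - k))\<lparr>flag := ?b\<rparr>)"], use n in simp, rule run_move)
       (use assms n in \<open>auto simp: all_tape\<close>)
  ultimately have "run (less_prog i j) (conf (\<lambda>_. N) w (?S 0))
    (n * (1 + 1) + 1 + (1 + (n * (1 + 1) + 1) + 1) + 1)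
     (conf (\<lambda>_. N) w ((?S 0)\<lparr>flag := ?b\<rparr>))"
    unfolding less_prog_def by (intro run_Seq) (simp_all only: diff_zero diff_self_eq_0)
  moreover have "?S 0 = S"
  proof -
    have "?e 0 = env S" by auto
    then have "?S 0 = S\<lparr>env := env S, spos := spos S\<rparr>" using assms(1) by simp
    then show ?thesis by simp
  qed
  moreover have "n * (1 + 1) + 1 + (1 + (n * (1 + 1) + 1) + 1) + 1 \<le> 4 * N + 5" using n by simp
  ultimately show ?thesis
    by (metis (no_types, lifting) run_mono)
qed

lemma run_input:
  assumes "spos S = 0" "ipos S = 0" "env S i \<le> N" "N > 0"
  shows "run (input_prog b i) (conf (\<lambda>_. N) w S) (4 * N + 5)
    (conf (\<lambda>_. N) w (S\<lparr>flag := env S i < length w \<and> w ! env S i = b\<rparr>))"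
proof -
  let ?n = "env S i"
  let ?S = "\<lambda>k. S\<lparr>env := (env S)(i := ?n - k), spos := k, ipos := int k\<rparr>"
  let ?b = "env S i < length w \<and> w ! env S i = b"
  have "run (While (\<lambda>s. s (Var i) \<noteq> 1) (move {Var i} {Inp, Scratch}))
      (conf (\<lambda>_. N) w (?S 0)) (?n * (1 + 1) + 1) (conf (\<lambda>_. N) w (?S ?n))"
    by (rule run_While[where \<sigma> = "\<lambda>k. conf (\<lambda>_. N) w (?S k)"], simp, rule run_move)
       (use assms in \<open>auto simp: all_tape\<close>)
  moreover have "run (Write {Flag} (\<lambda>s. if s Inp = (if b then 2 else 1) then 1 else 0))
      (conf (\<lambda>_. N) w (?S ?n)) 1 (conf (\<lambda>_. N) w ((?S ?n)\<lparr>flag := ?b\<rparr>))"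
    by (rule run_write_Flag) (use assms in \<open>auto simp: input_tape_def\<close>)
  moreover have "run (While (\<lambda>s. s Scratch \<noteq> 1) (move {Inp, Scratch} {Var i}))
      (conf (\<lambda>_. N) w ((?S (?n - 0))\<lparr>flag := ?b\<rparr>)) (?n * (1 + 1) + 1)
        (conf (\<lambda>_. N) w ((?S (?n - ?n))\<lparr>flag := ?b\<rparr>))"
    by (rule run_While[where \<sigma> = "\<lambda>k. conf (\<lambda>_. N) w ((?S (?n - k))\<lparr>flag := ?b\<rparr>)"], simp, rule run_move)
       (use assms in \<open>auto simp: all_tape\<close>)
  ultimately have "run (input_prog b i) (conf (\<lambda>_. N) w (?S 0))
    (?n * (1 + 1) + 1 + (1 + (?n * (1 + 1) + 1) + 1) + 1)
     (conf (\<lambda>_. N) w ((?S 0)\<lparr>flag := ?b\<rparr>))"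
    unfolding input_prog_def by (intro run_Seq) (simp_all only: diff_zero diff_self_eq_0)
  moreover have "?S 0 = S" using assms by simp
  moreover have "?n * (1 + 1) + 1 + (1 + (?n * (1 + 1) + 1) + 1) + 1 \<le> 4 * N + 5" using assms by simp
  ultimately show ?thesis
    by (metis (no_types, lifting) run_mono)
qed

lemma run_neg:
  assumes "run p (conf m w S) c (conf m w (S\<lparr>flag := b\<rparr>))"
  shows "run (neg_prog p) (conf m w S) (c + 2) (conf m w (S\<lparr>flag := \<not> b\<rparr>))"
proof -
  have "run (Write {Flag} (\<lambda>s. if s Flag = 1 then 0 else 1)) (conf m w (S\<lparr>flag := b\<rparr>)) 1
      (conf m w (S\<lparr>flag := b\<rparr>\<lparr>flag := \<not> b\<rparr>))"
    by (rule run_write_Flag) simp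
  from run_Seq[OF assms this] show ?thesis
    unfolding neg_prog_def by (simp add: numeral_2_eq_2)
qed

lemma run_and:
  assumes "run p (conf m w S) c (conf m w (S\<lparr>flag := b\<rparr>))"
    and "b \<Longrightarrow> run q (conf m w (S\<lparr>flag := b\<rparr>)) d (conf m w (S\<lparr>flag := b'\<rparr>))"
  shows "run (and_prog p q) (conf m w S) (c + d + 3) (conf m w (S\<lparr>flag := b \<and> b'\<rparr>))"
proof -
  have "run (Branch (\<lambda>s. s Flag = 1) q skip) (conf m w (S\<lparr>flag := b\<rparr>)) (d + 1 + 1)
      (conf m w (S\<lparr>flag := b \<and> b'\<rparr>))"
  proof (rule run_Branch, cases b)
    case True
    then show "run (if scan (conf m w (S\<lparr>flag := b\<rparr>)) Flag = 1 then q else skip) (conf m w (S\<lparr>flag := b\<rparr>))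
      (d + 1)
      (conf m w (S\<lparr>flag := b \<and> b'\<rparr>))"
      using run_mono[OF assms(2)[OF True], of "d + 1"] by simp
  next
    case False
    then show "run (if scan (conf m w (S\<lparr>flag := b\<rparr>)) Flag = 1 then q else skip) (conf m w (S\<lparr>flag := b\<rparr>))
      (d + 1)
      (conf m w (S\<lparr>flag := b \<and> b'\<rparr>))"
      using run_mono[OF run_skip, of "d + 1"] by simp
  qed
  from run_Seq[OF assms(1) this] show ?thesis
    unfolding and_prog_def by (simp add: numeral_3_eq_3)
qed

lemma run_eq:
  assumes "spos S = 0" "env S i \<le> N" "env S j \<le> N" "N > 0"
  shows "run (eq_prog i j) (conf (\<lambda>_. N) w S) (8 * N + 17) (conf (\<lambda>_. N) w (S\<lparr>flag := env S i = env S j\<rparr>))"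
proof -
  have 1: "run (neg_prog (less_prog i j)) (conf (\<lambda>_. N) w S) (4 * N + 5 + 2)
      (conf (\<lambda>_. N) w (S\<lparr>flag := \<not> env S i < env S j\<rparr>))"
    by (rule run_neg[OF run_less]) (use assms in auto)
  have 2: "run (neg_prog (less_prog j i)) (conf (\<lambda>_. N) w (S\<lparr>flag := b\<rparr>)) (4 * N + 5 + 2)
      (conf (\<lambda>_. N) w (S\<lparr>flag := \<not> env S j < env S i\<rparr>))" for b
    using run_neg[OF run_less[of "S\<lparr>flag := b\<rparr>" j N i w]] assms by simp
  have "(\<not> env S i < env S j \<and> \<not> env S j < env S i) = (env S i = env S j)" by auto
  with run_and[OF 1 2] show ?thesis
    unfolding eq_prog_def by (simp add: algebra_simps)
qed

lemma run_ex:
  assumes p: "\<And>x b. x < N \<Longrightarrow> run p (conf (\<lambda>_. N) w (S\<lparr>env := (env S)(v := x), flag := b\<rparr>)) c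
      (conf (\<lambda>_. N) w (S\<lparr>env := (env S)(v := x), flag := P x\<rparr>))"
    and "N > 0" "env S v = 0"
  shows "run (ex_prog v p) (conf (\<lambda>_. N) w S) (N * (c + 4) + 2 * N + 5) (conf (\<lambda>_. N) w (S\<lparr>flag := \<exists>x<N. P x\<rparr>))"
proof -
  let ?c = "conf (\<lambda>_. N) w"
  let ?p = "p ;; Branch (\<lambda>s. s Flag = 1) skip (move {} {Var v})"
  let ?S = "\<lambda>x b. S\<lparr>env := (env S)(v := x), flag := b\<rparr>"
  have step: "run ?p (?c (?S x False)) (c + 2 + 1) (?c (if P x then ?S x True else ?S (Suc x) False))"
    if "x < N" for x
  proof (rule run_Seq[OF p[OF that]])
    have "run (Branch (\<lambda>s. s Flag = 1) skip (move {} {Var v})) (?c (?S x (P x))) (1 + 1)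
       (?c (if P x then ?S x True else ?S (Suc x) False))"
    proof (rule run_Branch, cases "P x")
      case True
      then show "run (if scan (?c (?S x (P x))) Flag = 1 then skip else move {} {Var v}) (?c (?S x (P x))) 1
         (?c (if P x then ?S x True else ?S (Suc x) False))"
        using run_skip[of "\<lambda>_. N" w "?S x True"] by simp
    next
      case False
      have "run (move {} {Var v}) (?c (?S x False)) 1 (?c (?S (Suc x) False))"
        by (rule run_move) (simp_all add: all_tape)
      then show "run (if scan (?c (?S x (P x))) Flag = 1 then skip else move {} {Var v}) (?c (?S x (P x))) 1
         (?c (if P x then ?S x True else ?S (Suc x) False))"
        using False by simp
    qed
    then show "run (Branch (\<lambda>s. s Flag = 1) skip (move {} {Var v})) (?c (?S x (P x))) 2
       (?c (if P x then ?S x True else ?S (Suc x) False))"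
      by (simp add: numeral_2_eq_2)
  qed
  obtain x where x: "x \<le> N" and loop: "run (While (\<lambda>s. s (Var v) \<noteq> 2 \<and> s Flag \<noteq> 1) ?p) (?c (?S 0 False))
    (N * (c + 4) + 1)
      (?c (?S x (\<exists>x<N. P x)))"
  proof (cases "\<exists>x<N. P x")
    case True
    \<comment> \<open>The loop passes all positions below the least witness and halts there: the
      last of its \<open>Suc x\<close> rounds raises the flag instead of moving the head.\<close>
    define x where "x = (LEAST x. x < N \<and> P x)"
    have x: "x < N" "P x" using LeastI_ex[of "\<lambda>x. x < N \<and> P x"] True unfolding x_def by auto
    have less: "\<not> P y" if "y < x" for y
      using not_less_Least[of y "\<lambda>x. x < N \<and> P x"] that x(1) unfolding x_def by auto
    let ?\<sigma> = "\<lambda>k. ?c (if k \<le> x then ?S k False else ?S x True)"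
    have "run (While (\<lambda>s. s (Var v) \<noteq> 2 \<and> s Flag \<noteq> 1) ?p) (?\<sigma> 0) (Suc x * (c + 2 + 1 + 1) + 1) (?\<sigma> (Suc x))"
    proof (rule run_While[where \<sigma> = ?\<sigma>])
      fix k assume "k < Suc x"
      then show "run ?p (?\<sigma> k) (c + 2 + 1) (?\<sigma> (Suc k))"
        using step[of k] less[of k] x by (cases "k = x") simp_all
    qed (use x in auto)
    then have run: "run (While (\<lambda>s. s (Var v) \<noteq> 2 \<and> s Flag \<noteq> 1) ?p) (?c (?S 0 False))
        (Suc x * (c + 2 + 1 + 1) + 1) (?c (?S x True))"
      by (simp only: le0 if_True not_less_eq_eq[symmetric] if_False lessI simp_thms order_refl Suc_n_not_le_n)
    have "Suc x * (c + 4) \<le> N * (c + 4)"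
      using x(1) by (intro mult_le_mono) auto
    moreover have "c + 2 + 1 + 1 = c + 4" by simp
    ultimately have le: "Suc x * (c + 2 + 1 + 1) + 1 \<le> N * (c + 4) + 1"
      by (simp only: add_le_cancel_right)
    have ex: "(\<exists>x<N. P x) = True" using True by simp
    show ?thesis
      by (rule that[of x]) (use x run_mono[OF run le] in \<open>simp_all only: ex less_imp_le\<close>)
  next
    case False
    let ?\<sigma> = "\<lambda>k. ?c (?S k False)"
    have "run (While (\<lambda>s. s (Var v) \<noteq> 2 \<and> s Flag \<noteq> 1) ?p) (?\<sigma> 0) (N * (c + 2 + 1 + 1) + 1) (?\<sigma> N)"
    proof (rule run_While[where \<sigma> = ?\<sigma>])
      fix k assume "k < N"
      then show "run ?p (?\<sigma> k) (c + 2 + 1) (?\<sigma> (Suc k))"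
        using step[of k] False by simp
    qed (use assms in auto)
    then have run: "run (While (\<lambda>s. s (Var v) \<noteq> 2 \<and> s Flag \<noteq> 1) ?p) (?c (?S 0 False))
        (N * (c + 4) + 1) (?c (?S N False))"
      by (rule run_mono) (simp add: algebra_simps)
    have ex: "(\<exists>x<N. P x) = False" using False by simp
    show ?thesis
      by (rule that[of N]) (use run in \<open>simp_all only: ex order_refl\<close>)
  qed
  have eq: "S\<lparr>env := (env S)(v := 0), flag := b\<rparr> = S\<lparr>flag := b\<rparr>" for b
  proof -
    have "(env S)(v := 0) = env S" using assms(3) by auto
    then have "S\<lparr>env := (env S)(v := 0), flag := b\<rparr> = S\<lparr>env := env S, flag := b\<rparr>"
      by simp
    then show ?thesis by simp
  qed
  have init: "run (Write {Flag} (\<lambda>_. 0)) (?c S) 1 (?c (?S 0 False))"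
    unfolding eq by (rule run_write_Flag) simp
  have "run (rewind v) (?c (?S x b)) (2 * N + 1) (?c (S\<lparr>flag := b\<rparr>))" for b
  proof -
    have "run (rewind v) (?c (?S x b)) (2 * N + 1) (?c ((?S x b)\<lparr>env := (env (?S x b))(v := 0)\<rparr>))"
      by (rule run_rewind) (use x in simp)
    moreover have "(?S x b)\<lparr>env := (env (?S x b))(v := 0)\<rparr> = S\<lparr>env := (env S)(v := 0), flag := b\<rparr>"
      by simp
    ultimately show ?thesis by (simp only: eq)
  qed
  from run_Seq[OF init run_Seq[OF loop this]] show ?thesis
    unfolding ex_prog_def by (rule run_mono) simp
qed

lemma cell_eq_iff:
  assumes "k < N ^ 3" "x < N" "y < N" "z < N"
  shows "(k div N ^ 2 = x \<and> k div N mod N = y \<and> k mod N = z) \<longleftrightarrow> k = (x * N + y) * N + (z :: nat)"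
proof
  assume "k div N ^ 2 = x \<and> k div N mod N = y \<and> k mod N = z"
  then have "k div N div N = x" "k div N mod N = y" "k mod N = z"
    by (simp_all add: div_mult2_eq power2_eq_square)
  then show "k = (x * N + y) * N + z" by (metis div_mult_mod_eq)
next
  assume k: "k = (x * N + y) * N + z"
  then have "k div N = x * N + y" "k mod N = z" using assms by simp_all
  then show "k div N ^ 2 = x \<and> k div N mod N = y \<and> k mod N = z"
    using assms by (simp add: div_mult2_eq power2_eq_square)
qed

lemma cell_less:
  fixes N :: nat
  assumes "x < N" "y < N" "z < N"
  shows "(x * N + y) * N + z < N ^ 3"
proof -
  have 1: "u * N + v < M * N" if "u < M" "v < N" for u v M :: nat
  proof -
    have "u * N + v < Suc u * N" using that by simp
    also have "\<dots> \<le> M * N" using that by (intro mult_le_mono) auto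
    finally show ?thesis .
  qed
  have "(x * N + y) * N + z < N * N * N" using 1 assms by blast
  then show ?thesis by (simp add: power3_eq_cube)
qed

definition rel_cost :: "nat \<Rightarrow> nat" where
  "rel_cost N = sweep_cost N (24 * N + 61) + 4"

lemma run_rel:
  assumes S: "spos S = 0" "apos S j = 0" "\<not> flag2 S" "\<And>i. env S i < N"
      "env S 0 = 0" "env S 1 = 0" "env S 2 = 0"
    and xyz: "{x, y, z} \<inter> {0, 1, 2} = {}"
  shows "run (rel_prog j x y z) (conf (\<lambda>_. N) w S) (rel_cost N)
    (conf (\<lambda>_. N) w (S\<lparr>flag := rel N (cells S) j (env S x) (env S y) (env S z)\<rparr>))"
proof -
  let ?c = "conf (\<lambda>_. N) w"
  let ?t = "(env S x * N + env S y) * N + env S z"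
  have t: "?t < N ^ 3" using cell_less S(4) by blast
  \<comment> \<open>State before cell \<open>k\<close>: the flag still shows the comparison at cell
    \<open>k - 1\<close> (its initial value if \<open>k = 0\<close>), and the second flag holds the
    looked-up value as soon as cell \<open>?t\<close> has been passed.\<close>
  let ?S = "\<lambda>k. S\<lparr>flag := (if k = 0 then flag S else k - 1 = ?t), flag2 := ?t < k \<and> cells S j ?t\<rparr>"
  let ?p = "and_prog (eq_prog 0 x) (and_prog (eq_prog 1 y) (eq_prog 2 z))"
  have N: "N > 0" using S(4)[of 0] by simp
  have body: "run (?p ;; Branch (\<lambda>s. s Flag = 1) (Write {Flag2} (\<lambda>s. if s (Arr j) = 1 then 1 else 0)) skip)
      (?c (at_cell N 0 1 2 j k (?S k))) (24 * N + 61) (?c (at_cell N 0 1 2 j k (?S (Suc k))))"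
    if k: "k < N ^ 3" for k
  proof -
    let ?R = "at_cell N 0 1 2 j k (?S k)"
    have kN: "k div N ^ 2 < N" "k div N mod N < N" "k mod N < N"
      using k N by (simp_all add: less_mult_imp_div_less power3_eq_cube power2_eq_square)
    have envR: "env ?R 0 = k div N ^ 2" "env ?R 1 = k div N mod N" "env ?R 2 = k mod N"
       "env ?R x = env S x" "env ?R y = env S y" "env ?R z = env S z"
      using xyz by (auto simp: at_cell_def)
    have le: "env ?R i \<le> N" for i
      using kN S(4)[of i] by (auto simp: at_cell_def)
    have spos: "spos ?R = 0" using S by (simp add: at_cell_def)
    have eq: "run (eq_prog u v) (?c (?R\<lparr>flag := b\<rparr>)) (8 * N + 17) (?c (?R\<lparr>flag := env ?R u = env ?R v\<rparr>))"
      for u v b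
      using run_eq[of "?R\<lparr>flag := b\<rparr>" u N v w] le spos N by simp
    have "run (and_prog (eq_prog 1 y) (eq_prog 2 z)) (?c (?R\<lparr>flag := b\<rparr>)) (8 * N + 17 + (8 * N + 17) + 3)
       (?c (?R\<lparr>flag := env ?R 1 = env ?R y \<and> env ?R 2 = env ?R z\<rparr>))" for b
      using run_and[of "eq_prog 1 y" "\<lambda>_. N" w "?R\<lparr>flag := b\<rparr>" "8 * N + 17" "env ?R 1 = env ?R y"
        "eq_prog 2 z" "8 * N + 17" "env ?R 2 = env ?R z"] eq by simp
    then have "run ?p (?c (?R\<lparr>flag := b\<rparr>)) (8 * N + 17 + (8 * N + 17 + (8 * N + 17) + 3) + 3)
       (?c (?R\<lparr>flag := env ?R 0 = env ?R x \<and> env ?R 1 = env ?R y \<and> env ?R 2 = env ?R z\<rparr>))" for b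
      using run_and[of "eq_prog 0 x" "\<lambda>_. N" w "?R\<lparr>flag := b\<rparr>" "8 * N + 17" "env ?R 0 = env ?R x"
        "and_prog (eq_prog 1 y) (eq_prog 2 z)" "8 * N + 17 + (8 * N + 17) + 3"
        "env ?R 1 = env ?R y \<and> env ?R 2 = env ?R z"] eq by simp
    note * = this[of "flag ?R"]
    have flag_id: "R\<lparr>flag := flag R\<rparr> = R" for R by simp
    have 1: "run ?p (?c ?R) (24 * N + 57) (?c (?R\<lparr>flag := k = ?t\<rparr>))"
      using *[unfolded flag_id envR cell_eq_iff[OF k S(4)[of x] S(4)[of y] S(4)[of z]]]
      by (rule run_mono) simp
    have 2: "run (Branch (\<lambda>s. s Flag = 1) (Write {Flag2} (\<lambda>s. if s (Arr j) = 1 then 1 else 0)) skip)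
       (?c (?R\<lparr>flag := k = ?t\<rparr>)) (1 + 1) (?c (at_cell N 0 1 2 j k (?S (Suc k))))"
    proof (rule run_Branch, cases "k = ?t")
      case True
      have "run (Write {Flag2} (\<lambda>s. if s (Arr j) = 1 then 1 else 0)) (?c (?R\<lparr>flag := k = ?t\<rparr>)) 1
          (?c (?R\<lparr>flag := k = ?t\<rparr>\<lparr>flag2 := cells S j k\<rparr>))"
        by (rule run_write_Flag2) (simp add: at_cell_def)
      moreover have "?R\<lparr>flag := k = ?t\<rparr>\<lparr>flag2 := cells S j k\<rparr> = at_cell N 0 1 2 j k (?S (Suc k))"
        using True by (simp add: at_cell_def)
      ultimately show "run (if scan (?c (?R\<lparr>flag := k = ?t\<rparr>)) Flag = 1
        then Write {Flag2} (\<lambda>s. if s (Arr j) = 1 then 1 else 0) else skip)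
          (?c (?R\<lparr>flag := k = ?t\<rparr>)) 1 (?c (at_cell N 0 1 2 j k (?S (Suc k))))"
        using True by simp
    next
      case False
      have eq: "?R\<lparr>flag := k = ?t\<rparr> = at_cell N 0 1 2 j k (?S (Suc k))"
        using False by (auto simp: at_cell_def less_Suc_eq)
      have no: "scan (?c (?R\<lparr>flag := k = ?t\<rparr>)) Flag \<noteq> 1"
        using False by simp
      show "run (if scan (?c (?R\<lparr>flag := k = ?t\<rparr>)) Flag = 1
        then Write {Flag2} (\<lambda>s. if s (Arr j) = 1 then 1 else 0) else skip)
          (?c (?R\<lparr>flag := k = ?t\<rparr>)) 1 (?c (at_cell N 0 1 2 j k (?S (Suc k))))"
        by (simp only: eq[symmetric] no if_False run_skip)
    qed
    from run_Seq[OF 1 2] show ?thesis by (rule run_mono) simp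
  qed
  have at0: "at_cell N 0 1 2 j 0 R = R" if "env R = env S" "apos R = apos S" for R
  proof -
    have "(env S)(0 := 0, 1 := 0, 2 := 0) = env S" "(apos S)(j := 0) = apos S"
      using S by auto
    then have "at_cell N 0 1 2 j 0 R = R\<lparr>apos := apos R, env := env R\<rparr>"
      using that by (simp add: at_cell_def)
    then show ?thesis by simp
  qed
  have "run (sweep 0 1 2 j (?p ;; Branch (\<lambda>s. s Flag = 1)
    (Write {Flag2} (\<lambda>s. if s (Arr j) = 1 then 1 else 0)) skip))
    (?c (at_cell N 0 1 2 j 0 (?S 0))) (sweep_cost N (24 * N + 61)) (?c (at_cell N 0 1 2 j 0 (?S (N ^ 3))))"
    by (rule run_sweep[where S = ?S, OF body N]) auto
  moreover have "at_cell N 0 1 2 j 0 (?S 0) = ?S 0" "at_cell N 0 1 2 j 0 (?S (N ^ 3)) = ?S (N ^ 3)"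
    by (rule at0; simp)+
  moreover have "?S 0 = S"
  proof -
    have "?S 0 = S\<lparr>flag := flag S, flag2 := flag2 S\<rparr>" using S(3) by simp
    then show ?thesis by simp
  qed
  ultimately have 1: "run (sweep 0 1 2 j (?p ;; Branch (\<lambda>s. s Flag = 1)
    (Write {Flag2} (\<lambda>s. if s (Arr j) = 1 then 1 else 0)) skip))
    (?c S) (sweep_cost N (24 * N + 61)) (?c (?S (N ^ 3)))"
    by (simp only:)
  have 2: "run (Write {Flag} (\<lambda>s. if s Flag2 = 1 then 1 else 0)) (?c (?S (N ^ 3))) 1
     (?c ((?S (N ^ 3))\<lparr>flag := cells S j ?t\<rparr>))"
    by (rule run_write_Flag) (use t in simp)
  have 3: "run (Write {Flag2} (\<lambda>_. 0)) (?c ((?S (N ^ 3))\<lparr>flag := cells S j ?t\<rparr>)) 1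
     (?c ((?S (N ^ 3))\<lparr>flag := cells S j ?t\<rparr>\<lparr>flag2 := False\<rparr>))"
    by (rule run_write_Flag2) simp
  have 4: "(?S (N ^ 3))\<lparr>flag := cells S j ?t\<rparr>\<lparr>flag2 := False\<rparr> = S\<lparr>flag := cells S j ?t\<rparr>"
  proof -
    have "(?S (N ^ 3))\<lparr>flag := cells S j ?t\<rparr>\<lparr>flag2 := False\<rparr> = S\<lparr>flag := cells S j ?t, flag2 := flag2 S\<rparr>"
      using S(3) by simp
    then show ?thesis by simp
  qed
  from run_Seq[OF 1 run_Seq[OF 2 3]] show ?thesis
    unfolding rel_prog_def rel_cost_def rel_def 4 by (rule run_mono) simp
qed

primrec fm_prog :: "fm \<Rightarrow> tape prog" where
  "fm_prog (Less i j) = less_prog i j"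
| "fm_prog (Input b i) = input_prog b i"
| "fm_prog (Rel j x y z) = rel_prog j x y z"
| "fm_prog (Neg \<phi>) = neg_prog (fm_prog \<phi>)"
| "fm_prog (And \<phi> \<psi>) = and_prog (fm_prog \<phi>) (fm_prog \<psi>)"
| "fm_prog (Ex v \<phi>) = ex_prog v (fm_prog \<phi>)"

primrec fm_cost :: "nat \<Rightarrow> fm \<Rightarrow> nat" where
  "fm_cost N (Less i j) = 4 * N + 5"
| "fm_cost N (Input b i) = 4 * N + 5"
| "fm_cost N (Rel j x y z) = rel_cost N"
| "fm_cost N (Neg \<phi>) = fm_cost N \<phi> + 2"
| "fm_cost N (And \<phi> \<psi>) = fm_cost N \<phi> + fm_cost N \<psi> + 3"
| "fm_cost N (Ex v \<phi>) = N * (fm_cost N \<phi> + 4) + 2 * N + 5"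

text \<open>Only the arrays that the formula mentions must have their heads at \<open>0\<close>.
  This leaves room for the array that is being filled while the formula is evaluated.\<close>

lemma run_fm:
  assumes "wf_fm X \<phi>" "spos S = 0" "ipos S = 0" "\<not> flag2 S" "\<And>i. env S i < N"
    "\<And>i. i \<notin> X \<Longrightarrow> env S i = 0" "\<And>j. j \<in> rels \<phi> \<Longrightarrow> apos S j = 0"
  shows "run (fm_prog \<phi>) (conf (\<lambda>_. N) w S) (fm_cost N \<phi>)
    (conf (\<lambda>_. N) w (S\<lparr>flag := sem N w (cells S) (env S) \<phi>\<rparr>))"
  using assms
proof (induction \<phi> arbitrary: S X)
  case (Less i j)
  have "N > 0" using Less(5)[of 0] by simp
  then show ?case using run_less[of S i N j w] Less(2) less_imp_le[OF Less(5)] by simp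
next
  case (Input b i)
  have "N > 0" using Input(5)[of 0] by simp
  then show ?case using run_input[of S i N b w] Input(2,3) less_imp_le[OF Input(5)] by simp
next
  case (Rel j x y z)
  have "0 \<notin> X" "1 \<notin> X" "2 \<notin> X" "{x, y, z} \<inter> {0, 1, 2} = {}" using Rel.prems(1) by auto
  then show ?case using run_rel[of S j N x y z w] Rel.prems by simp
next
  case (Neg \<phi>)
  then show ?case using run_neg[OF Neg.IH[of X S]] by simp
next
  case (And \<phi> \<psi>)
  have 1: "run (fm_prog \<phi>) (conf (\<lambda>_. N) w S) (fm_cost N \<phi>)
    (conf (\<lambda>_. N) w (S\<lparr>flag := sem N w (cells S) (env S) \<phi>\<rparr>))"
    by (rule And.IH(1)[of X]) (use And.prems in auto)
  have 2: "run (fm_prog \<psi>) (conf (\<lambda>_. N) w (S\<lparr>flag := b\<rparr>)) (fm_cost N \<psi>)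
      (conf (\<lambda>_. N) w (S\<lparr>flag := sem N w (cells S) (env S) \<psi>\<rparr>))" for b
    using And.IH(2)[of X "S\<lparr>flag := b\<rparr>"] And.prems by simp
  from run_and[OF 1 2] show ?case by simp
next
  case (Ex v \<phi>)
  have N: "N > 0" using Ex.prems(5)[of 0] by simp
  have v: "env S v = 0" using Ex.prems(1,6) by simp
  have "run (fm_prog \<phi>) (conf (\<lambda>_. N) w (S\<lparr>env := (env S)(v := x), flag := b\<rparr>)) (fm_cost N \<phi>)
      (conf (\<lambda>_. N) w (S\<lparr>env := (env S)(v := x), flag := sem N w (cells S) ((env S)(v := x)) \<phi>\<rparr>))"
    if "x < N" for x b
  proof -
    let ?T = "S\<lparr>env := (env S)(v := x), flag := b\<rparr>"
    have "run (fm_prog \<phi>) (conf (\<lambda>_. N) w ?T) (fm_cost N \<phi>)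
      (conf (\<lambda>_. N) w (?T\<lparr>flag := sem N w (cells ?T) (env ?T) \<phi>\<rparr>))"
      by (rule Ex.IH[of "insert v X"]) (use Ex.prems that in auto)
    moreover have "?T\<lparr>flag := sem N w (cells ?T) (env ?T) \<phi>\<rparr> =
        S\<lparr>env := (env S)(v := x), flag := sem N w (cells S) ((env S)(v := x)) \<phi>\<rparr>"
      by simp
    ultimately show ?thesis by (simp only:)
  qed
  from run_ex[OF this N v] show ?case by simp
qed

lemma sem_rels_cong: "(\<And>j. j \<in> rels \<phi> \<Longrightarrow> A j = B j) \<Longrightarrow> sem N w A e \<phi> = sem N w B e \<phi>"
proof (induction \<phi> arbitrary: e)
  case (Neg \<phi>)
  have "sem N w A e \<phi> = sem N w B e \<phi>"
    by (rule Neg.IH) (use Neg.prems in auto)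
  then show ?case by simp
next
  case (And \<phi> \<psi>)
  have "sem N w A e \<phi> = sem N w B e \<phi>"
    by (rule And.IH(1)) (use And.prems in auto)
  moreover have "sem N w A e \<psi> = sem N w B e \<psi>"
    by (rule And.IH(2)) (use And.prems in auto)
  ultimately show ?case by simp
next
  case (Ex v \<phi>)
  have "sem N w A (e(v := x)) \<phi> = sem N w B (e(v := x)) \<phi>" for x
    by (rule Ex.IH) (use Ex.prems in auto)
  then show ?case by simp
qed (simp_all add: rel_def)

subsection \<open>Iterated definitions\<close>

text \<open>\<open>Def j \<phi>\<close> assigns the relation defined by \<open>\<phi>\<close> in the variables \<open>3\<close>, \<open>4\<close>, \<open>5\<close> to \<open>j\<close>;
  \<open>Loop v c\<close> repeats \<open>c\<close> as often as the universe has elements, counting with variable \<open>v\<close>.\<close>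

datatype cmd = Def nat fm | Then cmd cmd (infixr \<open>\<then>\<close> 60) | Loop nat cmd

text \<open>The default \<open>0\<close> matches the rest position of the heads of all other
  variables.\<close>

definition args :: "nat \<Rightarrow> nat \<Rightarrow> nat \<Rightarrow> nat \<Rightarrow> nat" where
  "args a b c = (\<lambda>_. 0)(3 := a, 4 := b, 5 := c)"

text \<open>Cells from \<open>N ^ 3\<close> on lie outside the sweep and keep their values. The
  formula is evaluated in the old \<open>A\<close>, which agrees with filling the array in place as
  long as \<open>\<phi>\<close> does not read \<open>j\<close>; \<open>wf_cmd\<close> demands
  this.\<close>

primrec exec :: "nat \<Rightarrow> bool list \<Rightarrow> cmd \<Rightarrow> (nat \<Rightarrow> nat \<Rightarrow> bool) \<Rightarrow> nat \<Rightarrow> nat \<Rightarrow> bool" where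
  "exec N w (Def j \<phi>) A = A(j := (\<lambda>k. if k < N ^ 3
      then sem N w A (args (k div N ^ 2) (k div N mod N) (k mod N)) \<phi> else A j k))"
| "exec N w (c \<then> d) A = exec N w d (exec N w c A)"
| "exec N w (Loop v c) A = (exec N w c ^^ N) A"

text \<open>\<open>X\<close> collects the counters of the surrounding loops, whose heads are away
  from \<open>0\<close>. Since the free variables of a definition are among \<open>3\<close>,
  \<open>4\<close>, \<open>5\<close>, the counters cannot enter its meaning, and \<open>exec\<close>
  does without them.\<close>

primrec wf_cmd :: "nat set \<Rightarrow> cmd \<Rightarrow> bool" where
  "wf_cmd X (Def j \<phi>) \<longleftrightarrow> X \<inter> {3, 4, 5} = {} \<and> wf_fm ({3, 4, 5} \<union> X) \<phi> \<and> fv \<phi> \<subseteq> {3, 4, 5} \<and> j \<notin> rels \<phi>"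
| "wf_cmd X (c \<then> d) \<longleftrightarrow> wf_cmd X c \<and> wf_cmd X d"
| "wf_cmd X (Loop v c) \<longleftrightarrow> v \<notin> X \<and> wf_cmd (insert v X) c"

primrec cmd_prog :: "cmd \<Rightarrow> tape prog" where
  "cmd_prog (Def j \<phi>) = sweep 3 4 5 j
     (fm_prog \<phi> ;; Write {Arr j} (\<lambda>s. if s Flag = 1 then 1 else 0) ;; Write {Flag} (\<lambda>_. 0))"
| "cmd_prog (c \<then> d) = cmd_prog c ;; cmd_prog d"
| "cmd_prog (Loop v c) = For v (cmd_prog c)"

primrec cmd_cost :: "nat \<Rightarrow> cmd \<Rightarrow> nat" where
  "cmd_cost N (Def j \<phi>) = sweep_cost N (fm_cost N \<phi> + 4)"
| "cmd_cost N (c \<then> d) = cmd_cost N c + cmd_cost N d + 1"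
| "cmd_cost N (Loop v c) = N * (cmd_cost N c + 3) + 2 * N + 3"

lemma run_cmd:
  assumes "wf_cmd X c" "spos S = 0" "ipos S = 0" "\<not> flag S" "\<not> flag2 S" "\<And>i. env S i < N"
    "\<And>i. i \<notin> X \<Longrightarrow> env S i = 0" "\<And>j. apos S j = 0"
  shows "run (cmd_prog c) (conf (\<lambda>_. N) w S) (cmd_cost N c)
    (conf (\<lambda>_. N) w (S\<lparr>cells := exec N w c (cells S)\<rparr>))"
  using assms
proof (induction c arbitrary: S X)
  case (Def j \<phi>)
  let ?c = "conf (\<lambda>_. N) w"
  let ?new = "\<lambda>k. sem N w (cells S) (args (k div N ^ 2) (k div N mod N) (k mod N)) \<phi>"
  \<comment> \<open>After \<open>k\<close> cells the array is new below \<open>k\<close> and old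
    from there on.\<close>
  let ?A = "\<lambda>k. (cells S)(j := (\<lambda>p. if p < k then ?new p else cells S j p))"
  let ?S = "\<lambda>k. S\<lparr>cells := ?A k\<rparr>"
  let ?p = "fm_prog \<phi> ;; Write {Arr j} (\<lambda>s. if s Flag = 1 then 1 else 0) ;; Write {Flag} (\<lambda>_. 0)"
  have N: "N > 0" using Def.prems(6)[of 0] by simp
  have body: "run ?p (?c (at_cell N 3 4 5 j k (?S k))) (fm_cost N \<phi> + 4)
    (?c (at_cell N 3 4 5 j k (?S (Suc k))))"
    if k: "k < N ^ 3" for k
  proof -
    let ?R = "at_cell N 3 4 5 j k (?S k)"
    have kN: "k div N ^ 2 < N" "k div N mod N < N" "k mod N < N"
      using k N by (simp_all add: less_mult_imp_div_less power3_eq_cube power2_eq_square)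
    have "run (fm_prog \<phi>) (?c ?R) (fm_cost N \<phi>) (?c (?R\<lparr>flag := sem N w (cells ?R) (env ?R) \<phi>\<rparr>))"
      by (rule run_fm[of "{3, 4, 5} \<union> X"]) (use Def.prems kN in \<open>auto simp: at_cell_def\<close>)
    moreover have "sem N w (cells ?R) (env ?R) \<phi> = ?new k"
    proof -
      have "sem N w (cells ?R) (env ?R) \<phi> = sem N w (cells S) (env ?R) \<phi>"
        by (rule sem_rels_cong) (use Def.prems(1) in \<open>auto simp: at_cell_def\<close>)
      also have "\<dots> = ?new k"
        by (rule sem_cong) (use Def.prems(1) in \<open>auto simp: at_cell_def args_def\<close>)
      finally show ?thesis .
    qed
    ultimately have 1: "run (fm_prog \<phi>) (?c ?R) (fm_cost N \<phi>) (?c (?R\<lparr>flag := ?new k\<rparr>))"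
      by (simp only:)
    let ?T = "?R\<lparr>flag := ?new k\<rparr>"
    have 2: "run (Write {Arr j} (\<lambda>s. if s Flag = 1 then 1 else 0)) (?c ?T) 1
        (?c (?T\<lparr>cells := (cells ?T)(j := (cells ?T j)(nat (apos ?T j) := ?new k))\<rparr>))"
      by (rule run_write_Arr) (auto simp: at_cell_def)
    have 3: "run (Write {Flag} (\<lambda>_. 0)) (?c U) 1 (?c (U\<lparr>flag := False\<rparr>))" for U
      by (rule run_write_Flag) simp
    have eq: "(cells ?T)(j := (cells ?T j)(nat (apos ?T j) := ?new k)) = ?A (Suc k)"
      by (auto simp: at_cell_def fun_eq_iff less_Suc_eq)
    have "?T\<lparr>cells := ?A (Suc k)\<rparr>\<lparr>flag := False\<rparr> = at_cell N 3 4 5 j k (?S (Suc k))\<lparr>flag := flag S\<rparr>"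
      using Def.prems(4) by (simp add: at_cell_def)
    also have "\<dots> = at_cell N 3 4 5 j k (?S (Suc k))" by (simp add: at_cell_def)
    finally have "?T\<lparr>cells := ?A (Suc k)\<rparr>\<lparr>flag := False\<rparr> = at_cell N 3 4 5 j k (?S (Suc k))" .
    with run_Seq[OF 1 run_Seq[OF 2[unfolded eq] 3]] show ?thesis
      by (metis (no_types, lifting) add.assoc numeral_plus_one one_add_one one_plus_numeral semiring_norm(2)
        semiring_norm(3) semiring_norm(4) add.commute run_mono le_refl nat_arith.rule0)
  qed
  have at0: "at_cell N 3 4 5 j 0 (?S k) = ?S k" for k
  proof -
    have "(env S)(3 := 0, 4 := 0, 5 := 0) = env S" "(apos S)(j := 0) = apos S"
      using Def.prems(1,7,8) by (auto simp: fun_eq_iff)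
    then have "at_cell N 3 4 5 j 0 (?S k) = (?S k)\<lparr>apos := apos (?S k), env := env (?S k)\<rparr>"
      by (simp add: at_cell_def)
    then show ?thesis by simp
  qed
  have "run (cmd_prog (Def j \<phi>)) (?c (at_cell N 3 4 5 j 0 (?S 0))) (sweep_cost N (fm_cost N \<phi> + 4))
      (?c (at_cell N 3 4 5 j 0 (?S (N ^ 3))))"
    unfolding cmd_prog.simps by (rule run_sweep[where S = ?S, OF body N]) auto
  moreover have "?S 0 = S"
  proof -
    have "?A 0 = cells S" by auto
    then show ?thesis by simp
  qed
  moreover have "?A (N ^ 3) = exec N w (Def j \<phi>) (cells S)" by simp
  ultimately show ?case unfolding at0 cmd_cost.simps by (simp only:)
next
  case (Then c d)
  have 1: "run (cmd_prog c) (conf (\<lambda>_. N) w S) (cmd_cost N c)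
    (conf (\<lambda>_. N) w (S\<lparr>cells := exec N w c (cells S)\<rparr>))"
    by (rule Then.IH(1)[of X]) (use Then.prems in auto)
  have "run (cmd_prog d) (conf (\<lambda>_. N) w (S\<lparr>cells := B\<rparr>)) (cmd_cost N d)
      (conf (\<lambda>_. N) w (S\<lparr>cells := B\<rparr>\<lparr>cells := exec N w d (cells (S\<lparr>cells := B\<rparr>))\<rparr>))" for B
    by (rule Then.IH(2)[of X]) (use Then.prems in auto)
  from run_Seq[OF 1 this] show ?case by simp
next
  case (Loop v c)
  let ?S = "\<lambda>k. S\<lparr>cells := (exec N w c ^^ k) (cells S)\<rparr>"
  have N: "N > 0" using Loop.prems(6)[of 0] by simp
  have "run (For v (cmd_prog c)) (conf (\<lambda>_. N) w ((?S 0)\<lparr>env := (env (?S 0))(v := 0)\<rparr>)) (cmd_cost N (Loop v c))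
     (conf (\<lambda>_. N) w ((?S N)\<lparr>env := (env (?S N))(v := 0)\<rparr>))"
    unfolding cmd_cost.simps
  proof (rule run_For[where S = ?S, OF _ N])
    fix k assume k: "k < N"
    let ?T = "(?S k)\<lparr>env := (env (?S k))(v := k)\<rparr>"
    have "run (cmd_prog c) (conf (\<lambda>_. N) w ?T) (cmd_cost N c)
      (conf (\<lambda>_. N) w (?T\<lparr>cells := exec N w c (cells ?T)\<rparr>))"
      by (rule Loop.IH[of "insert v X"]) (use Loop.prems k in auto)
    moreover have "?T\<lparr>cells := exec N w c (cells ?T)\<rparr> = (?S (Suc k))\<lparr>env := (env (?S (Suc k)))(v := k)\<rparr>"
      by simp
    ultimately show "run (cmd_prog c) (conf (\<lambda>_. N) w ?T) (cmd_cost N c)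
        (conf (\<lambda>_. N) w ((?S (Suc k))\<lparr>env := (env (?S (Suc k)))(v := k)\<rparr>))" by (simp only:)
  qed
  note loop = this
  have upd: "(?S k)\<lparr>env := (env (?S k))(v := 0)\<rparr> = ?S k" for k
  proof -
    have "(env S)(v := 0) = env S" using Loop.prems(1,7) by auto
    then have "(?S k)\<lparr>env := (env (?S k))(v := 0)\<rparr> = (?S k)\<lparr>env := env (?S k)\<rparr>" by simp
    then show ?thesis by simp
  qed
  have S0: "?S 0 = S" by simp
  show ?case using loop[unfolded upd, unfolded S0] by (simp only: cmd_prog.simps exec.simps)
qed

subsection \<open>Setting up the tapes\<close>

definition double :: "tape prog" where
  "double = While (\<lambda>s. s (Var 0) \<noteq> 1) (move {Var 0} {Var 1} ;; move {} {Var 1}) ;;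
     While (\<lambda>s. s (Var 1) \<noteq> 1) (move {Var 1} {Var 0})"

text \<open>The number \<open>2 ^ length w\<close> is built as a head position on
  \<open>Var 0\<close>, doubled once per input symbol. This head then walks back to \<open>0\<close>
  while all other variable heads walk out together and place their marks \<open>2\<close>; finally
  the motion is reversed so that \<open>Var 0\<close> can be marked itself.\<close>

definition setup_prog :: "tape prog" where
  "setup_prog =
     (Write ({Scratch} \<union> range Var) (\<lambda>_. 1) ;; move (range Arr) {} ;; Write (range Arr) (\<lambda>_. 2) ;;
      move {} ({Var 0} \<union> range Arr)) ;;
     While (\<lambda>s. s Inp \<noteq> 0) (double ;; move {} {Inp}) ;;
     (move {Inp} {} ;; While (\<lambda>s. s Inp \<noteq> 0) (move {Inp} {}) ;; move {} {Inp}) ;;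
     While (\<lambda>s. s (Var 0) \<noteq> 1) (move {Var 0} (Var ` {1..})) ;;
     Write (Var ` {1..}) (\<lambda>_. 2) ;;
     While (\<lambda>s. s (Var 1) \<noteq> 1) (move (Var ` {1..}) {Var 0}) ;;
     Write {Var 0} (\<lambda>_. 2) ;; rewind 0"

definition initial_state :: mstate where
  "initial_state = \<lparr>env = (\<lambda>_. 0), cells = (\<lambda>_ _. False), flag = False, flag2 = False, apos = (\<lambda>_. 0),
    spos = 0, ipos = 0\<rparr>"

abbreviation counting :: "nat \<Rightarrow> nat \<Rightarrow> int \<Rightarrow> mstate" where
  "counting a b p \<equiv> initial_state\<lparr>env := (\<lambda>v. if v = 0 then a else b), ipos := p\<rparr>"

abbreviation doubling :: "nat \<Rightarrow> nat \<Rightarrow> int \<Rightarrow> mstate" where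
  "doubling a b p \<equiv> initial_state\<lparr>env := (\<lambda>_. 0)(0 := a, 1 := b), ipos := p\<rparr>"

lemma run_double:
  "run double (conf (\<lambda>_. 0) w (doubling a 0 p)) (8 * a + 3) (conf (\<lambda>_. 0) w (doubling (2 * a) 0 p))"
proof -
  let ?c = "conf (\<lambda>_. 0) w"
  let ?\<sigma> = "\<lambda>k. ?c (doubling (a - k) (2 * k) p)"
  have "run (While (\<lambda>s. s (Var 0) \<noteq> 1) (move {Var 0} {Var 1} ;; move {} {Var 1})) (?\<sigma> 0)
    (a * ((1 + 1 + 1) + 1) + 1) (?\<sigma> a)"
  proof (rule run_While[where \<sigma> = ?\<sigma>])
    fix k assume k: "k < a"
    show "scan (?\<sigma> k) (Var 0) \<noteq> 1" using k by simp
    show "run (move {Var 0} {Var 1} ;; move {} {Var 1}) (?\<sigma> k) (1 + 1 + 1) (?\<sigma> (Suc k))"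
      by (rule run_Seq[where \<tau> = "?c (doubling (a - Suc k) (2 * k + 1) p)"]; rule run_move)
        (use k in \<open>auto simp: all_tape\<close>)
  qed simp
  moreover
  let ?\<sigma>' = "\<lambda>k. ?c (doubling k (2 * a - k) p)"
  have "run (While (\<lambda>s. s (Var 1) \<noteq> 1) (move {Var 1} {Var 0})) (?\<sigma>' 0) (2 * a * (1 + 1) + 1) (?\<sigma>' (2 * a))"
    by (rule run_While[where \<sigma> = ?\<sigma>'], simp, rule run_move) (auto simp: all_tape)
  ultimately have "run double (?c (doubling a 0 p)) (a * ((1 + 1 + 1) + 1) + 1 + (2 * a * (1 + 1) + 1) + 1)
    (?c (doubling (2 * a) 0 p))"
    unfolding double_def by (intro run_Seq) (simp_all only: diff_zero diff_self_eq_0 mult_0_right)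
  then show ?thesis by (rule run_mono) simp
qed

lemma run_setup:
  "run setup_prog (\<lambda>t. if t = Inp then input_tape w else (\<lambda>_. 0), \<lambda>_. 0)
    (length w * (8 * 2 ^ length w + 7) + 2 * length w + 6 * 2 ^ length w + 30)
    (conf (\<lambda>_. 2 ^ length w) w initial_state)"
proof -
  let ?n = "length w" and ?N = "2 ^ length w :: nat"
  \<comment> \<open>With all entries of \<open>m\<close> equal to \<open>0\<close>, no variable tape
    carries a mark \<open>2\<close> yet.\<close>
  let ?c = "conf (\<lambda>_. 0) w"
  let ?\<sigma> = "(\<lambda>t. if t = Inp then input_tape w else (\<lambda>_. 0), \<lambda>_. 0) :: tape tapes"
  have inp: "0 < input_tape w p \<longleftrightarrow> 0 \<le> p \<and> p < int ?n" for p
    by (simp add: input_tape_def)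
  have 1: "run (Write ({Scratch} \<union> range Var) (\<lambda>_. 1) ;; move (range Arr) {} ;; Write (range Arr) (\<lambda>_. 2) ;;
      move {} ({Var 0} \<union> range Arr)) ?\<sigma> (1 + (1 + (1 + 1 + 1) + 1) + 1) (?c (doubling 1 0 0))"
  proof -
    let ?V = "{Scratch} \<union> range Var"
    let ?f = "\<lambda>t. if t = Inp then input_tape w else if t \<in> ?V then (\<lambda>_. 0)(0 := 1) else (\<lambda>_. 0)"
    let ?h = "\<lambda>t. if t \<in> range Arr then - 1 else 0 :: int"
    let ?g = "\<lambda>t. if t \<in> range Arr then (\<lambda>_. 0)(- 1 := 2) else ?f t"
    have "run (Write ?V (\<lambda>_. 1)) ?\<sigma> 1 (?f, \<lambda>_. 0)"
      by (rule back_subst[of "run _ _ _", OF run_Write]) (auto simp: fun_eq_iff)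
    moreover have "run (move (range Arr) {}) (?f, \<lambda>_. 0) 1 (?f, ?h)"
      unfolding move_def by (rule back_subst[of "run _ _ _", OF run_Move]) (simp add: fun_eq_iff)
    moreover have "run (Write (range Arr) (\<lambda>_. 2)) (?f, ?h) 1 (?g, ?h)"
      by (rule back_subst[of "run _ _ _", OF run_Write]) (auto simp: fun_eq_iff)
    moreover have "run (move {} ({Var 0} \<union> range Arr)) (?g, ?h) 1 (?c (doubling 1 0 0))"
      unfolding move_def
    proof (rule back_subst[of "run _ _ _", OF run_Move])
      have "?g t p = contents (\<lambda>_. 0) w (doubling 1 0 0) t p" for t p
        by (cases t) (auto simp: initial_state_def)
      moreover have "?h t + head_shift (if t \<in> {} then Move_Left else if t \<in> {Var 0} \<union> range Arr
        then Move_Right else Stay)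
          = heads (doubling 1 0 0) t" for t
        by (cases t) (auto simp: initial_state_def)
      ultimately show "(fst (?g, ?h), \<lambda>t. snd (?g, ?h) t +
          head_shift (if t \<in> {} then Move_Left else if t \<in> {Var 0} \<union> range Arr then Move_Right else Stay)) =
          ?c (doubling 1 0 0)"
        unfolding conf_def fst_conv snd_conv by blast
    qed
    ultimately show ?thesis by (intro run_Seq)
  qed
  let ?\<sigma> = "\<lambda>k. ?c (doubling (2 ^ k) 0 (int k))"
  have 2: "run (While (\<lambda>s. s Inp \<noteq> 0) (double ;; move {} {Inp})) (?\<sigma> 0)
    (?n * ((8 * ?N + 3 + 1 + 1) + 1) + 1) (?\<sigma> ?n)"
  proof (rule run_While[where \<sigma> = ?\<sigma>])
    fix k assume k: "k < ?n"
    show "scan (?\<sigma> k) Inp \<noteq> 0" using k by (simp add: inp)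
    have "run double (?\<sigma> k) (8 * ?N + 3) (?c (doubling (2 * 2 ^ k) 0 (int k)))"
      by (rule run_mono[OF run_double]) (use k in simp)
    moreover have "run (move {} {Inp}) (?c (doubling (2 * 2 ^ k) 0 (int k))) 1 (?\<sigma> (Suc k))"
      by (rule run_move) (auto simp: all_tape)
    ultimately show "run (double ;; move {} {Inp}) (?\<sigma> k) (8 * ?N + 3 + 1 + 1) (?\<sigma> (Suc k))"
      by (rule run_Seq)
  qed (simp add: inp)
  let ?\<sigma>' = "\<lambda>k. ?c (doubling ?N 0 (int ?n - 1 - int k))"
  have 3: "run (move {Inp} {}) (?\<sigma> ?n) 1 (?\<sigma>' 0)"
    by (rule run_move) (auto simp: all_tape)
  have 4: "run (While (\<lambda>s. s Inp \<noteq> 0) (move {Inp} {})) (?\<sigma>' 0) (?n * (1 + 1) + 1) (?\<sigma>' ?n)"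
    by (rule run_While[where \<sigma> = ?\<sigma>'], simp add: inp, rule run_move) (auto simp: all_tape inp)
  have 5: "run (move {} {Inp}) (?\<sigma>' ?n) 1 (?c (counting (?N - 0) 0 0))"
    by (rule run_move) (auto simp: all_tape)
  let ?\<tau> = "\<lambda>k. ?c (counting (?N - k) k 0)"
  have 6: "run (While (\<lambda>s. s (Var 0) \<noteq> 1) (move {Var 0} (Var ` {1..}))) (?\<tau> 0) (?N * (1 + 1) + 1) (?\<tau> ?N)"
    by (rule run_While[where \<sigma> = ?\<tau>], simp, rule run_move) (auto simp: all_tape image_iff)
  \<comment> \<open>When the other marks are written the head of \<open>Var 0\<close> is at
    \<open>0\<close>, so this tape gets its mark only after the way back.\<close>
  let ?m = "\<lambda>v. if v = 0 then 0 else ?N"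
  let ?\<tau>' = "\<lambda>k. conf ?m w (counting k (?N - k) 0)"
  have 7: "run (Write (Var ` {1..}) (\<lambda>_. 2)) (?\<tau> ?N) 1 (?\<tau>' 0)"
    by (rule run_write) (auto simp: all_tape fun_eq_iff image_iff initial_state_def elim!: heads.elims)
  have 8: "run (While (\<lambda>s. s (Var 1) \<noteq> 1) (move (Var ` {1..}) {Var 0})) (?\<tau>' 0) (?N * (1 + 1) + 1) (?\<tau>' ?N)"
    by (rule run_While[where \<sigma> = ?\<tau>'], simp, rule run_move) (auto simp: all_tape image_iff)
  let ?S = "counting ?N 0 0"
  have 9: "run (Write {Var 0} (\<lambda>_. 2)) (?\<tau>' ?N) 1 (conf (\<lambda>_. ?N) w ?S)"
    by (rule run_write) (auto simp: all_tape fun_eq_iff image_iff initial_state_def elim!: heads.elims)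
  have "run (rewind 0) (conf (\<lambda>_. ?N) w ?S) (2 * ?N + 1) (conf (\<lambda>_. ?N) w (?S\<lparr>env := (env ?S)(0 := 0)\<rparr>))"
    by (rule run_rewind) simp
  moreover have "?S\<lparr>env := (env ?S)(0 := 0)\<rparr> = initial_state"
    by (auto simp: initial_state_def fun_eq_iff)
  ultimately have 10: "run (rewind 0) (conf (\<lambda>_. ?N) w ?S) (2 * ?N + 1) (conf (\<lambda>_. ?N) w initial_state)"
    by (simp only:)
  have 11: "?c (doubling 1 0 0) = ?\<sigma> 0" by simp
  show ?thesis
    unfolding setup_prog_def
    by (rule run_mono[OF run_Seq[OF 1[unfolded 11]
      run_Seq[OF 2 run_Seq[OF run_Seq[OF 3 run_Seq[OF 4 5]] run_Seq[OF 6
       run_Seq[OF 7 run_Seq[OF 8 run_Seq[OF 9 10]]]]]]]]) (simp add: algebra_simps)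
qed


subsection \<open>Time bounds\<close>

text \<open>For \<open>n \<ge> 1\<close> monomials are monotone in the degree, so that sums of
  bounds are bounds again.\<close>

definition poly_bounded :: "(nat \<Rightarrow> nat) \<Rightarrow> bool" where
  "poly_bounded f \<longleftrightarrow> (\<exists>c d. \<forall>n\<ge>1. f n \<le> c * n ^ d)"

lemma poly_bounded_const [simp]: "poly_bounded (\<lambda>_. c)"
  unfolding poly_bounded_def by (rule exI[of _ c], rule exI[of _ 0]) simp

lemma poly_bounded_id [simp]: "poly_bounded (\<lambda>n. n)"
  unfolding poly_bounded_def by (rule exI[of _ 1], rule exI[of _ 1]) simp

lemma poly_bounded_add [simp]:
  assumes "poly_bounded f" "poly_bounded g"
  shows "poly_bounded (\<lambda>n. f n + g n)"
proof -
  obtain c d c' d' where 1: "\<And>n. n \<ge> 1 \<Longrightarrow> f n \<le> c * n ^ d" and 2: "\<And>n. n \<ge> 1 \<Longrightarrow> g n \<le> c' * n ^ d'"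
    using assms unfolding poly_bounded_def by blast
  have "f n + g n \<le> (c + c') * n ^ (d + d')" if "n \<ge> 1" for n
  proof -
    have "n ^ d \<le> n ^ (d + d')" "n ^ d' \<le> n ^ (d + d')" using that by (auto intro: power_increasing)
    then have "c * n ^ d + c' * n ^ d' \<le> c * n ^ (d + d') + c' * n ^ (d + d')"
      by (intro add_mono mult_le_mono2)
    then show ?thesis using 1[OF that] 2[OF that] by (simp add: distrib_right)
  qed
  then show ?thesis unfolding poly_bounded_def by blast
qed

lemma poly_bounded_mult [simp]:
  assumes "poly_bounded f" "poly_bounded g"
  shows "poly_bounded (\<lambda>n. f n * g n)"
proof -
  obtain c d c' d' where 1: "\<And>n. n \<ge> 1 \<Longrightarrow> f n \<le> c * n ^ d" and 2: "\<And>n. n \<ge> 1 \<Longrightarrow> g n \<le> c' * n ^ d'"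
    using assms unfolding poly_bounded_def by blast
  have "f n * g n \<le> (c * c') * n ^ (d + d')" if "n \<ge> 1" for n
    using mult_le_mono[OF 1[OF that] 2[OF that]] by (simp add: power_add algebra_simps)
  then show ?thesis unfolding poly_bounded_def by blast
qed

lemma poly_bounded_power [simp]: "poly_bounded f \<Longrightarrow> poly_bounded (\<lambda>n. f n ^ k)"
  by (induction k) simp_all

lemma poly_bounded_Suc [simp]: "poly_bounded f \<Longrightarrow> poly_bounded (\<lambda>n. Suc (f n))"
  using poly_bounded_add[of f "\<lambda>_. 1"] by simp

lemma poly_bounded_sweep: "poly_bounded f \<Longrightarrow> poly_bounded (\<lambda>n. sweep_cost n (f n))"
  unfolding sweep_cost_def Let_def by simp

lemma poly_bounded_fm: "poly_bounded (\<lambda>n. fm_cost n \<phi>)"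
  by (induction \<phi>) (simp_all add: rel_cost_def poly_bounded_sweep)

lemma poly_bounded_cmd: "poly_bounded (\<lambda>n. cmd_cost n c)"
  by (induction c) (simp_all add: poly_bounded_sweep poly_bounded_fm)

text \<open>At \<open>2 ^ n\<close> a bound of degree \<open>d\<close> becomes
  \<open>2 ^ (n * d)\<close>, and \<open>n * d \<le> d ^ 2 + n ^ 2\<close> moves the degree into a
  constant factor. Hence the exponent \<open>n ^ 2\<close> suffices for every program.\<close>

lemma poly_bounded_exp:
  assumes "poly_bounded f"
  shows "\<exists>c. \<forall>n. f (2 ^ n) \<le> c * 2 ^ n ^ 2"
proof -
  obtain c d where f: "\<And>n. n \<ge> 1 \<Longrightarrow> f n \<le> c * n ^ d"
    using assms unfolding poly_bounded_def by blast
  have "f (2 ^ n) \<le> (c * 2 ^ d ^ 2) * 2 ^ n ^ 2" for n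
  proof -
    have "n * d \<le> d ^ 2 + n ^ 2"
    proof (cases "n \<le> d")
      case True
      then show ?thesis by (simp add: power2_eq_square trans_le_add1)
    next
      case False
      then show ?thesis by (simp add: power2_eq_square trans_le_add2)
    qed
    then have "(2 :: nat) ^ (n * d) \<le> 2 ^ d ^ 2 * 2 ^ n ^ 2"
      by (metis one_le_numeral power_add power_increasing)
    then have "c * (2 ^ n) ^ d \<le> c * (2 ^ d ^ 2 * 2 ^ n ^ 2)"
      by (metis mult_le_mono2 power_mult)
    moreover have "f (2 ^ n) \<le> c * (2 ^ n) ^ d"
      by (rule f) simp
    ultimately have "f (2 ^ n) \<le> c * (2 ^ d ^ 2 * 2 ^ n ^ 2)" by (rule order_trans[rotated])
    then show ?thesis by (simp only: mult.assoc)
  qed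
  then show ?thesis by blast
qed

subsection \<open>Definability in exponential time\<close>

primrec fm_ids :: "fm \<Rightarrow> nat set" where
  "fm_ids (Less i j) = {i, j}"
| "fm_ids (Input b i) = {i}"
| "fm_ids (Rel j x y z) = {j, x, y, z}"
| "fm_ids (Neg \<phi>) = fm_ids \<phi>"
| "fm_ids (And \<phi> \<psi>) = fm_ids \<phi> \<union> fm_ids \<psi>"
| "fm_ids (Ex v \<phi>) = insert v (fm_ids \<phi>)"

primrec cmd_ids :: "cmd \<Rightarrow> nat set" where
  "cmd_ids (Def j \<phi>) = insert j (fm_ids \<phi>)"
| "cmd_ids (c \<then> d) = cmd_ids c \<union> cmd_ids d"
| "cmd_ids (Loop v c) = insert v (cmd_ids c)"

text \<open>\<open>Inp\<close> comes first because a Turing machine receives its input on the first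
  tape.\<close>

definition tapes_upto :: "nat \<Rightarrow> tape list" where
  "tapes_upto k = [Inp, Flag, Flag2, Scratch] @ map Arr [0..<k] @ map Var [0..<k]"

lemma distinct_tapes_upto: "distinct (tapes_upto k)"
  by (auto simp: tapes_upto_def distinct_map inj_on_def)

lemma wf_move [simp]: "wf_prog T (move L R)"
  by (simp add: move_def)

lemma depends_onI:
  assumes "\<And>s. g s = g (\<lambda>t. if t \<in> T then s t else 0)"
  shows "depends_on T g"
proof -
  have "g s = g s'" if "\<forall>t\<in>T. s t = s' t" for s s'
  proof -
    have "(\<lambda>t. if t \<in> T then s t else 0) = (\<lambda>t. if t \<in> T then s' t else 0)"
      using that by auto
    then show ?thesis using assms[of s] assms[of s'] by simp
  qed
  then show ?thesis by (simp add: depends_on_def)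
qed

context
  fixes k :: nat and T :: "tape set"
  defines "T \<equiv> set (tapes_upto k)"
begin

lemma tapes [simp]: "Inp \<in> T" "Flag \<in> T" "Flag2 \<in> T" "Scratch \<in> T"
  "i < k \<Longrightarrow> Arr i \<in> T" "i < k \<Longrightarrow> Var i \<in> T"
  by (auto simp: tapes_upto_def T_def)

lemma wf_rewind: "v < k \<Longrightarrow> wf_prog T (rewind v)"
  unfolding rewind_def wf_prog.simps by (auto intro!: depends_onI)

lemma wf_For: "wf_prog T p \<Longrightarrow> v < k \<Longrightarrow> wf_prog T (For v p)"
  unfolding For_def wf_prog.simps by (auto intro!: depends_onI wf_rewind)

lemma wf_sweep:
  assumes "wf_prog T p" "a < k" "b < k" "c < k" "j < k"
  shows "wf_prog T (sweep a b c j p)"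
proof -
  have "wf_prog T (rewind_arr j)"
    unfolding rewind_arr_def wf_prog.simps using assms by (auto intro!: depends_onI)
  then show ?thesis
    unfolding sweep_def wf_prog.simps using assms by (auto intro!: wf_For)
qed

lemma wf_less: "i < k \<Longrightarrow> j < k \<Longrightarrow> wf_prog T (less_prog i j)"
  unfolding less_prog_def wf_prog.simps by (auto intro!: depends_onI)

lemma wf_input: "i < k \<Longrightarrow> wf_prog T (input_prog b i)"
  unfolding input_prog_def wf_prog.simps by (auto intro!: depends_onI)

lemma wf_neg: "wf_prog T p \<Longrightarrow> wf_prog T (neg_prog p)"
  unfolding neg_prog_def wf_prog.simps by (auto intro!: depends_onI)

lemma wf_and: "wf_prog T p \<Longrightarrow> wf_prog T q \<Longrightarrow> wf_prog T (and_prog p q)"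
  unfolding and_prog_def wf_prog.simps by (auto intro!: depends_onI)

lemma wf_eq: "i < k \<Longrightarrow> j < k \<Longrightarrow> wf_prog T (eq_prog i j)"
  unfolding eq_prog_def by (intro wf_and wf_neg wf_less)

lemma wf_ex: "wf_prog T p \<Longrightarrow> v < k \<Longrightarrow> wf_prog T (ex_prog v p)"
  unfolding ex_prog_def wf_prog.simps by (auto intro!: depends_onI wf_rewind)

lemma wf_rel:
  assumes "j < k" "x < k" "y < k" "z < k" "5 < k"
  shows "wf_prog T (rel_prog j x y z)"
proof -
  have "wf_prog T (and_prog (eq_prog 0 x) (and_prog (eq_prog 1 y) (eq_prog 2 z)))"
    using assms by (intro wf_and wf_eq) auto
  then have "wf_prog T (and_prog (eq_prog 0 x) (and_prog (eq_prog 1 y) (eq_prog 2 z)) ;;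
        Branch (\<lambda>s. s Flag = 1) (Write {Flag2} (\<lambda>s. if s (Arr j) = 1 then 1 else 0)) skip)"
    unfolding wf_prog.simps using assms by (auto intro!: depends_onI)
  then show ?thesis
    unfolding rel_prog_def wf_prog.simps(2,3) using assms
    by (intro conjI wf_sweep) (auto intro!: depends_onI)
qed

lemma wf_fm_prog: "\<forall>i\<in>fm_ids \<phi>. i < k \<Longrightarrow> 5 < k \<Longrightarrow> wf_prog T (fm_prog \<phi>)"
  by (induction \<phi>) (auto intro!: wf_less wf_input wf_rel wf_neg wf_and wf_ex)

lemma wf_cmd_prog: "\<forall>i\<in>cmd_ids c. i < k \<Longrightarrow> 5 < k \<Longrightarrow> wf_prog T (cmd_prog c)"
proof (induction c)
  case (Def j \<phi>)
  have "wf_prog T (fm_prog \<phi> ;; Write {Arr j} (\<lambda>s. if s Flag = 1 then 1 else 0) ;; Write {Flag} (\<lambda>_. 0))"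
    unfolding wf_prog.simps(2,3) using Def by (auto intro!: depends_onI wf_fm_prog)
  then show ?case
    unfolding cmd_prog.simps using Def by (intro wf_sweep) auto
qed (auto intro!: wf_For)

lemma wf_setup: "5 < k \<Longrightarrow> wf_prog T setup_prog"
  unfolding setup_prog_def double_def wf_prog.simps by (auto intro!: depends_onI wf_rewind)

end

definition decided :: "cmd \<Rightarrow> fm \<Rightarrow> bool list \<Rightarrow> bool" where
  "decided c \<phi> w \<longleftrightarrow> (let N = 2 ^ length w in sem N w (exec N w c (\<lambda>_ _. False)) (\<lambda>_. 0) \<phi>)"

theorem decided_in_EXPTIME:
  assumes "wf_cmd {} c" "wf_fm {} \<phi>"
  shows "{w. decided c \<phi> w} \<in> EXPTIME"
proof -
  \<comment> \<open>The \<open>5\<close> makes room for the variables \<open>0\<close> to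
    \<open>5\<close>, which the sweeps use even if no formula contains them.\<close>
  define k where "k = Suc (Max (insert 5 (cmd_ids c \<union> fm_ids \<phi>)))"
  have "finite (fm_ids \<psi>)" for \<psi> by (induction \<psi>) auto
  moreover from this have "finite (cmd_ids d)" for d by (induction d) auto
  ultimately have fin: "finite (insert 5 (cmd_ids c \<union> fm_ids \<phi>))" by simp
  have ids: "i < k" if "i \<in> insert 5 (cmd_ids c \<union> fm_ids \<phi>)" for i
    using Max_ge[OF fin that] by (simp add: k_def)
  \<comment> \<open>Two occurrences of \<open>length w\<close> in the setup time are replaced by
    \<open>N\<close>, so that the bound is a function of \<open>N\<close> alone.\<close>
  let ?f = "\<lambda>N. (N * (8 * N + 7) + 2 * N + 6 * N + 30) + (cmd_cost N c + fm_cost N \<phi> + 1) + 1"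
  have "poly_bounded ?f" by (simp add: poly_bounded_cmd poly_bounded_fm)
  then obtain C where C: "\<And>n. ?f (2 ^ n) \<le> C * 2 ^ n ^ 2"
    using poly_bounded_exp by blast
  have "{w. decided c \<phi> w} \<in> DTIME (\<lambda>n. 2 ^ n ^ 2)"
  proof (rule DTIME_I[where ts = "tapes_upto k" and inp = Inp and flag = Flag and c = C])
    show "wf_prog (set (tapes_upto k)) (setup_prog ;; cmd_prog c ;; fm_prog \<phi>)"
      using wf_setup[of k] wf_cmd_prog[of c k] wf_fm_prog[of \<phi> k] ids by simp
  next
    fix w :: "bool list"
    let ?N = "2 ^ length w :: nat"
    let ?A = "exec ?N w c (\<lambda>_ _. False)"
    let ?c = "conf (\<lambda>_. ?N) w"
    let ?S = "initial_state\<lparr>cells := ?A\<rparr>"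
    have "length w \<le> ?N" by (simp add: less_imp_le)
    then have "length w * (8 * ?N + 7) + 2 * length w + 6 * ?N + 30 \<le> ?N * (8 * ?N + 7) + 2 * ?N + 6 * ?N + 30"
      by (intro add_mono mult_le_mono) auto
    note 1 = run_mono[OF run_setup this]
    have 2: "run (cmd_prog c) (?c initial_state) (cmd_cost ?N c)
        (?c (initial_state\<lparr>cells := exec ?N w c (cells initial_state)\<rparr>))"
      by (rule run_cmd[OF assms(1)]) (simp_all add: initial_state_def)
    have "cells initial_state = (\<lambda>_ _. False)" by (simp add: initial_state_def)
    note 2 = 2[unfolded this]
    have 3: "run (fm_prog \<phi>) (?c ?S) (fm_cost ?N \<phi>) (?c (?S\<lparr>flag := sem ?N w (cells ?S) (env ?S) \<phi>\<rparr>))"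
      by (rule run_fm[OF assms(2)]) (simp_all add: initial_state_def)
    from run_mono[OF run_Seq[OF 1 run_Seq[OF 2 3]] C[of "length w"]]
    have "run (setup_prog ;; cmd_prog c ;; fm_prog \<phi>) (\<lambda>t. if t = Inp then input_tape w else (\<lambda>_. 0), \<lambda>_. 0)
        (C * 2 ^ length w ^ 2) (?c (?S\<lparr>flag := sem ?N w (cells ?S) (env ?S) \<phi>\<rparr>))" .
    moreover have "scan (?c (?S\<lparr>flag := sem ?N w (cells ?S) (env ?S) \<phi>\<rparr>)) Flag = 1 \<longleftrightarrow> w \<in> {w. decided c \<phi> w}"
      by (simp add: decided_def Let_def initial_state_def)
    ultimately show "\<exists>\<tau>. run (setup_prog ;; cmd_prog c ;; fm_prog \<phi>)
      (\<lambda>t. if t = Inp then input_tape w else (\<lambda>_. 0), \<lambda>_. 0)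
        (C * 2 ^ length w ^ 2) \<tau> \<and> (scan \<tau> Flag = 1 \<longleftrightarrow> w \<in> {w. decided c \<phi> w})"
      by blast
  qed (simp_all add: distinct_tapes_upto, simp_all add: tapes_upto_def)
  then show ?thesis unfolding EXPTIME_def by blast
qed

section \<open>The distribution of prefixes\<close>

definition play_prefix :: "nat \<Rightarrow> ('s, 'a) play \<Rightarrow> ('s, 'a) prefix" where
  "play_prefix n \<pi> = (map \<pi> [0..<n], fst (\<pi> n))"

text \<open>Here time is cut after a state, whereas the rounds of the outcome measure end with a
  letter. Beliefs and strategies of Player 1 refer to prefixes that end with a state.\<close>

definition extend_prefix :: "('s, 'a) strategy1 \<Rightarrow> ('s, 'a) strategy2 \<Rightarrow> ('s, 'a) prefix \<Rightarrow>
  ('s, 'a) prefix pmf" where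
  "extend_prefix \<alpha> \<beta> p = bind_pmf (\<alpha> p) (\<lambda>\<sigma>. map_pmf (Pair (fst p @ [(snd p, \<sigma>)])) (\<beta> p \<sigma>))"

primrec rounds_pmf :: "('s, 'a, 'o) game_structure \<Rightarrow> ('s, 'a) strategy1 \<Rightarrow> ('s, 'a) strategy2 \<Rightarrow> nat \<Rightarrow>
  ('s \<times> 'a) list pmf" where
  "rounds_pmf G \<alpha> \<beta> 0 = return_pmf []"
| "rounds_pmf G \<alpha> \<beta> (Suc n) = bind_pmf (rounds_pmf G \<alpha> \<beta> n) (\<lambda>h. map_pmf (\<lambda>r. h @ [r]) (next_round G \<alpha> \<beta> h))"

primrec prefix_pmf :: "('s, 'a, 'o) game_structure \<Rightarrow> ('s, 'a) strategy1 \<Rightarrow> ('s, 'a) strategy2 \<Rightarrow> nat \<Rightarrow>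
  ('s, 'a) prefix pmf" where
  "prefix_pmf G \<alpha> \<beta> 0 = return_pmf ([], initial G)"
| "prefix_pmf G \<alpha> \<beta> (Suc n) = bind_pmf (prefix_pmf G \<alpha> \<beta> n) (extend_prefix \<alpha> \<beta>)"

text \<open>The same random choices, regrouped by associativity of \<open>bind_pmf\<close>: the two
  processes differ by the pending choice of the next state.\<close>

lemma prefix_pmf_rounds:
  "prefix_pmf G \<alpha> \<beta> n = bind_pmf (rounds_pmf G \<alpha> \<beta> n) (\<lambda>h. map_pmf (Pair h) (next_state G \<beta> h))"
proof (induction n)
  case 0
  then show ?case by (simp add: bind_return_pmf next_state_def)
next
  case (Suc n)
  have "next_state G \<beta> (h @ [(q, \<sigma>)]) = \<beta> (h, q) \<sigma>" for h q \<sigma>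
    by (simp add: next_state_def)
  then show ?case
    by (simp add: Suc bind_assoc_pmf bind_map_pmf map_bind_pmf next_round_def extend_prefix_def map_pmf_comp)
qed

text \<open>Forgetting the last letter undoes the half-round shift, so events about prefixes become
  events about completed rounds.\<close>

lemma prefix_pmf_eq_map:
  "prefix_pmf G \<alpha> \<beta> n = map_pmf (\<lambda>h. (butlast h, fst (last h))) (rounds_pmf G \<alpha> \<beta> (Suc n))"
  unfolding prefix_pmf_rounds
  by (simp add: map_bind_pmf next_round_def map_pmf_comp bind_map_pmf) (simp add: map_pmf_def)

locale play_measure =
  fixes G :: "('s, 'a, 'o) game_structure" and \<alpha> :: "('s, 'a) strategy1" and \<beta> :: "('s, 'a) strategy2"
  assumes game: "is_game_structure G"
    and strategy1: "randomized_strategy1 G \<alpha>" and strategy2: "randomized_strategy2 G \<beta>"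
begin

abbreviation "S \<equiv> states G \<times> alphabet G"
abbreviation "M \<equiv> outcome_measure G \<alpha> \<beta>"

sublocale IT: Ionescu_Tulcea "round_kernel G \<alpha> \<beta>" "rounds_space G"
  by (rule Ionescu_Tulcea_round_kernel[OF game strategy1 strategy2])

lemma finite_S: "finite S"
  using game by (simp add: is_game_structure_def)

lemma PiM_rounds: "PiM {0..<i} (rounds_space G) = count_space (PiE {0..<i} (\<lambda>_. S))"
  using finite_S by (intro count_space_PiM_finite) (auto intro: countable_finite)

lemma M_eq: "M = IT.PF.lim"
  by (simp add: outcome_measure_def)

sublocale prob_space M
  unfolding M_eq
proof
  \<comment> \<open>The cylinder over the empty index set is the whole space.\<close>
  have "emeasure IT.PF.lim (IT.PF.emb UNIV {} (space (PiM {} (rounds_space G)))) = 1"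
  proof (subst IT.lim)
    have "space (IT.CI {}) = space (PiM {} (rounds_space G))"
      by (simp add: IT.CI_def)
    then show "emeasure (IT.CI {}) (space (PiM {} (rounds_space G))) = 1"
      using prob_space.emeasure_space_1[OF IT.PF.prob_space_P, of "{}"] by simp
  qed auto
  moreover have "IT.PF.emb UNIV {} (space (PiM {} (rounds_space G))) = space IT.PF.lim"
    by (auto simp: prod_emb_def space_PiM)
  ultimately show "emeasure IT.PF.lim (space IT.PF.lim) = 1" by simp
qed

lemma space_M: "space M = (UNIV \<rightarrow> S)"
  by (simp add: M_eq space_PiM PiE_UNIV_domain)

text \<open>In the Ionescu-Tulcea construction the measure for \<open>Suc n\<close> rounds is the
  one for \<open>n\<close> rounds bound to the kernel \<open>IT.eP n\<close>; listing the rounds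
  turns this into the recursion of \<open>rounds_pmf\<close>. The finite products are discrete, so
  measurability is automatic.\<close>

lemma distr_rounds:
  "distr (IT.C 0 n (\<lambda>_. undefined)) (count_space UNIV) (\<lambda>x. map x [0..<n]) = measure_pmf (rounds_pmf G \<alpha> \<beta> n)"
proof (induction n)
  case 0
  have "(\<lambda>_. undefined) \<in> space (PiM {0..<0} (rounds_space G))" by simp
  show ?case
  proof (rule measure_eqI)
    fix A :: "('s \<times> 'a) list set"
    show "emeasure (distr (IT.C 0 0 (\<lambda>_. undefined)) (count_space UNIV) (\<lambda>x. map x [0..<0])) A =
        emeasure (measure_pmf (rounds_pmf G \<alpha> \<beta> 0)) A"
      by (subst emeasure_distr) (auto simp: PiM_empty indicator_def)
  qed simp
next
  case (Suc n)
  let ?u = "\<lambda>_. undefined :: 's \<times> 'a"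
  let ?C = "IT.C 0 n ?u"
  have u: "?u \<in> space (PiM {0..<0} (rounds_space G))" by simp
  have setsC: "sets (IT.C 0 m ?u) = sets (PiM {0..<m} (rounds_space G))" for m
    using IT.sets_C[OF u, of m] by simp
  have spaceC: "space (IT.C 0 m ?u) = PiE {0..<m} (\<lambda>_. S)" for m
    using IT.space_C[OF u, of m] by (simp add: PiM_rounds)
  have meas: "f \<in> IT.C 0 m ?u \<rightarrow>\<^sub>M count_space UNIV" for f :: "(nat \<Rightarrow> 's \<times> 'a) \<Rightarrow> 'c" and m
    unfolding measurable_cong_sets[OF setsC refl] PiM_rounds by simp
  show ?case
  proof (rule measure_eqI)
    fix A :: "('s \<times> 'a) list set"
    let ?X = "{x \<in> PiE {0..<Suc n} (\<lambda>_. S). map x [0..<Suc n] \<in> A}"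
    have step: "emeasure (IT.eP n x) ?X = emeasure
      (map_pmf (\<lambda>r. map x [0..<n] @ [r]) (next_round G \<alpha> \<beta> (map x [0..<n]))) A"
      if x: "x \<in> PiE {0..<n} (\<lambda>_. S)" for x
    proof -
      let ?h = "map x [0..<n]"
      have "set ?h \<subseteq> S" using x by (auto simp: PiE_iff)
      note sub = set_next_round[OF game strategy1 strategy2 this]
      have "emeasure (IT.eP n x) ?X = emeasure (round_kernel G \<alpha> \<beta> n x) ((\<lambda>r. fun_upd x n r) -` ?X \<inter> S)"
        using IT.emeasure_eP[of x n ?X] x unfolding PiM_rounds by simp
      also have "(\<lambda>r. fun_upd x n r) -` ?X \<inter> S = {r \<in> S. ?h @ [r] \<in> A}"
      proof -
        have "map (x(n := r)) [0..<n] = ?h" for r by simp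
        moreover have "x(n := r) \<in> PiE {0..<Suc n} (\<lambda>_. S)" if "r \<in> S" for r
          using x that by (auto simp: PiE_iff extensional_def)
        ultimately show ?thesis by auto
      qed
      also have "emeasure (round_kernel G \<alpha> \<beta> n x) \<dots> = emeasure (next_round G \<alpha> \<beta> ?h) {r \<in> S. ?h @ [r] \<in> A}"
        unfolding round_kernel_def by (rule emeasure_restrict_space) auto
      also have "\<dots> = emeasure (next_round G \<alpha> \<beta> ?h) ((\<lambda>r. ?h @ [r]) -` A)"
        by (rule emeasure_eq_AE) (use sub in \<open>auto simp: AE_measure_pmf_iff\<close>)
      also have "\<dots> = emeasure (map_pmf (\<lambda>r. ?h @ [r]) (next_round G \<alpha> \<beta> ?h)) A" by simp
      finally show ?thesis .
    qed
    have "emeasure (distr (IT.C 0 (Suc n) ?u) (count_space UNIV) (\<lambda>x. map x [0..<Suc n])) A =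
        emeasure (IT.C 0 (Suc n) ?u) ?X"
    proof (subst emeasure_distr)
      show "(\<lambda>x. map x [0..<Suc n]) \<in> IT.C 0 (Suc n) ?u \<rightarrow>\<^sub>M count_space UNIV" by (rule meas)
      show "emeasure (IT.C 0 (Suc n) ?u) ((\<lambda>x. map x [0..<Suc n]) -` A \<inter> space (IT.C 0 (Suc n) ?u)) =
        emeasure (IT.C 0 (Suc n) ?u) ?X"
        unfolding spaceC by (rule arg_cong[of _ _ "emeasure _"]) auto
    qed simp
    also have "\<dots> = (\<integral>\<^sup>+x. emeasure (IT.eP n x) ?X \<partial>?C)"
    proof -
      have "IT.eP n \<in> ?C \<rightarrow>\<^sub>M subprob_algebra (PiM {0..<Suc n} (rounds_space G))"
        using IT.measurable_eP[of n] by (simp add: measurable_cong_sets[OF setsC refl])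
      moreover have "space ?C \<noteq> {}"
        using prob_space.not_empty[OF IT.prob_space_C[OF u, of n]] .
      moreover have "?X \<in> sets (PiM {0..<Suc n} (rounds_space G))"
        unfolding PiM_rounds by auto
      ultimately show ?thesis by (simp add: emeasure_bind)
    qed
    also have "\<dots> = (\<integral>\<^sup>+x. emeasure (map_pmf (\<lambda>r. map x [0..<n] @ [r]) (next_round G \<alpha> \<beta> (map x [0..<n]))) A
      \<partial>?C)"
      by (rule nn_integral_cong) (use step spaceC in blast)
    also have "\<dots> = (\<integral>\<^sup>+h. emeasure (map_pmf (\<lambda>r. h @ [r]) (next_round G \<alpha> \<beta> h)) A \<partial>distr ?C
      (count_space UNIV) (\<lambda>x. map x [0..<n]))"
      by (rule nn_integral_distr[symmetric]) (auto intro: meas)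
    also have "\<dots> = emeasure (rounds_pmf G \<alpha> \<beta> (Suc n)) A"
      by (simp add: Suc)
    finally show "emeasure (distr (IT.C 0 (Suc n) ?u) (count_space UNIV) (\<lambda>x. map x [0..<Suc n])) A =
        emeasure (rounds_pmf G \<alpha> \<beta> (Suc n)) A" .
  qed simp
qed

text \<open>An event about the first \<open>n\<close> rounds is a cylinder, whose measure the
  projective limit prescribes.\<close>

lemma rounds_event:
  "{\<pi> \<in> space M. map \<pi> [0..<n] \<in> A} \<in> sets M"
  "emeasure M {\<pi> \<in> space M. map \<pi> [0..<n] \<in> A} = emeasure (rounds_pmf G \<alpha> \<beta> n) A"
proof -
  let ?u = "\<lambda>_. undefined :: 's \<times> 'a"
  let ?X = "{x \<in> PiE {0..<n} (\<lambda>_. S). map x [0..<n] \<in> A}"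
  have X: "?X \<in> sets (PiM {0..<n} (rounds_space G))" unfolding PiM_rounds by auto
  have emb: "IT.PF.emb UNIV {0..<n} ?X = {\<pi> \<in> space M. map \<pi> [0..<n] \<in> A}"
  proof -
    have *: "map (restrict \<pi> {0..<n}) [0..<n] = map \<pi> [0..<n]" for \<pi> :: "nat \<Rightarrow> 's \<times> 'a" by simp
    show ?thesis
      unfolding space_M prod_emb_def vimage_def by (auto simp only: *)
        (auto simp: space_PiM restrict_PiE_iff PiE_UNIV_domain)
  qed
  show "{\<pi> \<in> space M. map \<pi> [0..<n] \<in> A} \<in> sets M"
  proof -
    have "sets M = sets (PiM UNIV (rounds_space G))" by (simp add: M_eq)
    moreover have "IT.PF.emb UNIV {0..<n} ?X \<in> sets (PiM UNIV (rounds_space G))"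
      by (rule measurable_prod_emb[OF _ X]) simp
    ultimately show ?thesis unfolding emb by blast
  qed
  have u: "?u \<in> space (PiM {0..<0} (rounds_space G))" by simp
  have "emeasure M {\<pi> \<in> space M. map \<pi> [0..<n] \<in> A} = emeasure IT.PF.lim (IT.PF.emb UNIV {0..<n} ?X)"
    unfolding emb by (simp add: M_eq)
  also have "\<dots> = emeasure (IT.CI {0..<n}) ?X"
    by (rule IT.lim[OF _ X]) simp
  also have "\<dots> = emeasure (IT.C 0 n ?u) ?X"
  proof -
    have "IT.PF.emb {0..<n} {0..<n} ?X = ?X"
      by (rule prod_emb_id) (auto simp: space_PiM)
    then show ?thesis using IT.emeasure_CI[OF _ X, of n] by simp
  qed
  also have "\<dots> = emeasure (distr (IT.C 0 n ?u) (count_space UNIV) (\<lambda>x. map x [0..<n])) A"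
  proof -
    have "sets (IT.C 0 n ?u) = sets (PiM {0..<n} (rounds_space G))" "space (IT.C 0 n ?u) = PiE {0..<n} (\<lambda>_. S)"
      using IT.sets_C[OF u, of n] IT.space_C[OF u, of n] by (simp_all add: PiM_rounds)
    then have "sets (IT.C 0 n ?u) = Pow (space (IT.C 0 n ?u))" by (simp add: PiM_rounds)
    then have "(\<lambda>x. map x [0..<n]) \<in> IT.C 0 n ?u \<rightarrow>\<^sub>M count_space UNIV"
      by (auto simp: measurable_def)
    moreover have "(\<lambda>x. map x [0..<n]) -` A \<inter> space (IT.C 0 n ?u) = ?X"
      using \<open>space (IT.C 0 n ?u) = PiE {0..<n} (\<lambda>_. S)\<close> by auto
    ultimately show ?thesis by (simp add: emeasure_distr)
  qed
  finally show "emeasure M {\<pi> \<in> space M. map \<pi> [0..<n] \<in> A} = emeasure (rounds_pmf G \<alpha> \<beta> n) A"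
    by (simp add: distr_rounds)
qed

lemma prefix_event:
  "{\<pi> \<in> space M. play_prefix n \<pi> \<in> A} \<in> sets M"
  "emeasure M {\<pi> \<in> space M. play_prefix n \<pi> \<in> A} = emeasure (prefix_pmf G \<alpha> \<beta> n) A"
proof -
  let ?f = "\<lambda>h :: ('s \<times> 'a) list. (butlast h, fst (last h))"
  have "play_prefix n \<pi> \<in> A \<longleftrightarrow> map \<pi> [0..<Suc n] \<in> ?f -` A" for \<pi>
    by (simp add: play_prefix_def)
  then have eq: "{\<pi> \<in> space M. play_prefix n \<pi> \<in> A} = {\<pi> \<in> space M. map \<pi> [0..<Suc n] \<in> ?f -` A}"
    by simp
  show "{\<pi> \<in> space M. play_prefix n \<pi> \<in> A} \<in> sets M"
    unfolding eq by (rule rounds_event)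
  show "emeasure M {\<pi> \<in> space M. play_prefix n \<pi> \<in> A} = emeasure (prefix_pmf G \<alpha> \<beta> n) A"
    unfolding eq rounds_event prefix_pmf_eq_map by simp
qed

lemma AE_prefix: "AE \<pi> in M. play_prefix n \<pi> \<in> set_pmf (prefix_pmf G \<alpha> \<beta> n)"
proof (rule AE_I_eq_1)
  show "{\<pi> \<in> space M. play_prefix n \<pi> \<in> set_pmf (prefix_pmf G \<alpha> \<beta> n)} \<in> sets M"
    by (rule prefix_event)
  show "emeasure M {\<pi> \<in> space M. play_prefix n \<pi> \<in> set_pmf (prefix_pmf G \<alpha> \<beta> n)} = 1"
    unfolding prefix_event by (rule measure_pmf.emeasure_eq_1_AE) (auto simp: AE_measure_pmf_iff)
qed

text \<open>A prefix determines its predecessor, so lying in the support at length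
  \<open>Suc n\<close> already says that the last step was a possible one.\<close>

lemma AE_extend_prefix: "AE \<pi> in M. \<forall>n. play_prefix (Suc n) \<pi> \<in> set_pmf (extend_prefix \<alpha> \<beta> (play_prefix n \<pi>))"
proof (subst AE_all_countable, rule allI)
  fix n
  have "play_prefix n \<pi> = p" if "play_prefix (Suc n) \<pi> \<in> set_pmf (extend_prefix \<alpha> \<beta> p)" for \<pi> p
    using that by (cases p) (auto simp: play_prefix_def extend_prefix_def)
  then show "AE \<pi> in M. play_prefix (Suc n) \<pi> \<in> set_pmf (extend_prefix \<alpha> \<beta> (play_prefix n \<pi>))"
    using AE_prefix[of "Suc n"] by (auto elim!: eventually_mono)
qed

lemma Buchi_measurable: "Buchi G T \<inter> space M \<in> sets M" if "finite T"
proof -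
  have "{\<pi> \<in> space M. obs_of G (fst (\<pi> i)) = b} \<in> sets M" for i b
    using prefix_event(1)[of i "{p. obs_of G (snd p) = b}"] by (simp add: play_prefix_def)
  note [measurable] = this
  have "Buchi G T \<inter> space M = {\<pi> \<in> space M. \<exists>b\<in>T. \<forall>n. \<exists>i>n. obs_of G (fst (\<pi> i)) = b}"
    by (auto simp: Buchi_def INFM_nat)
  also have "\<dots> \<in> sets M"
    using that by measurable
  finally show ?thesis .
qed

end

section \<open>Knowledge and beliefs\<close>

definition post :: "('s, 'a, 'o) game_structure \<Rightarrow> 's set \<Rightarrow> 'a \<Rightarrow> 's set" where
  "post G s \<sigma> = {q'. \<exists>q\<in>s. (q, \<sigma>, q') \<in> transitions G}"

definition next_belief :: "('s, 'a, 'o) game_structure \<Rightarrow> 's set \<Rightarrow> 'a \<Rightarrow> 's \<Rightarrow> 's set" where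
  "next_belief G s \<sigma> q' = {q\<in>post G s \<sigma>. obs_of G q = obs_of G q'}"

text \<open>Player 1 cannot tell the states of \<open>s\<close> apart, so transitions from all of
  them count and not only those from the actual state.\<close>

definition allowed :: "('s, 'a, 'o) game_structure \<Rightarrow> 's set set \<Rightarrow> 's set \<Rightarrow> 'a \<Rightarrow> bool" where
  "allowed G Y s \<sigma> \<longleftrightarrow> (\<forall>q\<in>s. \<forall>q'. (q, \<sigma>, q') \<in> transitions G \<longrightarrow> next_belief G s \<sigma> q' \<in> Y)"

text \<open>The least fixpoint of \<open>reach_step G T Y\<close> consists of the pairs of a belief and a state in it from
  which playing all allowed letters with positive probability reaches \<open>T\<close> with positive probability
  against every opponent; \<open>safe_step\<close> keeps the beliefs all of whose states are of this kind.\<close>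

definition reach_step :: "('s, 'a, 'o) game_structure \<Rightarrow> 'o set \<Rightarrow> 's set set \<Rightarrow> ('s set \<times> 's) set \<Rightarrow>
  ('s set \<times> 's) set" where
  "reach_step G T Y X = {(s, q). s \<subseteq> states G \<and> q \<in> s \<and> (obs_of G q \<in> T \<or>
     (\<exists>\<sigma>\<in>alphabet G. allowed G Y s \<sigma> \<and> (\<forall>q'. (q, \<sigma>, q') \<in> transitions G \<longrightarrow> (next_belief G s \<sigma> q', q') \<in> X)))}"

definition safe_step :: "('s, 'a, 'o) game_structure \<Rightarrow> 'o set \<Rightarrow> 's set set \<Rightarrow> 's set set" where
  "safe_step G T Y = {s. s \<subseteq> states G \<and> (\<exists>\<sigma>\<in>alphabet G. allowed G Y s \<sigma>) \<and>
    (\<forall>q\<in>s. (s, q) \<in> lfp (reach_step G T Y))}"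

definition winning_beliefs :: "('s, 'a, 'o) game_structure \<Rightarrow> 'o set \<Rightarrow> 's set set" where
  "winning_beliefs G T = gfp (safe_step G T)"

lemma allowed_mono: "Y \<subseteq> Y' \<Longrightarrow> allowed G Y s \<sigma> \<Longrightarrow> allowed G Y' s \<sigma>"
  by (auto simp: allowed_def)

lemma mono_reach_step: "mono (reach_step G T Y)"
  by (rule monoI) (auto simp: reach_step_def, blast)

lemma reach_step_mono:
  assumes Y: "Y \<subseteq> Y'"
  shows "reach_step G T Y X \<subseteq> reach_step G T Y' X"
proof clarify
  fix s q
  assume "(s, q) \<in> reach_step G T Y X"
  then have s: "s \<subseteq> states G" "q \<in> s" and "obs_of G q \<in> T \<or> (\<exists>\<sigma>\<in>alphabet G. allowed G Y s \<sigma> \<and>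
      (\<forall>q'. (q, \<sigma>, q') \<in> transitions G \<longrightarrow> (next_belief G s \<sigma> q', q') \<in> X))"
    by (auto simp: reach_step_def)
  then have "obs_of G q \<in> T \<or> (\<exists>\<sigma>\<in>alphabet G. allowed G Y' s \<sigma> \<and>
      (\<forall>q'. (q, \<sigma>, q') \<in> transitions G \<longrightarrow> (next_belief G s \<sigma> q', q') \<in> X))"
    using allowed_mono[OF Y] by metis
  with s show "(s, q) \<in> reach_step G T Y' X" by (simp add: reach_step_def)
qed

lemma mono_safe_step: "mono (safe_step G T)"
proof (rule monoI, rule subsetI)
  fix Y Y' :: "'a set set" and s
  assume Y: "Y \<subseteq> Y'" and s: "s \<in> safe_step G T Y"
  have "lfp (reach_step G T Y) \<subseteq> lfp (reach_step G T Y')"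
    by (rule lfp_mono) (rule reach_step_mono[OF Y])
  moreover obtain \<sigma> where \<sigma>: "\<sigma> \<in> alphabet G" "allowed G Y s \<sigma>"
    using s by (auto simp: safe_step_def)
  moreover have "allowed G Y' s \<sigma>" by (rule allowed_mono[OF Y \<sigma>(2)])
  ultimately show "s \<in> safe_step G T Y'"
    using s by (auto simp: safe_step_def)
qed

text \<open>The iterates increase inside the finite set \<open>U\<close>. They cannot grow strictly
  \<open>Suc n\<close> times, and where they stand still they have reached the least fixpoint. Any
  \<open>n\<close> from \<open>card U\<close> on will do, which suits loops with a fixed number of
  rounds.\<close>

lemma lfp_eq_funpow:
  fixes F :: "'x set \<Rightarrow> 'x set"
  assumes F: "mono F" and U: "\<And>X. X \<subseteq> U \<Longrightarrow> F X \<subseteq> U" "finite U" "card U \<le> n"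
  shows "(F ^^ n) {} = lfp F"
proof -
  have inc: "(F ^^ k) {} \<subseteq> (F ^^ Suc k) {}" for k
    by (induction k) (use monoD[OF F] in auto)
  have sub: "(F ^^ k) {} \<subseteq> U" for k
    by (induction k) (use U in auto)
  have lfp: "(F ^^ k) {} \<subseteq> lfp F" for k
  proof (induction k)
    case (Suc k)
    then have "F ((F ^^ k) {}) \<subseteq> F (lfp F)" by (rule monoD[OF F])
    then show ?case using lfp_unfold[OF F] by simp
  qed simp
  have "\<exists>k\<le>n. (F ^^ Suc k) {} = (F ^^ k) {}"
  proof (rule ccontr)
    assume neg: "\<not> ?thesis"
    have "k \<le> Suc n \<Longrightarrow> k \<le> card ((F ^^ k) {})" for k
    proof (induction k)
      case (Suc k)
      then have "(F ^^ Suc k) {} \<noteq> (F ^^ k) {}" using neg by (metis Suc_le_mono)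
      then have "(F ^^ k) {} \<subset> (F ^^ Suc k) {}" using inc[of k] by blast
      then have "card ((F ^^ k) {}) < card ((F ^^ Suc k) {})"
        using sub[of "Suc k"] U(2) by (meson finite_subset psubset_card_mono)
      then show ?case using Suc by simp
    qed simp
    from this[of "Suc n"] have "Suc n \<le> card U"
      using card_mono[OF U(2) sub[of "Suc n"]] by simp
    then show False using U(3) by simp
  qed
  then obtain k where k: "k \<le> n" "F ((F ^^ k) {}) = (F ^^ k) {}" by auto
  have "(F ^^ (k + j)) {} = (F ^^ k) {}" for j
    by (induction j) (use k in auto)
  from this[of "n - k"] have "(F ^^ n) {} = (F ^^ k) {}" using k by simp
  moreover have "lfp F \<subseteq> (F ^^ k) {}" by (rule lfp_lowerbound) (simp add: k)
  ultimately show ?thesis using lfp by blast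
qed

text \<open>By complementation in \<open>U\<close>: the iterates of the dual operator
  \<open>?H\<close> from the empty set are the complements of the iterates of \<open>F\<close> from
  \<open>U\<close>.\<close>

lemma gfp_eq_funpow:
  fixes F :: "'x set \<Rightarrow> 'x set"
  assumes F: "mono F" and U: "\<And>X. F X \<subseteq> U" "finite U" "card U \<le> n"
  shows "(F ^^ n) U = gfp F"
proof -
  let ?H = "\<lambda>X. U - F (U - X)"
  have H: "mono ?H"
  proof (rule monoI)
    fix X Y :: "'x set"
    assume "X \<subseteq> Y"
    then have "F (U - Y) \<subseteq> F (U - X)" by (intro monoD[OF F]) auto
    then show "?H X \<subseteq> ?H Y" by auto
  qed
  have pow: "(?H ^^ k) {} = U - (F ^^ k) U" for k
  proof (induction k)
    case (Suc k)
    have "(F ^^ k) U \<subseteq> U" using U(1) by (cases k) auto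
    then have "U - (U - (F ^^ k) U) = (F ^^ k) U" by auto
    with Suc show ?case by simp
  qed simp
  have fin: "(?H ^^ n) {} = lfp ?H"
    by (rule lfp_eq_funpow[OF H _ U(2,3)]) auto
  have sub: "(F ^^ n) U \<subseteq> U" using U(1) by (cases n) auto
  have "?H (lfp ?H) = lfp ?H" using lfp_unfold[OF H] by simp
  then have "U - F ((F ^^ n) U) = U - (F ^^ n) U"
    unfolding fin[symmetric] pow using sub by (simp add: double_diff)
  then have fp: "F ((F ^^ n) U) = (F ^^ n) U" using sub U(1) by blast
  show ?thesis
  proof
    show "(F ^^ n) U \<subseteq> gfp F" by (rule gfp_upperbound) (simp add: fp)
    have "gfp F \<subseteq> (F ^^ k) U" for k
    proof (induction k)
      case 0
      then show ?case using gfp_unfold[OF F] U(1) by auto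
    next
      case (Suc k)
      then show ?case using monoD[OF F Suc] gfp_unfold[OF F] by simp
    qed
    then show "gfp F \<subseteq> (F ^^ n) U" .
  qed
qed

subsection \<open>Prefixes\<close>

lemma prefixes_Nil: "([], q) \<in> prefixes G \<longleftrightarrow> q = initial G \<and> q \<in> states G"
  by (auto simp: prefixes_def)

lemma prefixes_snoc:
  assumes "is_game_structure G"
  shows "(h @ [(q, \<sigma>)], q') \<in> prefixes G \<longleftrightarrow> (h, q) \<in> prefixes G \<and> (q, \<sigma>, q') \<in> transitions G"
proof -
  let ?ls = "map fst h @ [q]"
  have gen: "(\<forall>i<Suc (length h). ((ls @ [q']) ! i, snd ((h @ [(q, \<sigma>)]) ! i), (ls @ [q']) ! Suc i) \<in>
    transitions G) \<longleftrightarrow>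
      (\<forall>i<length h. (ls ! i, snd (h ! i), ls ! Suc i) \<in> transitions G) \<and> (ls ! length h, \<sigma>, q') \<in> transitions G"
    if "length ls = Suc (length h)" for ls
  proof -
    have "((ls @ [q']) ! i, snd ((h @ [(q, \<sigma>)]) ! i), (ls @ [q']) ! Suc i) = (ls ! i, snd (h ! i), ls ! Suc i)"
      if "i < length h" for i
      using that \<open>length ls = Suc (length h)\<close> by (simp add: nth_append)
    moreover have "((ls @ [q']) ! length h, snd ((h @ [(q, \<sigma>)]) ! length h), (ls @ [q']) ! Suc (length h)) =
        (ls ! length h, \<sigma>, q')"
      using that by (simp add: nth_append)
    ultimately show ?thesis by (auto simp: All_less_Suc)
  qed
  have nth: "?ls ! length h = q" by (simp add: nth_append)
  have "(\<forall>i<Suc (length h). ((?ls @ [q']) ! i, snd ((h @ [(q, \<sigma>)]) ! i), (?ls @ [q']) ! Suc i) \<in> transitions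
    G) \<longleftrightarrow>
      (\<forall>i<length h. (?ls ! i, snd (h ! i), ?ls ! Suc i) \<in> transitions G) \<and> (q, \<sigma>, q') \<in> transitions G"
    using gen[of ?ls] nth by simp
  moreover have "hd (?ls @ [q']) = hd ?ls" by (cases h) auto
  moreover have "q' \<in> states G" if "(q, \<sigma>, q') \<in> transitions G"
    using that assms by (auto simp: is_game_structure_def)
  ultimately show ?thesis
    by (auto simp: prefixes_def Let_def)
qed

text \<open>Given by indistinguishable prefixes instead of a recursion, so that it is a function of
  the observations at once; the recursive update is \<open>knowledge_snoc\<close>.\<close>

definition knowledge :: "('s, 'a, 'o) game_structure \<Rightarrow> ('s, 'a) prefix \<Rightarrow> 's set" where
  "knowledge G p = {snd p' | p'. p' \<in> prefixes G \<and> obs_prefix G p' = obs_prefix G p}"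

lemma knowledge_cong: "obs_prefix G p = obs_prefix G p' \<Longrightarrow> knowledge G p = knowledge G p'"
  by (simp add: knowledge_def)

lemma knowledge_self: "p \<in> prefixes G \<Longrightarrow> snd p \<in> knowledge G p"
  unfolding knowledge_def by blast

lemma knowledge_states: "knowledge G p \<subseteq> states G"
  by (auto simp: knowledge_def prefixes_def Let_def)

lemma knowledge_Nil:
  assumes "initial G \<in> states G"
  shows "knowledge G ([], initial G) = {initial G}"
proof -
  have "snd p' = initial G" if "p' \<in> prefixes G" "obs_prefix G p' = obs_prefix G ([], initial G)" for p'
    using that prefixes_Nil[of "snd p'" G] by (cases p') (auto simp: obs_prefix_def)
  moreover have "initial G \<in> knowledge G ([], initial G)"
    using assms knowledge_self[of "([], initial G)" G] by (simp add: prefixes_Nil)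
  ultimately show ?thesis unfolding knowledge_def by blast
qed

lemma obs_prefix_eq_snocE:
  assumes "obs_prefix G p = obs_prefix G (h @ [(q, \<sigma>)], q')"
  obtains g y x where "p = (g @ [(y, \<sigma>)], x)" "obs_prefix G (g, y) = obs_prefix G (h, q)"
    "obs_of G x = obs_of G q'"
proof -
  obtain k x where p: "p = (k, x)" by (cases p)
  let ?f = "\<lambda>(l', \<sigma>). (obs_of G l', \<sigma>)"
  have eq: "map ?f k = map ?f h @ [(obs_of G q, \<sigma>)]" "obs_of G x = obs_of G q'"
    using assms by (simp_all add: p obs_prefix_def)
  then obtain g r where k: "k = g @ [r]" "map ?f g = map ?f h" "?f r = (obs_of G q, \<sigma>)"
    by (auto simp: map_eq_append_conv)
  obtain y \<tau> where r: "r = (y, \<tau>)" by (cases r)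
  then have "\<tau> = \<sigma>" "obs_of G y = obs_of G q" using k by auto
  then show ?thesis using that[of g y x] p k r eq by (simp add: obs_prefix_def)
qed

text \<open>An indistinguishable prefix shows the same letters, so cutting its last round leaves a
  prefix that looks like \<open>(h, q)\<close>; conversely such a prefix can be extended by
  \<open>\<sigma>\<close> and any successor with the observation of \<open>q'\<close>.\<close>

lemma knowledge_snoc:
  assumes G: "is_game_structure G" and p: "(h @ [(q, \<sigma>)], q') \<in> prefixes G"
  shows "knowledge G (h @ [(q, \<sigma>)], q') = next_belief G (knowledge G (h, q)) \<sigma> q'"
proof (intro set_eqI iffI)
  fix x assume "x \<in> knowledge G (h @ [(q, \<sigma>)], q')"
  then obtain p' where p': "p' \<in> prefixes G" "obs_prefix G p' = obs_prefix G (h @ [(q, \<sigma>)], q')" "x = snd p'"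
    by (auto simp: knowledge_def)
  obtain g y z where *: "p' = (g @ [(y, \<sigma>)], z)" "obs_prefix G (g, y) = obs_prefix G (h, q)"
    "obs_of G z = obs_of G q'"
    using obs_prefix_eq_snocE[OF p'(2)] by blast
  then have "(g, y) \<in> prefixes G" "(y, \<sigma>, z) \<in> transitions G" using p'(1) prefixes_snoc[OF G] by auto
  moreover have "x = z" using * p' by simp
  ultimately show "x \<in> next_belief G (knowledge G (h, q)) \<sigma> q'"
    using * unfolding next_belief_def post_def knowledge_def by force
next
  fix x assume "x \<in> next_belief G (knowledge G (h, q)) \<sigma> q'"
  then obtain g y where *: "(g, y) \<in> prefixes G" "obs_prefix G (g, y) = obs_prefix G (h, q)"
    "(y, \<sigma>, x) \<in> transitions G" "obs_of G x = obs_of G q'"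
    unfolding next_belief_def post_def knowledge_def by force
  then have "(g @ [(y, \<sigma>)], x) \<in> prefixes G" using prefixes_snoc[OF G] by blast
  moreover have "obs_prefix G (g @ [(y, \<sigma>)], x) = obs_prefix G (h @ [(q, \<sigma>)], q')"
    using * by (simp add: obs_prefix_def)
  ultimately show "x \<in> knowledge G (h @ [(q, \<sigma>)], q')"
    unfolding knowledge_def by force
qed

text \<open>No opponent strategy is fixed: these are the prefixes that can occur with positive
  probability against some opponent.\<close>

inductive_set compatible :: "('s, 'a, 'o) game_structure \<Rightarrow> ('s, 'a) strategy1 \<Rightarrow> ('s, 'a) prefix set"
  for G \<alpha> where
  init: "([], initial G) \<in> compatible G \<alpha>"
| step: "(h, q) \<in> compatible G \<alpha> \<Longrightarrow> \<sigma> \<in> set_pmf (\<alpha> (h, q)) \<Longrightarrow> (q, \<sigma>, q') \<in> transitions G \<Longrightarrow>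
    (h @ [(q, \<sigma>)], q') \<in> compatible G \<alpha>"

lemma compatible_prefixes:
  assumes G: "is_game_structure G" and "p \<in> compatible G \<alpha>"
  shows "p \<in> prefixes G"
proof -
  have "(h, q) \<in> prefixes G" if "(h, q) \<in> compatible G \<alpha>" for h q
    using that
  proof (induction rule: compatible.induct)
    case init
    then show ?case using G by (simp add: prefixes_Nil is_game_structure_def)
  next
    case (step h q \<sigma> q')
    then show ?case using prefixes_snoc[OF G] by blast
  qed
  then show ?thesis using assms(2) by (cases p) simp
qed

text \<open>At each earlier point of \<open>p'\<close> the strategy sees the same observations as
  along \<open>p\<close> and so gives positive probability to the same letters.\<close>

lemma compatible_obs:
  assumes G: "is_game_structure G" and \<alpha>: "observation_based G \<alpha>"
    and "p \<in> compatible G \<alpha>" "p' \<in> prefixes G" "obs_prefix G p' = obs_prefix G p"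
  shows "p' \<in> compatible G \<alpha>"
proof -
  have "p' \<in> compatible G \<alpha>"
    if "(h, q) \<in> compatible G \<alpha>" "p' \<in> prefixes G" "obs_prefix G p' = obs_prefix G (h, q)" for h q p'
    using that
  proof (induction arbitrary: p' rule: compatible.induct)
    case init
    then have "fst p' = []" by (cases p') (auto simp: obs_prefix_def)
    then have "p' = ([], initial G)" using init(1) prefixes_Nil[of "snd p'" G] by (metis prod.collapse)
    then show ?case by (simp add: compatible.init)
  next
    case (step h q \<sigma> q')
    obtain g y z where *: "p' = (g @ [(y, \<sigma>)], z)" "obs_prefix G (g, y) = obs_prefix G (h, q)"
      using obs_prefix_eq_snocE[OF step.prems(2)] by blast
    then have **: "(g, y) \<in> prefixes G" "(y, \<sigma>, z) \<in> transitions G"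
      using step.prems(1) prefixes_snoc[OF G] by auto
    have "(g, y) \<in> compatible G \<alpha>" by (rule step.IH) (use * ** in auto)
    moreover have "\<alpha> (g, y) = \<alpha> (h, q)"
      using \<alpha> *(2) **(1) compatible_prefixes[OF G step.hyps(1)] unfolding observation_based_def by blast
    ultimately show ?case using * ** step.hyps by (auto intro: compatible.step)
  qed
  then show ?thesis using assms(3-5) by (cases p) simp
qed

section \<open>Almost-winning states and beliefs\<close>

primrec reach :: "('s, 'a) strategy1 \<Rightarrow> ('s, 'a) strategy2 \<Rightarrow> nat \<Rightarrow> ('s, 'a) prefix \<Rightarrow> ('s, 'a) prefix pmf" where
  "reach \<alpha> \<beta> 0 p = return_pmf p"
| "reach \<alpha> \<beta> (Suc k) p = bind_pmf (extend_prefix \<alpha> \<beta> p) (reach \<alpha> \<beta> k)"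

lemma reach_add: "reach \<alpha> \<beta> (j + k) p = bind_pmf (reach \<alpha> \<beta> j p) (reach \<alpha> \<beta> k)"
proof (induction j arbitrary: p)
  case (Suc j)
  then have "reach \<alpha> \<beta> (j + k) = (\<lambda>p. bind_pmf (reach \<alpha> \<beta> j p) (reach \<alpha> \<beta> k))" by blast
  then show ?case by (simp add: bind_assoc_pmf)
qed (simp add: bind_return_pmf)

lemma prefix_pmf_add: "prefix_pmf G \<alpha> \<beta> (n + k) = bind_pmf (prefix_pmf G \<alpha> \<beta> n) (reach \<alpha> \<beta> k)"
proof (induction k arbitrary: n)
  case 0
  then show ?case by (simp add: bind_return_pmf')
next
  case (Suc k)
  from Suc[of "Suc n"] show ?case by (simp add: bind_assoc_pmf)
qed

lemma set_extend:
  "p' \<in> set_pmf (extend_prefix \<alpha> \<beta> p) \<longleftrightarrow>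
    (\<exists>\<sigma>\<in>set_pmf (\<alpha> p). \<exists>q'\<in>set_pmf (\<beta> p \<sigma>). p' = (fst p @ [(snd p, \<sigma>)], q'))"
  by (auto simp: extend_prefix_def)

lemma reach_extends:
  "p' \<in> set_pmf (reach \<alpha> \<beta> k p) \<Longrightarrow> \<exists>g. length g = k \<and> fst p' = fst p @ g \<and> (k > 0 \<longrightarrow> fst (hd g) = snd p)"
proof (induction k arbitrary: p)
  case (Suc k)
  then obtain p1 where p1: "p1 \<in> set_pmf (extend_prefix \<alpha> \<beta> p)" "p' \<in> set_pmf (reach \<alpha> \<beta> k p1)" by auto
  then obtain \<sigma> where "fst p1 = fst p @ [(snd p, \<sigma>)]" by (auto simp: set_extend)
  with Suc.IH[OF p1(2)] obtain g where "length g = k" "fst p' = fst p @ (snd p, \<sigma>) # g" by auto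
  then show ?case by (intro exI[of _ "(snd p, \<sigma>) # g"]) auto
qed simp

text \<open>Only completed rounds count, so a target state at the very end of a prefix is registered
  one round later.\<close>

definition visits :: "('s, 'a, 'o) game_structure \<Rightarrow> 'o set \<Rightarrow> nat \<Rightarrow> ('s, 'a) prefix set" where
  "visits G T n = {p. \<exists>i\<ge>n. i < length (fst p) \<and> obs_of G (fst (fst p ! i)) \<in> T}"

lemma visits_antimono: "n \<le> m \<Longrightarrow> visits G T m \<subseteq> visits G T n"
  by (auto simp: visits_def; blast intro: le_trans)

lemma visits_reach:
  assumes "p \<in> visits G T n" "p' \<in> set_pmf (reach \<alpha> \<beta> k p)"
  shows "p' \<in> visits G T n"
proof -
  obtain g where "fst p' = fst p @ g" using reach_extends[OF assms(2)] by blast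
  then show ?thesis using assms(1) by (force simp: visits_def nth_append)
qed

lemma finite_beliefs:
  assumes "is_game_structure G"
  shows "finite (Pow (states G) \<times> states G)" "X \<subseteq> Pow (states G) \<times> states G \<Longrightarrow>
    reach_step G T Y X \<subseteq> Pow (states G) \<times> states G"
  using assms by (auto simp: is_game_structure_def reach_step_def)

subsection \<open>Playing all allowed letters\<close>

locale winning_game =
  fixes G :: "('s, 'a, 'o) game_structure" and T :: "'o set"
  assumes game: "is_game_structure G" and target: "T \<subseteq> observations G"
    and winning: "{initial G} \<in> winning_beliefs G T"
begin

abbreviation "Y \<equiv> winning_beliefs G T"

definition letters :: "('s, 'a) prefix \<Rightarrow> 'a set" where
  "letters p = {\<sigma>\<in>alphabet G. allowed G Y (knowledge G p) \<sigma>}"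

definition uniform :: "('s, 'a) strategy1" where
  "uniform p = pmf_of_set (if letters p = {} then alphabet G else letters p)"

lemma Y_eq: "Y = safe_step G T Y"
  unfolding winning_beliefs_def by (rule gfp_unfold[OF mono_safe_step])

lemma YD:
  assumes "s \<in> Y"
  shows "s \<subseteq> states G" "\<exists>\<sigma>\<in>alphabet G. allowed G Y s \<sigma>" "q \<in> s \<Longrightarrow> (s, q) \<in> lfp (reach_step G T Y)"
proof -
  have "s \<in> safe_step G T Y" by (subst Y_eq[symmetric]) (rule assms)
  then show "s \<subseteq> states G" "\<exists>\<sigma>\<in>alphabet G. allowed G Y s \<sigma>" "q \<in> s \<Longrightarrow> (s, q) \<in> lfp (reach_step G T Y)"
    by (simp_all add: safe_step_def)
qed

lemma finite_alphabet: "finite (alphabet G)" and nonempty_alphabet: "alphabet G \<noteq> {}"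
  using game YD(2)[OF winning] by (auto simp: is_game_structure_def)

lemma finite_letters: "finite (letters p)"
  using finite_alphabet by (simp add: letters_def)

lemma set_uniform: "set_pmf (uniform p) = (if letters p = {} then alphabet G else letters p)"
  unfolding uniform_def using finite_letters finite_alphabet nonempty_alphabet by (auto intro!: set_pmf_of_set)

lemma uniform_strategy: "randomized_strategy1 G uniform"
  unfolding randomized_strategy1_def set_uniform by (auto simp: letters_def)

lemma uniform_obs: "observation_based G uniform"
proof -
  have "uniform p = uniform p'" if "obs_prefix G p = obs_prefix G p'" for p p'
  proof -
    have "letters p = letters p'" using knowledge_cong[OF that] by (simp add: letters_def)
    then show ?thesis by (simp add: uniform_def)
  qed
  then show ?thesis unfolding observation_based_def by blast
qed

lemma pmf_uniform:
  assumes "\<sigma> \<in> letters p"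
  shows "pmf (uniform p) \<sigma> \<ge> 1 / card (alphabet G)"
proof -
  have "letters p \<noteq> {}" using assms by auto
  moreover from this have "0 < card (letters p)" using finite_letters by (simp add: card_gt_0_iff)
  moreover have "card (letters p) \<le> card (alphabet G)"
    by (rule card_mono[OF finite_alphabet]) (auto simp: letters_def)
  ultimately show ?thesis
    using assms finite_letters by (simp add: uniform_def frac_le)
qed

context
  fixes \<beta> :: "('s, 'a) strategy2"
  assumes \<beta>: "randomized_strategy2 G \<beta>"
begin

interpretation play: play_measure G uniform \<beta>
  using game uniform_strategy \<beta> by unfold_locales

section \<open>Probability of visiting the target from winning beliefs\<close>

definition good :: "('s, 'a) prefix set" where
  "good = {p \<in> prefixes G. knowledge G p \<in> Y}"

lemma good_letters: "p \<in> good \<Longrightarrow> letters p \<noteq> {}"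
  using YD(2) by (auto simp: good_def letters_def)

text \<open>Allowed letters lead to beliefs in \<open>Y\<close> by definition, and
  \<open>knowledge_snoc\<close> identifies these with the knowledge of the longer prefix. So play
  never leaves the winning beliefs.\<close>

lemma extend_good:
  assumes p: "p \<in> good" and \<sigma>: "\<sigma> \<in> set_pmf (uniform p)" and q': "q' \<in> set_pmf (\<beta> p \<sigma>)"
  shows "(snd p, \<sigma>, q') \<in> transitions G" "(fst p @ [(snd p, \<sigma>)], q') \<in> good"
    "knowledge G (fst p @ [(snd p, \<sigma>)], q') = next_belief G (knowledge G p) \<sigma> q'"
proof -
  have \<sigma>: "\<sigma> \<in> letters p" using \<sigma> good_letters[OF p] set_uniform by auto
  have q: "snd p \<in> knowledge G p" using knowledge_self[of p G] p by (simp add: good_def)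
  then have "snd p \<in> states G" using knowledge_states[of G p] by blast
  moreover have "\<sigma> \<in> alphabet G" using \<sigma> by (simp add: letters_def)
  ultimately show *: "(snd p, \<sigma>, q') \<in> transitions G"
  proof -
    assume "snd p \<in> states G" "\<sigma> \<in> alphabet G"
    then have "set_pmf (\<beta> (fst p, snd p) \<sigma>) \<subseteq> {q'. (snd p, \<sigma>, q') \<in> transitions G}"
      using \<beta> unfolding randomized_strategy2_def by blast
    then show ?thesis using q' by auto
  qed
  then have pre: "(fst p @ [(snd p, \<sigma>)], q') \<in> prefixes G"
    using prefixes_snoc[OF game] p by (auto simp: good_def)
  show "knowledge G (fst p @ [(snd p, \<sigma>)], q') = next_belief G (knowledge G p) \<sigma> q'"
    using knowledge_snoc[OF game pre] by simp
  moreover have "next_belief G (knowledge G p) \<sigma> q' \<in> Y"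
  proof -
    have "allowed G Y (knowledge G p) \<sigma>" using \<sigma> by (simp add: letters_def)
    then show ?thesis using q * unfolding allowed_def by blast
  qed
  ultimately show "(fst p @ [(snd p, \<sigma>)], q') \<in> good"
    using pre by (simp add: good_def)
qed

lemma reach_good: "p \<in> good \<Longrightarrow> p' \<in> set_pmf (reach uniform \<beta> k p) \<Longrightarrow> p' \<in> good"
proof (induction k arbitrary: p)
  case (Suc k)
  then obtain p1 where "p1 \<in> set_pmf (extend_prefix uniform \<beta> p)" "p' \<in> set_pmf (reach uniform \<beta> k p1)" by auto
  then show ?case using Suc extend_good(2)[OF Suc.prems(1)] by (auto simp: set_extend)
qed simp

lemma prefix_pmf_good: "p \<in> set_pmf (prefix_pmf G uniform \<beta> n) \<Longrightarrow> p \<in> good"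
proof -
  have "initial G \<in> states G" using game by (simp add: is_game_structure_def)
  then have "([], initial G) \<in> good"
    using winning by (simp add: good_def prefixes_Nil knowledge_Nil)
  moreover have "prefix_pmf G uniform \<beta> n = reach uniform \<beta> n ([], initial G)"
    using prefix_pmf_add[of G uniform \<beta> 0 n] by (simp add: bind_return_pmf)
  ultimately show "p \<in> set_pmf (prefix_pmf G uniform \<beta> n) \<Longrightarrow> p \<in> good"
    using reach_good by auto
qed

definition eps :: real where "eps = 1 / card (alphabet G)"

lemma eps: "0 < eps" "eps \<le> 1"
  using finite_alphabet nonempty_alphabet card_gt_0_iff[of "alphabet G"] by (auto simp: eps_def)

text \<open>Induction on the stage of the inner fixpoint. Outside the target some allowed letter
  leads to the previous stage whatever successor the opponent takes; it is chosen with probability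
  at least \<open>eps\<close>, so each stage costs one factor \<open>eps\<close>.\<close>

lemma visits_lower_bound:
  assumes "p \<in> good" "(knowledge G p, snd p) \<in> (reach_step G T Y ^^ k) {}"
  shows "emeasure (reach uniform \<beta> k p) (visits G T (length (fst p))) \<ge> ennreal (eps ^ k)"
  using assms
proof (induction k arbitrary: p)
  case (Suc k)
  let ?n = "length (fst p)"
  let ?s = "knowledge G p"
  have "(?s, snd p) \<in> reach_step G T Y ((reach_step G T Y ^^ k) {})" using Suc.prems(2) by simp
  then have "obs_of G (snd p) \<in> T \<or> (\<exists>\<sigma>\<in>alphabet G. allowed G Y ?s \<sigma> \<and>
      (\<forall>q'. (snd p, \<sigma>, q') \<in> transitions G \<longrightarrow> (next_belief G ?s \<sigma> q', q') \<in> (reach_step G T Y ^^ k) {}))"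
    by (subst (asm) reach_step_def) simp
  then show ?case
  proof
    assume "obs_of G (snd p) \<in> T"
    \<comment> \<open>The last state of \<open>p\<close> is completed by the first of the
      \<open>Suc k\<close> further rounds, so this visit counts.\<close>
    have "p' \<in> visits G T ?n" if p': "p' \<in> set_pmf (reach uniform \<beta> (Suc k) p)" for p'
    proof -
      obtain g where g: "length g = Suc k" "fst p' = fst p @ g" "fst (hd g) = snd p"
        using reach_extends[OF p'] by auto
      then have "fst p' ! ?n = hd g" by (cases g) auto
      then show ?thesis
        using g \<open>obs_of G (snd p) \<in> T\<close> unfolding visits_def by (auto intro!: exI[of _ ?n])
    qed
    then have "emeasure (reach uniform \<beta> (Suc k) p) (visits G T ?n) = 1"
      by (intro measure_pmf.emeasure_eq_1_AE) (auto simp: AE_measure_pmf_iff simp del: reach.simps)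
    then show ?thesis using eps by (simp add: power_le_one mult_le_one del: reach.simps)
  next
    assume "\<exists>\<sigma>\<in>alphabet G. allowed G Y ?s \<sigma> \<and>
      (\<forall>q'. (snd p, \<sigma>, q') \<in> transitions G \<longrightarrow> (next_belief G ?s \<sigma> q', q') \<in> (reach_step G T Y ^^ k) {})"
    then obtain \<sigma> where \<sigma>: "\<sigma> \<in> letters p"
      and succ: "\<And>q'. (snd p, \<sigma>, q') \<in> transitions G \<Longrightarrow> (next_belief G ?s \<sigma> q', q') \<in> (reach_step G T Y ^^ k) {}"
      by (auto simp: letters_def)
    \<comment> \<open>Reads off the letter just chosen; under this map the one-step distribution
      becomes \<open>uniform p\<close>, whatever \<open>\<beta>\<close> does.\<close>
    let ?f = "\<lambda>p' :: ('s, 'a) prefix. snd (last (fst p'))"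
    have map: "map_pmf ?f (extend_prefix uniform \<beta> p) = uniform p"
      by (simp add: extend_prefix_def map_bind_pmf map_pmf_comp bind_return_pmf')
    have "eps \<le> pmf (uniform p) \<sigma>" using pmf_uniform[OF \<sigma>] by (simp add: eps_def)
    then have "eps ^ Suc k \<le> eps ^ k * pmf (uniform p) \<sigma>"
      using mult_left_mono[of eps "pmf (uniform p) \<sigma>" "eps ^ k"] eps by (simp add: mult.commute)
    then have "ennreal (eps ^ Suc k) \<le> ennreal (eps ^ k) * ennreal (pmf (uniform p) \<sigma>)"
      using eps by (subst ennreal_mult[symmetric]) (auto intro!: ennreal_leI)
    also have "ennreal (pmf (uniform p) \<sigma>) = emeasure (map_pmf ?f (extend_prefix uniform \<beta> p)) {\<sigma>}"
      unfolding map by (simp add: emeasure_pmf_single)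
    also have "\<dots> = emeasure (extend_prefix uniform \<beta> p) (?f -` {\<sigma>})"
      by (rule emeasure_map_pmf)
    also have "ennreal (eps ^ k) * emeasure (extend_prefix uniform \<beta> p) (?f -` {\<sigma>}) =
        (\<integral>\<^sup>+p'. ennreal (eps ^ k) * indicator (?f -` {\<sigma>}) p' \<partial>extend_prefix uniform \<beta> p)"
      by (simp add: nn_integral_cmult)
    also have "\<dots> \<le> (\<integral>\<^sup>+p'. emeasure (reach uniform \<beta> k p') (visits G T ?n) \<partial>extend_prefix uniform \<beta> p)"
    proof (rule nn_integral_mono_AE, unfold AE_measure_pmf_iff, rule ballI)
      fix p' assume p': "p' \<in> set_pmf (extend_prefix uniform \<beta> p)"
      show "ennreal (eps ^ k) * indicator (?f -` {\<sigma>}) p' \<le> emeasure (reach uniform \<beta> k p') (visits G T ?n)"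
      proof (cases "?f p' = \<sigma>")
        case True
        with p' obtain q' where q': "\<sigma> \<in> set_pmf (uniform p)" "q' \<in> set_pmf (\<beta> p \<sigma>)"
          "p' = (fst p @ [(snd p, \<sigma>)], q')"
          by (auto simp: set_extend)
        note ext = extend_good[OF Suc.prems(1) q'(1,2)]
        have "ennreal (eps ^ k) \<le> emeasure (reach uniform \<beta> k p') (visits G T (length (fst p')))"
          by (rule Suc.IH) (use ext succ q' in auto)
        also have "\<dots> \<le> emeasure (reach uniform \<beta> k p') (visits G T ?n)"
          by (rule emeasure_mono) (use q' visits_antimono[of ?n "length (fst p')"] in auto)
        finally show ?thesis using True by simp
      qed simp
    qed
    also have "\<dots> = emeasure (reach uniform \<beta> (Suc k) p) (visits G T ?n)" by simp
    finally show ?thesis .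
  qed
qed simp

text \<open>By this number of iterations the stages of the inner fixpoint are stationary, so the
  same number of rounds works from every good prefix.\<close>

definition bound :: nat where "bound = card (Pow (states G) \<times> states G)"

lemma miss_bound:
  assumes "p \<in> good"
  shows "emeasure (reach uniform \<beta> bound p) (- visits G T (length (fst p))) \<le> ennreal (1 - eps ^ bound)"
proof -
  let ?V = "visits G T (length (fst p))"
  let ?R = "measure_pmf (reach uniform \<beta> bound p)"
  have lfp: "(reach_step G T Y ^^ bound) {} = lfp (reach_step G T Y)"
    by (rule lfp_eq_funpow[OF mono_reach_step finite_beliefs(2)[OF game] finite_beliefs(1)[OF game]])
      (auto simp: bound_def)
  have "snd p \<in> knowledge G p" using assms knowledge_self[of p G] by (simp add: good_def)
  then have "(knowledge G p, snd p) \<in> (reach_step G T Y ^^ bound) {}"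
    unfolding lfp using YD(3) assms by (auto simp: good_def)
  from visits_lower_bound[OF assms this] have "eps ^ bound \<le> measure ?R ?V"
    using eps by (simp add: measure_pmf.emeasure_eq_measure)
  moreover have "measure ?R (- ?V) = 1 - measure ?R ?V"
    using measure_pmf.prob_compl[of ?V "reach uniform \<beta> bound p"] by (simp add: Compl_eq_Diff_UNIV)
  ultimately show ?thesis
    by (simp add: measure_pmf.emeasure_eq_measure ennreal_leI)
qed

text \<open>After a block of \<open>bound\<close> rounds play is at a good prefix again, so the
  bounds for single blocks multiply. The indicator in the integral removes the prefixes that have
  already visited the target.\<close>

lemma miss_bound_iterated:
  assumes "p \<in> good"
  shows "emeasure (reach uniform \<beta> (bound * j) p) (- visits G T (length (fst p))) \<le> ennreal
    ((1 - eps ^ bound) ^ j)"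
  using assms
proof (induction j arbitrary: p)
  case 0
  then show ?case by (simp add: indicator_def)
next
  case (Suc j)
  let ?V = "visits G T (length (fst p))" and ?c = "1 - eps ^ bound"
  have c: "0 \<le> ?c" using eps by (simp add: power_le_one)
  have "emeasure (reach uniform \<beta> (bound * Suc j) p) (- ?V) =
      (\<integral>\<^sup>+p'. emeasure (reach uniform \<beta> (bound * j) p') (- ?V) \<partial>reach uniform \<beta> bound p)"
    by (simp add: reach_add)
  also have "\<dots> \<le> (\<integral>\<^sup>+p'. ennreal (?c ^ j) * indicator (- ?V) p' \<partial>reach uniform \<beta> bound p)"
  proof (rule nn_integral_mono_AE, unfold AE_measure_pmf_iff, rule ballI)
    fix p' assume p': "p' \<in> set_pmf (reach uniform \<beta> bound p)"
    show "emeasure (reach uniform \<beta> (bound * j) p') (- ?V) \<le> ennreal (?c ^ j) * indicator (- ?V) p'"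
    proof (cases "p' \<in> ?V")
      case True
      then have "AE x in reach uniform \<beta> (bound * j) p'. x \<notin> - ?V"
        using visits_reach by (fastforce simp: AE_measure_pmf_iff)
      then have "emeasure (reach uniform \<beta> (bound * j) p') {x. x \<in> - ?V} = 0"
        using emeasure_eq_0_AE[of "\<lambda>x. x \<in> - ?V" "measure_pmf (reach uniform \<beta> (bound * j) p')"] by simp
      then have "emeasure (reach uniform \<beta> (bound * j) p') (- ?V) = 0" by (simp only: Collect_mem_eq)
      then show ?thesis by simp
    next
      case False
      have "length (fst p) \<le> length (fst p')" using reach_extends[OF p'] by auto
      then have "emeasure (reach uniform \<beta> (bound * j) p') (- ?V) \<le>
          emeasure (reach uniform \<beta> (bound * j) p') (- visits G T (length (fst p')))"
        using visits_antimono[of "length (fst p)" "length (fst p')" G T] by (intro emeasure_mono) auto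
      also have "\<dots> \<le> ennreal (?c ^ j)"
        by (rule Suc.IH) (rule reach_good[OF Suc.prems p'])
      finally show ?thesis using False by simp
    qed
  qed
  also have "\<dots> = ennreal (?c ^ j) * emeasure (reach uniform \<beta> bound p) (- ?V)"
    by (simp add: nn_integral_cmult)
  also have "\<dots> \<le> ennreal (?c ^ j) * ennreal ?c"
    by (rule mult_left_mono[OF miss_bound[OF Suc.prems]]) simp
  also have "\<dots> = ennreal (?c ^ Suc j)"
    using c by (simp add: ennreal_mult[symmetric] mult.commute)
  finally show ?case .
qed

text \<open>Missing the target from round \<open>n\<close> on means missing it in \<open>j\<close>
  successive blocks, for every \<open>j\<close>, and the geometric bounds tend to
  \<open>0\<close>.\<close>

lemma AE_visit: "AE \<pi> in play.M. \<exists>i\<ge>n. obs_of G (fst (\<pi> i)) \<in> T"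
proof -
  let ?c = "1 - eps ^ bound"
  let ?A = "{\<pi> \<in> space play.M. \<forall>i\<ge>n. obs_of G (fst (\<pi> i)) \<notin> T}"
  have c: "0 \<le> ?c" "?c < 1"
    using eps power_le_one[of eps bound] zero_less_power[of eps bound]
      by (simp_all only: diff_ge_0_iff_ge less_imp_le diff_less_eq less_add_same_cancel1)
  have A: "emeasure play.M ?A \<le> ennreal (?c ^ j)" for j
  proof -
    let ?m = "n + bound * j"
    let ?B = "{\<pi> \<in> space play.M. play_prefix ?m \<pi> \<in> - visits G T n}"
    have "emeasure play.M ?A \<le> emeasure play.M ?B"
    proof (rule emeasure_mono)
      show "?A \<subseteq> ?B" by (auto simp: play_prefix_def visits_def)
      show "?B \<in> sets play.M" by (rule play.prefix_event(1))
    qed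
    also have "\<dots> = (\<integral>\<^sup>+p. emeasure (reach uniform \<beta> (bound * j) p) (- visits G T n) \<partial>prefix_pmf G uniform \<beta> n)"
      unfolding play.prefix_event prefix_pmf_add by simp
    also have "\<dots> \<le> (\<integral>\<^sup>+p. ennreal (?c ^ j) \<partial>prefix_pmf G uniform \<beta> n)"
    proof (rule nn_integral_mono_AE, unfold AE_measure_pmf_iff, rule ballI)
      fix p assume p: "p \<in> set_pmf (prefix_pmf G uniform \<beta> n)"
      have "prefix_pmf G uniform \<beta> n = reach uniform \<beta> n ([], initial G)"
        using prefix_pmf_add[of G uniform \<beta> 0 n] by (simp add: bind_return_pmf)
      then have "length (fst p) = n" using p reach_extends[of p uniform \<beta> n "([], initial G)"] by auto
      then show "emeasure (reach uniform \<beta> (bound * j) p) (- visits G T n) \<le> ennreal (?c ^ j)"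
        using miss_bound_iterated[OF prefix_pmf_good[OF p]] by blast
    qed
    also have "\<dots> = ennreal (?c ^ j)" by simp
    finally show ?thesis .
  qed
  have "(\<lambda>j. ?c ^ j) \<longlonglongrightarrow> 0" by (rule LIMSEQ_realpow_zero[OF c])
  then have "(\<lambda>j. ennreal (?c ^ j)) \<longlonglongrightarrow> ennreal 0" by (rule tendsto_ennrealI)
  then have "emeasure play.M ?A \<le> ennreal 0"
    by (rule LIMSEQ_le_const) (use A in blast)
  moreover have "?A \<in> sets play.M"
  proof -
    have "{\<pi> \<in> space play.M. obs_of G (fst (\<pi> i)) \<in> T} \<in> sets play.M" for i
      using play.prefix_event(1)[of i "{p. obs_of G (snd p) \<in> T}"] by (simp add: play_prefix_def)
    then have "space play.M - (\<Union>i\<in>{n..}. {\<pi> \<in> space play.M. obs_of G (fst (\<pi> i)) \<in> T}) \<in> sets play.M"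
      by (intro sets.Diff sets.top sets.countable_UN') auto
    moreover have "?A = space play.M - (\<Union>i\<in>{n..}. {\<pi> \<in> space play.M. obs_of G (fst (\<pi> i)) \<in> T})"
      by auto
    ultimately show ?thesis by (simp only:)
  qed
  moreover have "{\<pi> \<in> space play.M. \<not> (\<exists>i\<ge>n. obs_of G (fst (\<pi> i)) \<in> T)} \<subseteq> ?A" by blast
  ultimately show ?thesis by (intro AE_I[where N = ?A]) (simp_all only: ennreal_0 le_zero_eq)
qed

text \<open>\<open>Buchi\<close> asks for one single observation that recurs. As \<open>T\<close> is
  finite, infinitely many visits to \<open>T\<close> provide one.\<close>

lemma uniform_wins: "measure play.M (Buchi G T \<inter> space play.M) = 1"
proof -
  have "finite T" using target game by (auto simp: is_game_structure_def intro: finite_subset)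
  have "AE \<pi> in play.M. \<forall>n. \<exists>i\<ge>n. obs_of G (fst (\<pi> i)) \<in> T"
    by (simp add: AE_all_countable AE_visit)
  with AE_space have "AE \<pi> in play.M. \<pi> \<in> Buchi G T \<inter> space play.M"
  proof eventually_elim
    case (elim \<pi>)
    then have "\<exists>\<^sub>\<infinity>i. obs_of G (fst (\<pi> i)) \<in> T" by (simp add: INFM_nat_le)
    then have "\<exists>\<^sub>\<infinity>i. \<exists>b\<in>T. obs_of G (fst (\<pi> i)) = b" by simp
    then have "\<pi> \<in> Buchi G T"
      unfolding Buchi_def INFM_finite_Bex_distrib[OF \<open>finite T\<close>] by simp
    with elim show ?case by simp
  qed
  then show ?thesis
    using play.prob_eq_1[OF play.Buchi_measurable[OF \<open>finite T\<close>]] by simp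
qed

end

end

subsection \<open>Spoiling strategies\<close>

lemma knowledgeE:
  assumes "q \<in> knowledge G p"
  obtains h where "(h, q) \<in> prefixes G" "obs_prefix G (h, q) = obs_prefix G p"
  using assms by (auto simp: knowledge_def)

locale almost_winning_game =
  fixes G :: "('s, 'a, 'o) game_structure" and T :: "'o set" and \<alpha> :: "('s, 'a) strategy1"
  assumes game: "is_game_structure G"
    and strategy: "randomized_strategy1 G \<alpha>" and obs_based: "observation_based G \<alpha>"
    and wins: "\<And>\<beta>. randomized_strategy2 G \<beta> \<Longrightarrow>
      measure (outcome_measure G \<alpha> \<beta>) (Buchi G T \<inter> space (outcome_measure G \<alpha> \<beta>)) = 1"
begin

text \<open>The beliefs that arise under \<open>\<alpha>\<close>. They turn out to be a
  post-fixpoint of \<open>safe_step\<close>, which places them below its greatest fixpoint.\<close>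

definition Y :: "'s set set" where "Y = knowledge G ` compatible G \<alpha>"

abbreviation "X \<equiv> lfp (reach_step G T Y)"

text \<open>The state \<open>q\<close> need not be the last state of \<open>p\<close>. A prefix that
  looks like \<open>p\<close> and ends in \<open>q\<close> takes its place; there the
  observation-based strategy plays the same letters.\<close>

lemma compatible_extend:
  assumes "p \<in> compatible G \<alpha>" "q \<in> knowledge G p" "\<sigma> \<in> set_pmf (\<alpha> p)" "(q, \<sigma>, q') \<in> transitions G"
  shows "next_belief G (knowledge G p) \<sigma> q' \<in> Y"
proof -
  obtain h where h: "(h, q) \<in> prefixes G" "obs_prefix G (h, q) = obs_prefix G p"
    using knowledgeE[OF assms(2)] .
  have c: "(h, q) \<in> compatible G \<alpha>" by (rule compatible_obs[OF game obs_based assms(1) h])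
  have "\<alpha> (h, q) = \<alpha> p"
    using obs_based h compatible_prefixes[OF game assms(1)] unfolding observation_based_def by blast
  then have s: "(h @ [(q, \<sigma>)], q') \<in> compatible G \<alpha>"
    using compatible.step[OF c] assms by simp
  then have "knowledge G (h @ [(q, \<sigma>)], q') = next_belief G (knowledge G (h, q)) \<sigma> q'"
    by (intro knowledge_snoc[OF game] compatible_prefixes[OF game])
  also have "knowledge G (h, q) = knowledge G p" by (rule knowledge_cong[OF h(2)])
  finally show ?thesis using s unfolding Y_def by (metis imageI)
qed

lemma allowed_support:
  assumes "p \<in> compatible G \<alpha>" "\<sigma> \<in> set_pmf (\<alpha> p)"
  shows "allowed G Y (knowledge G p) \<sigma>"
  unfolding allowed_def using compatible_extend[OF assms(1) _ assms(2)] by blast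

lemma support_alphabet: "\<sigma> \<in> set_pmf (\<alpha> p) \<Longrightarrow> \<sigma> \<in> alphabet G"
  using strategy unfolding randomized_strategy1_def by blast

text \<open>Every letter that \<open>\<alpha>\<close> may play is allowed for \<open>Y\<close>. So a
  pair outside the fixpoint can only be there because the letter has a successor that is outside as
  well.\<close>

lemma ex_spoiling_move:
  assumes p: "p \<in> compatible G \<alpha>" and X: "(knowledge G p, snd p) \<notin> X" and \<sigma>: "\<sigma> \<in> set_pmf (\<alpha> p)"
  shows "obs_of G (snd p) \<notin> T"
    and "\<exists>q'. (snd p, \<sigma>, q') \<in> transitions G \<and> (next_belief G (knowledge G p) \<sigma> q', q') \<notin> X"
proof -
  have q: "snd p \<in> knowledge G p" by (rule knowledge_self[OF compatible_prefixes[OF game p]])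
  have "(knowledge G p, snd p) \<notin> reach_step G T Y X"
    using X lfp_unfold[OF mono_reach_step, of G T Y] by blast
  then have *: "obs_of G (snd p) \<notin> T \<and> \<not> (\<exists>\<sigma>\<in>alphabet G. allowed G Y (knowledge G p) \<sigma> \<and>
      (\<forall>q'. (snd p, \<sigma>, q') \<in> transitions G \<longrightarrow> (next_belief G (knowledge G p) \<sigma> q', q') \<in> X))"
    using q knowledge_states[of G p] unfolding reach_step_def by blast
  then show "obs_of G (snd p) \<notin> T" by blast
  from * show "\<exists>q'. (snd p, \<sigma>, q') \<in> transitions G \<and> (next_belief G (knowledge G p) \<sigma> q', q') \<notin> X"
    using allowed_support[OF p \<sigma>] support_alphabet[OF \<sigma>] by blast
qed

text \<open>For \<open>n\<close> rounds the opponent moves uniformly at random, so that every compatible prefix of length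
  \<open>n\<close> has positive probability; then it avoids \<open>X\<close>.\<close>

definition spoil :: "nat \<Rightarrow> ('s, 'a) strategy2" where
  "spoil n p \<sigma> = (let A = {q'. (snd p, \<sigma>, q') \<in> transitions G};
     B = {q'\<in>A. (next_belief G (knowledge G p) \<sigma> q', q') \<notin> X} in
     if length (fst p) < n \<or> B = {} then pmf_of_set A else pmf_of_set B)"

lemma finite_transitions: "finite {q'. (q, \<sigma>, q') \<in> transitions G}"
proof -
  have "{q'. (q, \<sigma>, q') \<in> transitions G} \<subseteq> states G" "finite (states G)"
    using game by (auto simp: is_game_structure_def)
  then show ?thesis by (rule finite_subset)
qed

lemma spoil_strategy: "randomized_strategy2 G (spoil n)"
  unfolding randomized_strategy2_def
proof (intro allI ballI)
  fix h l \<sigma>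
  assume "l \<in> states G" "\<sigma> \<in> alphabet G"
  then have ne: "{q'. (l, \<sigma>, q') \<in> transitions G} \<noteq> {}" using game by (auto simp: is_game_structure_def)
  have "finite {q' \<in> {q'. (l, \<sigma>, q') \<in> transitions G}. P q'}" for P
    using finite_transitions[of l \<sigma>] by simp
  then show "set_pmf (spoil n (h, l) \<sigma>) \<subseteq> {l'. (l, \<sigma>, l') \<in> transitions G}"
    using ne finite_transitions[of l \<sigma>] unfolding spoil_def Let_def fst_conv snd_conv
    by (auto simp del: mem_Collect_eq split: if_splits)
qed

lemma compatible_in_prefix_pmf:
  assumes "p \<in> compatible G \<alpha>" "length (fst p) \<le> n"
  shows "p \<in> set_pmf (prefix_pmf G \<alpha> (spoil n) (length (fst p)))"
proof -
  have "(h, q) \<in> set_pmf (prefix_pmf G \<alpha> (spoil n) (length h))" if "(h, q) \<in> compatible G \<alpha>" "length h \<le> n"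
    for h q
    using that
  proof (induction rule: compatible.induct)
    case init
    then show ?case by simp
  next
    case (step h q \<sigma> q')
    have "q' \<in> {q'. (q, \<sigma>, q') \<in> transitions G}" using step by simp
    moreover have "spoil n (h, q) \<sigma> = pmf_of_set {q'. (q, \<sigma>, q') \<in> transitions G}"
      using step.prems by (simp add: spoil_def)
    ultimately have "q' \<in> set_pmf (spoil n (h, q) \<sigma>)"
      using set_pmf_of_set[OF _ finite_transitions[of q \<sigma>]] by (metis empty_iff)
    then show ?case using step by (auto simp: set_extend intro!: bexI[of _ "(h, q)"])
  qed
  then show ?thesis using assms by (metis prod.collapse)
qed

lemma spoil_extend:
  assumes p: "p \<in> compatible G \<alpha>" and X: "(knowledge G p, snd p) \<notin> X" and n: "n \<le> length (fst p)"
    and p': "p' \<in> set_pmf (extend_prefix \<alpha> (spoil n) p)"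
  shows "p' \<in> compatible G \<alpha>" "(knowledge G p', snd p') \<notin> X" "length (fst p') = Suc (length (fst p))"
proof -
  obtain \<sigma> q' where *: "\<sigma> \<in> set_pmf (\<alpha> p)" "q' \<in> set_pmf (spoil n p \<sigma>)" "p' = (fst p @ [(snd p, \<sigma>)], q')"
    using p' by (auto simp: set_extend)
  let ?A = "{q'. (snd p, \<sigma>, q') \<in> transitions G}"
  let ?B = "{q'\<in>?A. (next_belief G (knowledge G p) \<sigma> q', q') \<notin> X}"
  have "?B \<noteq> {}" using ex_spoiling_move(2)[OF p X *(1)] by blast
  moreover have "finite ?B" using finite_transitions by simp
  ultimately have "set_pmf (spoil n p \<sigma>) = ?B"
    using n unfolding spoil_def Let_def by (subst if_not_P) (auto simp: set_pmf_of_set)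
  with * have q': "(snd p, \<sigma>, q') \<in> transitions G" "(next_belief G (knowledge G p) \<sigma> q', q') \<notin> X" by auto
  show c: "p' \<in> compatible G \<alpha>"
    using compatible.step[of "fst p" "snd p" G \<alpha> \<sigma> q'] p * q' by simp
  have "knowledge G p' = next_belief G (knowledge G p) \<sigma> q'"
    using knowledge_snoc[OF game, of "fst p" "snd p" \<sigma> q'] compatible_prefixes[OF game c] * by simp
  then show "(knowledge G p', snd p') \<notin> X" using q' * by simp
  show "length (fst p') = Suc (length (fst p))" using * by simp
qed

text \<open>Otherwise, against \<open>spoil ?n\<close>, the prefix \<open>p\<close> would have
  positive probability while almost every play through it avoids \<open>T\<close> from round
  \<open>?n\<close> on, contrary to the almost sure win.\<close>

lemma compatible_X:
  assumes p: "p \<in> compatible G \<alpha>"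
  shows "(knowledge G p, snd p) \<in> X"
proof (rule ccontr)
  assume X: "(knowledge G p, snd p) \<notin> X"
  let ?n = "length (fst p)"
  interpret play: play_measure G \<alpha> "spoil ?n"
    using game strategy spoil_strategy by unfold_locales
  \<comment> \<open>A set outside the sigma-algebra gets measure \<open>0\<close>; since the measure
    here is \<open>1\<close>, the event is measurable.\<close>
  have B: "Buchi G T \<inter> space play.M \<in> sets play.M"
    using wins[OF spoil_strategy, of ?n] measure_notin_sets[of "Buchi G T \<inter> space play.M" play.M]
    by (metis zero_neq_one)
  have "AE \<pi> in play.M. \<pi> \<in> Buchi G T \<inter> space play.M"
    using wins[OF spoil_strategy, of ?n] play.prob_eq_1[OF B] by blast
  with play.AE_extend_prefix have "AE \<pi> in play.M. play_prefix ?n \<pi> \<noteq> p"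
  proof eventually_elim
    case (elim \<pi>)
    show ?case
    proof
      assume eq: "play_prefix ?n \<pi> = p"
      have inv: "play_prefix (?n + k) \<pi> \<in> compatible G \<alpha> \<and>
        (knowledge G (play_prefix (?n + k) \<pi>), snd (play_prefix (?n + k) \<pi>)) \<notin> X" for k
      proof (induction k)
        case 0
        then show ?case using p X eq by simp
      next
        case (Suc k)
        have "play_prefix (Suc (?n + k)) \<pi> \<in> set_pmf (extend_prefix \<alpha> (spoil ?n) (play_prefix (?n + k) \<pi>))"
          using elim(1) by blast
        moreover have "?n \<le> length (fst (play_prefix (?n + k) \<pi>))" by (simp add: play_prefix_def)
        ultimately show ?case
          using spoil_extend(1,2)[of "play_prefix (?n + k) \<pi>" ?n "play_prefix (Suc (?n + k)) \<pi>"] Suc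
          unfolding add_Suc_right by blast
      qed
      have "obs_of G (fst (\<pi> (?n + k))) \<notin> T" for k
      proof -
        obtain \<sigma> where "\<sigma> \<in> set_pmf (\<alpha> (play_prefix (?n + k) \<pi>))"
          using set_pmf_not_empty[of "\<alpha> (play_prefix (?n + k) \<pi>)"] by blast
        then have "obs_of G (snd (play_prefix (?n + k) \<pi>)) \<notin> T"
          using ex_spoiling_move(1) inv[of k] by blast
        then show ?thesis by (simp add: play_prefix_def)
      qed
      moreover obtain b where "b \<in> T" "\<exists>\<^sub>\<infinity>i. obs_of G (fst (\<pi> i)) = b"
        using elim(2) by (auto simp: Buchi_def)
      then obtain i where "?n \<le> i" "obs_of G (fst (\<pi> i)) \<in> T" by (auto simp: INFM_nat_le)
      ultimately show False by (metis le_iff_add)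
    qed
  qed
  then have "AE \<pi> in play.M. \<not> (play_prefix ?n \<pi> \<in> {p})" by simp
  then have "emeasure play.M {\<pi> \<in> space play.M. play_prefix ?n \<pi> \<in> {p}} = 0"
    by (rule emeasure_eq_0_AE)
  then have "pmf (prefix_pmf G \<alpha> (spoil ?n) ?n) p = 0"
    unfolding play.prefix_event by (simp add: emeasure_pmf_single)
  then show False
    using compatible_in_prefix_pmf[OF p order_refl] by (simp add: set_pmf_iff)
qed

lemma initial_belief_winning: "{initial G} \<in> winning_beliefs G T"
proof -
  have "Y \<subseteq> safe_step G T Y"
  proof
    fix s assume "s \<in> Y"
    then obtain p where p: "p \<in> compatible G \<alpha>" "s = knowledge G p" by (auto simp: Y_def)
    obtain \<sigma> where "\<sigma> \<in> set_pmf (\<alpha> p)" using set_pmf_not_empty by fast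
    then have "\<sigma> \<in> alphabet G" "allowed G Y s \<sigma>"
      using allowed_support[OF p(1)] support_alphabet p(2) by auto
    moreover have "(s, q) \<in> X" if q: "q \<in> s" for q
    proof -
      obtain h where h: "(h, q) \<in> prefixes G" "obs_prefix G (h, q) = obs_prefix G p"
        using knowledgeE[OF q[unfolded p(2)]] .
      have "(h, q) \<in> compatible G \<alpha>" by (rule compatible_obs[OF game obs_based p(1) h])
      from compatible_X[OF this] show ?thesis
        using knowledge_cong[OF h(2)] p(2) by simp
    qed
    ultimately show "s \<in> safe_step G T Y"
      using knowledge_states[of G p] p(2) by (auto simp: safe_step_def)
  qed
  then have "Y \<subseteq> winning_beliefs G T" unfolding winning_beliefs_def by (rule gfp_upperbound)
  moreover have "{initial G} \<in> Y"
    using knowledge_Nil[of G] game compatible.init[of G \<alpha>] unfolding Y_def is_game_structure_def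
    by (metis imageI)
  ultimately show ?thesis by blast
qed

end

section \<open>Moving the initial state\<close>

lemma start_in_simps:
  "prefixes (start_in G l) = {(h, q). let ls = map fst h @ [q] in
     hd ls = l \<and> set ls \<subseteq> states G \<and> (\<forall>i<length h. (ls ! i, snd (h ! i), ls ! Suc i) \<in> transitions G)}"
  "obs_of (start_in G l) = obs_of G" "Buchi (start_in G l) T = Buchi G T"
  by (simp_all add: prefixes_def obs_of_def fun_eq_iff Buchi_def)

lemma winning_beliefs_start_in: "winning_beliefs (start_in G l) T = winning_beliefs G T"
proof -
  have obs: "obs_of (start_in G l) = obs_of G" by (simp add: start_in_simps)
  have nb: "next_belief (start_in G l) = next_belief G"
    by (simp add: fun_eq_iff next_belief_def post_def obs)
  have al: "allowed (start_in G l) = allowed G"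
    by (simp add: fun_eq_iff allowed_def nb)
  have "reach_step (start_in G l) T Y = reach_step G T Y" for Y
    by (rule ext) (simp add: reach_step_def obs nb al)
  then have "safe_step (start_in G l) T = safe_step G T"
    by (intro ext) (simp add: safe_step_def al)
  then show ?thesis by (simp add: winning_beliefs_def)
qed

theorem almost_winning_iff:
  assumes G: "is_game_structure G" and T: "T \<subseteq> observations G" and l: "l \<in> states G"
  shows "almost_winning G (Buchi G T) l \<longleftrightarrow> {l} \<in> winning_beliefs G T"
proof
  let ?H = "start_in G l"
  have H: "is_game_structure ?H" using G l by (simp add: is_game_structure_def)
  assume "almost_winning G (Buchi G T) l"
  then obtain \<alpha> where \<alpha>: "randomized_strategy1 ?H \<alpha>" "observation_based ?H \<alpha>"
    "\<And>\<beta>. randomized_strategy2 ?H \<beta> \<Longrightarrow>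
      measure (outcome_measure ?H \<alpha> \<beta>) (Buchi G T \<inter> space (outcome_measure ?H \<alpha> \<beta>)) = 1"
    unfolding almost_winning_def by blast
  interpret almost_winning_game ?H T \<alpha>
    using H \<alpha> by unfold_locales (simp_all add: start_in_simps)
  show "{l} \<in> winning_beliefs G T"
    using initial_belief_winning by (simp add: winning_beliefs_start_in)
next
  let ?H = "start_in G l"
  have H: "is_game_structure ?H" using G l by (simp add: is_game_structure_def)
  assume "{l} \<in> winning_beliefs G T"
  then interpret winning_game ?H T
    using H T by unfold_locales (simp_all add: winning_beliefs_start_in)
  show "almost_winning G (Buchi G T) l"
    unfolding almost_winning_def
    using uniform_strategy uniform_obs uniform_wins by (auto simp: start_in_simps)
qed

section \<open>Isomorphic games\<close>

text \<open>The fixpoints use observations only through the partition they induce and through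
  membership in the target. Hence there is a map for states and one for letters, and observations
  need no map.\<close>

locale game_iso =
  fixes G :: "('s, 'a, 'o) game_structure" and T :: "'o set"
    and H :: "('t, 'b, 'p) game_structure" and U :: "'p set" and f :: "'s \<Rightarrow> 't" and g :: "'a \<Rightarrow> 'b"
  assumes f: "bij_betw f (states G) (states H)" and g: "bij_betw g (alphabet G) (alphabet H)"
    and transG: "transitions G \<subseteq> states G \<times> alphabet G \<times> states G"
    and transH: "transitions H \<subseteq> states H \<times> alphabet H \<times> states H"
    and trans: "\<And>q \<sigma> q'. q \<in> states G \<Longrightarrow> \<sigma> \<in> alphabet G \<Longrightarrow> q' \<in> states G \<Longrightarrow>
      (f q, g \<sigma>, f q') \<in> transitions H \<longleftrightarrow> (q, \<sigma>, q') \<in> transitions G"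
    and obs: "\<And>q q'. q \<in> states G \<Longrightarrow> q' \<in> states G \<Longrightarrow>
      obs_of H (f q) = obs_of H (f q') \<longleftrightarrow> obs_of G q = obs_of G q'"
    and target: "\<And>q. q \<in> states G \<Longrightarrow> obs_of H (f q) \<in> U \<longleftrightarrow> obs_of G q \<in> T"
begin

lemma transHE:
  assumes "(f q, g \<sigma>, r) \<in> transitions H" "q \<in> states G" "\<sigma> \<in> alphabet G"
  obtains q' where "r = f q'" "q' \<in> states G" "(q, \<sigma>, q') \<in> transitions G"
proof -
  have "r \<in> states H" using assms(1) transH by blast
  then obtain q' where "q' \<in> states G" "r = f q'" using f by (auto simp: bij_betw_def)
  then show ?thesis using that trans assms by blast
qed

lemma next_belief_iso:
  assumes "s \<subseteq> states G" "\<sigma> \<in> alphabet G" "q' \<in> states G"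
  shows "next_belief H (f ` s) (g \<sigma>) (f q') = f ` next_belief G s \<sigma> q'"
proof (intro set_eqI iffI)
  fix r assume "r \<in> next_belief H (f ` s) (g \<sigma>) (f q')"
  then obtain q where q: "q \<in> s" "(f q, g \<sigma>, r) \<in> transitions H" "obs_of H r = obs_of H (f q')"
    by (auto simp: next_belief_def post_def)
  then have "q \<in> states G" using assms by auto
  then obtain x where x: "r = f x" "x \<in> states G" "(q, \<sigma>, x) \<in> transitions G"
    using transHE[OF q(2) _ assms(2)] by blast
  then have "x \<in> next_belief G s \<sigma> q'" using q obs assms by (auto simp: next_belief_def post_def)
  then show "r \<in> f ` next_belief G s \<sigma> q'" using x by blast
next
  fix r assume "r \<in> f ` next_belief G s \<sigma> q'"
  then obtain x q where x: "r = f x" "q \<in> s" "(q, \<sigma>, x) \<in> transitions G" "obs_of G x = obs_of G q'"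
    by (auto simp: next_belief_def post_def)
  then have "x \<in> states G" "q \<in> states G" using transG assms by auto
  then have "(f q, g \<sigma>, r) \<in> transitions H" "obs_of H r = obs_of H (f q')"
    using x trans obs assms by auto
  then show "r \<in> next_belief H (f ` s) (g \<sigma>) (f q')"
    using x(2) by (auto simp: next_belief_def post_def)
qed

lemma allowed_iso:
  assumes "s \<subseteq> states G" "\<sigma> \<in> alphabet G" "allowed G Y s \<sigma>"
  shows "allowed H (image f ` Y) (f ` s) (g \<sigma>)"
  unfolding allowed_def
proof (intro ballI allI impI)
  fix p r assume "p \<in> f ` s" and tr: "(p, g \<sigma>, r) \<in> transitions H"
  then obtain q where q: "q \<in> s" "p = f q" by blast
  then obtain q' where q': "r = f q'" "q' \<in> states G" "(q, \<sigma>, q') \<in> transitions G"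
    using transHE[of q \<sigma> r] tr assms by blast
  then have "next_belief G s \<sigma> q' \<in> Y" using assms(3) q unfolding allowed_def by blast
  then show "next_belief H (f ` s) (g \<sigma>) r \<in> image f ` Y"
    using next_belief_iso[OF assms(1,2) q'(2)] q'(1) by simp
qed

lemma reach_iso:
  assumes "(s, q) \<in> lfp (reach_step G T Y)"
  shows "(f ` s, f q) \<in> lfp (reach_step H U (image f ` Y))"
proof -
  let ?L = "lfp (reach_step H U (image f ` Y))"
  have "lfp (reach_step G T Y) \<subseteq> {(s, q). (f ` s, f q) \<in> ?L}"
  proof (rule lfp_lowerbound, clarify)
    fix s q
    assume "(s, q) \<in> reach_step G T Y {(s, q). (f ` s, f q) \<in> ?L}"
    then have s: "s \<subseteq> states G" "q \<in> s" and *: "obs_of G q \<in> T \<or> (\<exists>\<sigma>\<in>alphabet G. allowed G Y s \<sigma> \<and>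
        (\<forall>q'. (q, \<sigma>, q') \<in> transitions G \<longrightarrow> (f ` next_belief G s \<sigma> q', f q') \<in> ?L))"
      by (auto simp: reach_step_def)
    have "f ` s \<subseteq> states H" using s(1) f by (auto simp: bij_betw_def)
    moreover have "obs_of H (f q) \<in> U \<or> (\<exists>\<sigma>\<in>alphabet H. allowed H (image f ` Y) (f ` s) \<sigma> \<and>
        (\<forall>r. (f q, \<sigma>, r) \<in> transitions H \<longrightarrow> (next_belief H (f ` s) \<sigma> r, r) \<in> ?L))"
      using *
    proof
      assume "obs_of G q \<in> T"
      then show ?thesis using target s by auto
    next
      assume "\<exists>\<sigma>\<in>alphabet G. allowed G Y s \<sigma> \<and>
        (\<forall>q'. (q, \<sigma>, q') \<in> transitions G \<longrightarrow> (f ` next_belief G s \<sigma> q', f q') \<in> ?L)"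
      then obtain \<sigma> where \<sigma>: "\<sigma> \<in> alphabet G" "allowed G Y s \<sigma>"
        "\<And>q'. (q, \<sigma>, q') \<in> transitions G \<Longrightarrow> (f ` next_belief G s \<sigma> q', f q') \<in> ?L" by blast
      have "(next_belief H (f ` s) (g \<sigma>) r, r) \<in> ?L" if r: "(f q, g \<sigma>, r) \<in> transitions H" for r
      proof -
        obtain q' where "r = f q'" "q' \<in> states G" "(q, \<sigma>, q') \<in> transitions G"
          using transHE[OF r _ \<sigma>(1)] s by blast
        then show ?thesis using \<sigma>(3) next_belief_iso[OF s(1) \<sigma>(1)] by simp
      qed
      moreover have "g \<sigma> \<in> alphabet H" using g \<sigma>(1) by (auto simp: bij_betw_def)
      ultimately show ?thesis using allowed_iso[OF s(1) \<sigma>(1,2)] by blast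
    qed
    ultimately have "(f ` s, f q) \<in> reach_step H U (image f ` Y) ?L"
      using s(2) unfolding reach_step_def by blast
    then show "(f ` s, f q) \<in> ?L" using lfp_unfold[OF mono_reach_step] by blast
  qed
  then show ?thesis using assms by blast
qed

text \<open>The image of the winning beliefs is a post-fixpoint of the operator of \<open>H\<close>.
  The opposite direction comes from applying this to \<open>inverse_iso\<close>.\<close>

lemma winning_beliefs_iso: "s \<in> winning_beliefs G T \<Longrightarrow> f ` s \<in> winning_beliefs H U"
proof -
  let ?Y = "winning_beliefs G T"
  have "image f ` ?Y \<subseteq> safe_step H U (image f ` ?Y)"
  proof clarify
    fix s assume "s \<in> ?Y"
    then have "s \<in> safe_step G T ?Y"
      unfolding winning_beliefs_def using gfp_unfold[OF mono_safe_step] by blast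
    then obtain \<sigma> where s: "s \<subseteq> states G" "\<And>q. q \<in> s \<Longrightarrow> (s, q) \<in> lfp (reach_step G T ?Y)"
      "\<sigma> \<in> alphabet G" "allowed G ?Y s \<sigma>"
      unfolding safe_step_def by blast
    have "f ` s \<subseteq> states H" using s(1) f by (auto simp: bij_betw_def)
    moreover have "g \<sigma> \<in> alphabet H" using g s(3) by (auto simp: bij_betw_def)
    ultimately show "f ` s \<in> safe_step H U (image f ` ?Y)"
      using allowed_iso[OF s(1,3,4)] reach_iso s(2) unfolding safe_step_def by blast
  qed
  then have "image f ` ?Y \<subseteq> winning_beliefs H U"
    unfolding winning_beliefs_def by (rule gfp_upperbound)
  then show "s \<in> winning_beliefs G T \<Longrightarrow> f ` s \<in> winning_beliefs H U" by blast
qed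

lemma inverse_iso: "game_iso H U G T (inv_into (states G) f) (inv_into (alphabet G) g)"
proof -
  let ?f = "inv_into (states G) f" and ?g = "inv_into (alphabet G) g"
  have f': "f (?f q) = q" "?f q \<in> states G" if "q \<in> states H" for q
    using f that by (auto simp: bij_betw_def f_inv_into_f inv_into_into)
  have g': "g (?g \<sigma>) = \<sigma>" "?g \<sigma> \<in> alphabet G" if "\<sigma> \<in> alphabet H" for \<sigma>
    using g that by (auto simp: bij_betw_def f_inv_into_f inv_into_into)
  show ?thesis
  proof
    fix q \<sigma> q' assume "q \<in> states H" "\<sigma> \<in> alphabet H" "q' \<in> states H"
    then show "(?f q, ?g \<sigma>, ?f q') \<in> transitions G \<longleftrightarrow> (q, \<sigma>, q') \<in> transitions H"
      using trans[of "?f q" "?g \<sigma>" "?f q'"] f' g' by simp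
  next
    fix q q' assume "q \<in> states H" "q' \<in> states H"
    then show "obs_of G (?f q) = obs_of G (?f q') \<longleftrightarrow> obs_of H q = obs_of H q'"
      using obs[of "?f q" "?f q'"] f' by simp
  next
    fix q assume "q \<in> states H"
    then show "obs_of G (?f q) \<in> T \<longleftrightarrow> obs_of H q \<in> U" using target[of "?f q"] f' by simp
  qed (use f g transG transH in \<open>auto intro: bij_betw_inv_into\<close>)
qed

lemma singleton_winning_iff:
  assumes "l \<in> states G"
  shows "{l} \<in> winning_beliefs G T \<longleftrightarrow> {f l} \<in> winning_beliefs H U"
proof
  show "{l} \<in> winning_beliefs G T \<Longrightarrow> {f l} \<in> winning_beliefs H U" using winning_beliefs_iso[of "{l}"] by simp
  show "{f l} \<in> winning_beliefs H U \<Longrightarrow> {l} \<in> winning_beliefs G T"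
    using game_iso.winning_beliefs_iso[OF inverse_iso, of "{f l}"] assms f by (simp add: bij_betw_def)
qed

end

lemma obs_of_eq_iff:
  assumes G: "is_game_structure G" and q: "q \<in> states G"
  shows "obs_of G q = b \<longleftrightarrow> b \<in> observations G \<and> q \<in> gamma G b"
proof -
  have uniq: "b = b'" if "b \<in> observations G" "q \<in> gamma G b" "b' \<in> observations G" "q \<in> gamma G b'" for b b'
    using that G unfolding is_game_structure_def disjoint_family_on_def by blast
  obtain b0 where b0: "b0 \<in> observations G" "q \<in> gamma G b0" using q G unfolding is_game_structure_def by blast
  then have "obs_of G q = b0" unfolding obs_of_def using uniq by blast
  then show ?thesis using b0 uniq by blast
qed

section \<open>Codes of instances\<close>

text \<open>False beyond the end of the word for both values of \<open>b\<close>, like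
  \<open>Input\<close> and unlike indexing by \<open>!\<close>.\<close>

definition reads :: "bool list \<Rightarrow> bool \<Rightarrow> nat \<Rightarrow> bool" where
  "reads w b p \<longleftrightarrow> p < length w \<and> w ! p = b"

definition header :: "bool list \<Rightarrow> nat \<Rightarrow> nat \<Rightarrow> nat \<Rightarrow> bool" where
  "header w n m k \<longleftrightarrow>
     reads w False n \<and> (\<forall>p<n. reads w True p) \<and>
     reads w False (n + 1 + m) \<and> (\<forall>p. n < p \<and> p < n + 1 + m \<longrightarrow> reads w True p) \<and>
     reads w False (n + 1 + m + 1 + k) \<and> (\<forall>p. n + 1 + m < p \<and> p < n + 1 + m + 1 + k \<longrightarrow> reads w True p)"

text \<open>The three unary numbers take \<open>n + m + k + 3\<close> bits; the tables that follow
  have \<open>n\<close>, \<open>n * m * n\<close>, \<open>k * n\<close>, \<open>k\<close> and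
  \<open>n\<close> bits. In particular \<open>start_pos n m k n\<close> is the length of a whole
  code.\<close>

definition initial_pos :: "nat \<Rightarrow> nat \<Rightarrow> nat \<Rightarrow> nat \<Rightarrow> nat" where
  "initial_pos n m k q = n + m + k + 3 + q"

definition trans_pos :: "nat \<Rightarrow> nat \<Rightarrow> nat \<Rightarrow> nat \<Rightarrow> nat \<Rightarrow> nat \<Rightarrow> nat" where
  "trans_pos n m k q \<sigma> q' = n + m + k + 3 + n + ((q * m + \<sigma>) * n + q')"

definition gamma_pos :: "nat \<Rightarrow> nat \<Rightarrow> nat \<Rightarrow> nat \<Rightarrow> nat \<Rightarrow> nat" where
  "gamma_pos n m k b q = n + m + k + 3 + n + n * m * n + (b * n + q)"

definition target_pos :: "nat \<Rightarrow> nat \<Rightarrow> nat \<Rightarrow> nat \<Rightarrow> nat" where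
  "target_pos n m k b = n + m + k + 3 + n + n * m * n + k * n + b"

definition start_pos :: "nat \<Rightarrow> nat \<Rightarrow> nat \<Rightarrow> nat \<Rightarrow> nat" where
  "start_pos n m k q = n + m + k + 3 + n + n * m * n + k * n + k + q"

definition shape :: "bool list \<Rightarrow> nat \<Rightarrow> nat \<Rightarrow> nat \<Rightarrow> bool" where
  "shape w n m k \<longleftrightarrow> header w n m k \<and> length w = start_pos n m k n"

text \<open>Each unary number ends at its first \<open>False\<close>, where a larger candidate would
  claim \<open>True\<close>.\<close>

lemma header_unique:
  assumes "header w n m k" "header w n' m' k'"
  shows "n = n' \<and> m = m' \<and> k = k'"
proof -
  have neq: "\<not> (reads w True p \<and> reads w False p)" for p by (auto simp: reads_def)
  have 1: "n = n'"
    by (rule linorder_cases[of n n']) (use assms neq in \<open>auto simp: header_def\<close>)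
  have 2: "m = m'"
  proof (rule linorder_cases[of m m'])
    assume "m < m'"
    then have "reads w True (n + 1 + m)" using assms(2) 1 by (auto simp: header_def)
    then show ?thesis using assms(1) neq by (auto simp: header_def)
  next
    assume "m' < m"
    then have "reads w True (n + 1 + m')" using assms(1) by (auto simp: header_def)
    then show ?thesis using assms(2) 1 neq by (auto simp: header_def)
  qed
  have "k = k'"
  proof (rule linorder_cases[of k k'])
    assume "k < k'"
    then have "reads w True (n + 1 + m + 1 + k)" using assms(2) 1 2 by (auto simp: header_def)
    then show ?thesis using assms(1) neq by (auto simp: header_def)
  next
    assume "k' < k"
    then have "reads w True (n + 1 + m + 1 + k')" using assms(1) by (auto simp: header_def)
    then show ?thesis using assms(2) 1 2 neq by (auto simp: header_def)
  qed
  with 1 2 show ?thesis by simp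
qed

lemma length_concat_uniform: "(\<And>x. x \<in> set xss \<Longrightarrow> length x = d) \<Longrightarrow> length (concat xss) = length xss * d"
  by (induction xss) auto

lemma nth_concat_uniform:
  "(\<And>x. x \<in> set xss \<Longrightarrow> length x = d) \<Longrightarrow> i < length xss \<Longrightarrow> j < d \<Longrightarrow> concat xss ! (i * d + j) = xss ! i ! j"
proof (induction xss arbitrary: i)
  case (Cons x xss)
  show ?case
  proof (cases i)
    case 0
    then show ?thesis using Cons by (simp add: nth_append)
  next
    case (Suc i')
    have "length x = d" using Cons by simp
    then have "concat (x # xss) ! (i * d + j) = concat xss ! (i' * d + j)"
      using Suc by (simp add: nth_append add.assoc)
    then show ?thesis using Cons Suc by simp
  qed
qed simp

lemma index_less:
  fixes i d j N :: nat
  assumes "i < N" "j < d" shows "i * d + j < N * d"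
proof -
  have "i * d + j < Suc i * d" using assms by simp
  also have "\<dots> \<le> N * d" using assms by (intro mult_le_mono) auto
  finally show ?thesis .
qed

text \<open>The sizes determine the header, and every later position lies in exactly one of the five
  tables. This serves to recognise a word as the code rebuilt from its own entries.\<close>

lemma shape_eqI:
  assumes w: "shape w n m k" and w': "shape w' n m k"
    and i: "\<And>q. q < n \<Longrightarrow> w ! initial_pos n m k q = w' ! initial_pos n m k q"
    and tr: "\<And>q \<sigma> q'. q < n \<Longrightarrow> \<sigma> < m \<Longrightarrow> q' < n \<Longrightarrow> w ! trans_pos n m k q \<sigma> q' = w' ! trans_pos n m k q \<sigma> q'"
    and ga: "\<And>b q. b < k \<Longrightarrow> q < n \<Longrightarrow> w ! gamma_pos n m k b q = w' ! gamma_pos n m k b q"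
    and ta: "\<And>b. b < k \<Longrightarrow> w ! target_pos n m k b = w' ! target_pos n m k b"
    and st: "\<And>q. q < n \<Longrightarrow> w ! start_pos n m k q = w' ! start_pos n m k q"
  shows "w = w'"
proof (rule nth_equalityI)
  show len: "length w = length w'" using w w' by (simp add: shape_def)
  fix p assume p: "p < length w"
  let ?o = "n + m + k + 3"
  consider "p < ?o" | "?o \<le> p" "p < ?o + n" | "?o + n \<le> p" "p < ?o + n + n * m * n"
    | "?o + n + n * m * n \<le> p" "p < ?o + n + n * m * n + k * n"
    | "?o + n + n * m * n + k * n \<le> p" "p < ?o + n + n * m * n + k * n + k"
    | "?o + n + n * m * n + k * n + k \<le> p" "p < ?o + n + n * m * n + k * n + k + n"
    using p w unfolding shape_def start_pos_def by linarith
  then show "w ! p = w' ! p"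
  proof cases
    case 1
    have h: "header w n m k" "header w' n m k" using w w' by (auto simp: shape_def)
    have "v ! p \<longleftrightarrow> p \<noteq> n \<and> p \<noteq> n + 1 + m \<and> p \<noteq> n + 1 + m + 1 + k" if "header v n m k" for v
    proof -
      consider "p < n" | "p = n" | "n < p \<and> p < n + 1 + m" | "p = n + 1 + m"
        | "n + 1 + m < p \<and> p < n + 1 + m + 1 + k" | "p = n + 1 + m + 1 + k" using 1 by linarith
      then show ?thesis using that unfolding header_def reads_def by cases auto
    qed
    from this[OF h(1)] this[OF h(2)] show ?thesis by simp
  next
    case 2
    then show ?thesis using i[of "p - ?o"] by (simp add: initial_pos_def)
  next
    case 3
    \<comment> \<open>Division with remainder by \<open>n\<close> and then by \<open>m\<close>
      recovers the three indices from the offset.\<close>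
    let ?r = "p - (?o + n)"
    have "n > 0" using 3 by (cases n) auto
    have "m > 0" using 3 by (cases m) auto
    have r: "?r < n * m * n" using 3 by simp
    then have "?r div n < n * m" by (simp add: less_mult_imp_div_less)
    then have "?r div n div m < n" by (simp add: less_mult_imp_div_less)
    moreover have "((?r div n div m) * m + ?r div n mod m) * n + ?r mod n = ?r" by simp
    ultimately show ?thesis
      using tr[of "?r div n div m" "?r div n mod m" "?r mod n"] 3 \<open>n > 0\<close> \<open>m > 0\<close>
      by (simp add: trans_pos_def)
  next
    case 4
    let ?r = "p - (?o + n + n * m * n)"
    have "n > 0" using 4 by (cases n) auto
    have "?r < k * n" using 4 by simp
    then have "?r div n < k" by (simp add: less_mult_imp_div_less)
    moreover have "(?r div n) * n + ?r mod n = ?r" by simp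
    ultimately show ?thesis
      using ga[of "?r div n" "?r mod n"] 4 \<open>n > 0\<close> by (simp add: gamma_pos_def)
  next
    case 5
    then show ?thesis using ta[of "p - (?o + n + n * m * n + k * n)"] by (simp add: target_pos_def)
  next
    case 6
    then show ?thesis using st[of "p - (?o + n + n * m * n + k * n + k)"] by (simp add: start_pos_def)
  qed
qed

lemma nth_append_right: "i = length xs + j \<Longrightarrow> (xs @ ys) ! i = ys ! j"
  by simp

lemma encode_instance_nth:
  fixes ls :: "'s list" and xs :: "'a list" and os :: "'o list" and G T l
  defines "n \<equiv> length ls" and "m \<equiv> length xs" and "k \<equiv> length os"
  defines "w \<equiv> encode_instance ls xs os G T l"
  shows "shape w n m k"
    and "q < n \<Longrightarrow> w ! initial_pos n m k q \<longleftrightarrow> ls ! q = initial G"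
    and "q < n \<Longrightarrow> \<sigma> < m \<Longrightarrow> q' < n \<Longrightarrow> w ! trans_pos n m k q \<sigma> q' \<longleftrightarrow> (ls ! q, xs ! \<sigma>, ls ! q') \<in> transitions G"
    and "b < k \<Longrightarrow> q < n \<Longrightarrow> w ! gamma_pos n m k b q \<longleftrightarrow> ls ! q \<in> gamma G (os ! b)"
    and "b < k \<Longrightarrow> w ! target_pos n m k b \<longleftrightarrow> os ! b \<in> T"
    and "q < n \<Longrightarrow> w ! start_pos n m k q \<longleftrightarrow> ls ! q = l"
proof -
  define hd where "hd = unary n @ unary m @ unary k"
  define A where "A = map (\<lambda>s. s = initial G) ls"
  define B where "B = concat (map (\<lambda>s. concat (map (\<lambda>\<sigma>. map (\<lambda>s'. (s, \<sigma>, s') \<in> transitions G) ls) xs)) ls)"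
  define C where "C = concat (map (\<lambda>b. map (\<lambda>s. s \<in> gamma G b) ls) os)"
  define D where "D = map (\<lambda>b. b \<in> T) os"
  define E where "E = map (\<lambda>s. s = l) ls"
  have w: "w = hd @ A @ B @ C @ D @ E"
    by (simp add: w_def encode_instance_def hd_def A_def B_def C_def D_def E_def n_def m_def k_def)
  have lu: "length (unary x) = Suc x" for x by (simp add: unary_def)
  have nu: "i < Suc x \<Longrightarrow> unary x ! i \<longleftrightarrow> i < x" for i x
    by (auto simp: unary_def nth_append)
  have lhd: "length hd = n + m + k + 3" by (simp add: hd_def lu)
  have lA: "length A = n" and lD: "length D = k" and lE: "length E = n"
    by (simp_all add: A_def D_def E_def n_def k_def)
  have lB1: "length (concat (map (\<lambda>\<sigma>. map (\<lambda>s'. (s, \<sigma>, s') \<in> transitions G) ls) xs)) = m * n" for s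
    by (subst length_concat_uniform[where d = n]) (auto simp: n_def m_def)
  have lB: "length B = n * m * n"
    unfolding B_def by (subst length_concat_uniform[where d = "m * n"]) (auto simp: lB1 n_def)
  have lC: "length C = k * n"
    unfolding C_def by (subst length_concat_uniform[where d = n]) (auto simp: n_def k_def)
  have hd_nth: "w ! p = hd ! p" if "p < n + m + k + 3" for p
    using that lhd by (simp add: w nth_append)
  have len: "length w = start_pos n m k n"
    by (simp add: w lhd lA lB lC lD lE start_pos_def)
  have "reads w b p \<longleftrightarrow> hd ! p = b" if "p < n + m + k + 3" for p b
    using that len hd_nth[OF that] by (simp add: reads_def start_pos_def)
  moreover have "hd ! p \<longleftrightarrow> p < n" if "p \<le> n" for p
    using that nu[of p n] lu by (simp add: hd_def nth_append)
  moreover have "hd ! p \<longleftrightarrow> p < n + 1 + m" if "n < p" "p \<le> n + 1 + m" for p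
    using that nu[of "p - Suc n" m] lu by (simp add: hd_def nth_append) linarith
  moreover have "hd ! p \<longleftrightarrow> p < n + 1 + m + 1 + k" if "n + 1 + m < p" "p \<le> n + 1 + m + 1 + k" for p
    using that nu[of "p - Suc n - Suc m" k] lu by (simp add: hd_def nth_append) linarith
  ultimately have "header w n m k" by (simp add: header_def)
  with len show "shape w n m k" by (simp add: shape_def)
  show "q < n \<Longrightarrow> w ! initial_pos n m k q \<longleftrightarrow> ls ! q = initial G"
  proof -
    assume q: "q < n"
    have "w ! initial_pos n m k q = (A @ B @ C @ D @ E) ! q"
      unfolding w by (rule nth_append_right) (simp add: lhd initial_pos_def)
    then show ?thesis using q by (simp add: nth_append lA) (simp add: A_def n_def)
  qed
  show "w ! trans_pos n m k q \<sigma> q' \<longleftrightarrow> (ls ! q, xs ! \<sigma>, ls ! q') \<in> transitions G" if q: "q < n" "\<sigma> < m" "q' < n"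
  proof -
    let ?i = "(q * m + \<sigma>) * n + q'"
    have "?i < n * m * n" using index_less[OF index_less[OF q(1,2)] q(3)] .
    have "w ! trans_pos n m k q \<sigma> q' = ((hd @ A) @ B @ C @ D @ E) ! trans_pos n m k q \<sigma> q'" by (simp add: w)
    also have "\<dots> = (B @ C @ D @ E) ! ?i"
      by (rule nth_append_right) (simp add: lhd lA trans_pos_def)
    also have "\<dots> = B ! ?i" using \<open>?i < n * m * n\<close> by (simp add: nth_append lB)
    also have "?i = q * (m * n) + (\<sigma> * n + q')" by (simp add: algebra_simps)
    also have "B ! \<dots> = concat (map (\<lambda>\<sigma>. map (\<lambda>s'. (ls ! q, \<sigma>, s') \<in> transitions G) ls) xs) ! (\<sigma> * n + q')"
      unfolding B_def using index_less[OF q(2,3)] q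
      by (subst nth_concat_uniform[where d = "m * n"]) (auto simp: lB1 n_def)
    also have "\<dots> \<longleftrightarrow> (ls ! q, xs ! \<sigma>, ls ! q') \<in> transitions G"
      using q by (subst nth_concat_uniform[where d = n]) (auto simp: n_def m_def)
    finally show ?thesis .
  qed
  show "w ! gamma_pos n m k b q \<longleftrightarrow> ls ! q \<in> gamma G (os ! b)" if q: "b < k" "q < n"
  proof -
    let ?i = "b * n + q"
    have "w ! gamma_pos n m k b q = ((hd @ A @ B) @ C @ D @ E) ! gamma_pos n m k b q" by (simp add: w)
    also have "\<dots> = (C @ D @ E) ! ?i"
      by (rule nth_append_right) (simp add: lhd lA lB gamma_pos_def)
    also have "\<dots> = C ! ?i" using index_less[OF q] by (simp add: nth_append lC)
    also have "\<dots> \<longleftrightarrow> ls ! q \<in> gamma G (os ! b)"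
      unfolding C_def using q by (subst nth_concat_uniform[where d = n]) (auto simp: n_def k_def)
    finally show ?thesis .
  qed
  show "w ! target_pos n m k b \<longleftrightarrow> os ! b \<in> T" if b: "b < k"
  proof -
    have "w ! target_pos n m k b = ((hd @ A @ B @ C) @ D @ E) ! target_pos n m k b" by (simp add: w)
    also have "\<dots> = (D @ E) ! b"
      by (rule nth_append_right) (simp add: lhd lA lB lC target_pos_def)
    also have "\<dots> \<longleftrightarrow> os ! b \<in> T" using b by (simp add: nth_append lD) (simp add: D_def k_def)
    finally show ?thesis .
  qed
  show "w ! start_pos n m k q \<longleftrightarrow> ls ! q = l" if q: "q < n"
  proof -
    have "w ! start_pos n m k q = ((hd @ A @ B @ C @ D) @ E) ! start_pos n m k q" by (simp add: w)
    also have "\<dots> = E ! q"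
      by (rule nth_append_right) (simp add: lhd lA lB lC lD start_pos_def)
    also have "\<dots> \<longleftrightarrow> ls ! q = l" using q by (simp add: E_def n_def)
    finally show ?thesis .
  qed
qed

text \<open>The value \<open>0\<close> is a placeholder; \<open>start_in\<close> puts in the encoded
  initial state where the structure is used as an instance.\<close>

definition index_game :: "bool list \<Rightarrow> nat \<Rightarrow> nat \<Rightarrow> nat \<Rightarrow> (nat, nat, nat) game_structure" where
  "index_game w n m k = \<lparr>states = {..<n}, initial = 0, alphabet = {..<m},
     transitions = {(q, \<sigma>, q'). q < n \<and> \<sigma> < m \<and> q' < n \<and> w ! trans_pos n m k q \<sigma> q'},
     observations = {..<k}, gamma = (\<lambda>b. {q. q < n \<and> w ! gamma_pos n m k b q})\<rparr>"

definition index_target :: "bool list \<Rightarrow> nat \<Rightarrow> nat \<Rightarrow> nat \<Rightarrow> nat set" where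
  "index_target w n m k = {b. b < k \<and> w ! target_pos n m k b}"

text \<open>First-order in the table entries, so that a formula can test it, and yet a
  characterisation of codes by \<open>instance_valid\<close> and
  \<open>valid_is_code\<close>.\<close>

definition valid :: "bool list \<Rightarrow> nat \<Rightarrow> nat \<Rightarrow> nat \<Rightarrow> bool" where
  "valid w n m k \<longleftrightarrow> shape w n m k \<and>
     (\<exists>q0<n. \<forall>q<n. w ! initial_pos n m k q \<longleftrightarrow> q = q0) \<and>
     (\<exists>l<n. \<forall>q<n. w ! start_pos n m k q \<longleftrightarrow> q = l) \<and>
     (\<forall>q<n. \<forall>\<sigma><m. \<exists>q'<n. w ! trans_pos n m k q \<sigma> q') \<and>
     (\<forall>b<k. \<exists>q<n. w ! gamma_pos n m k b q) \<and>
     (\<forall>q<n. \<exists>b<k. \<forall>b'<k. w ! gamma_pos n m k b' q \<longleftrightarrow> b' = b)"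

text \<open>No choice is involved in the quantifiers: the sizes are determined by \<open>w\<close>
  and the index \<open>l\<close> by validity.\<close>

definition accepting :: "bool list \<Rightarrow> bool" where
  "accepting w \<longleftrightarrow> (\<exists>n m k l. valid w n m k \<and> l < n \<and> w ! start_pos n m k l \<and>
     {l} \<in> winning_beliefs (index_game w n m k) (index_target w n m k))"

section \<open>Valid words are the codes\<close>

lemma index_game_structure:
  assumes "valid w n m k" "q0 < n"
  shows "is_game_structure (start_in (index_game w n m k) q0)"
proof -
  have "disjoint_family_on (gamma (index_game w n m k)) {..<k}"
    using assms(1) unfolding disjoint_family_on_def valid_def index_game_def by fastforce
  moreover have "(\<Union>b<k. gamma (index_game w n m k) b) = {..<n}"
    using assms(1) unfolding valid_def index_game_def by fastforce
  ultimately show ?thesis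
    using assms unfolding is_game_structure_def
    by (auto simp: valid_def index_game_def)
qed

lemma obs_of_index_game:
  assumes "valid w n m k" "q < n"
  shows "obs_of (index_game w n m k) q = b \<longleftrightarrow> b < k \<and> w ! gamma_pos n m k b q"
  using obs_of_eq_iff[OF index_game_structure[OF assms], of q b] assms(2)
  unfolding start_in_simps by (simp add: index_game_def)

lemma instance_valid:
  assumes I: "Buchi_instance ls xs os G T l"
  defines "n \<equiv> length ls" and "m \<equiv> length xs" and "k \<equiv> length os"
  defines "w \<equiv> encode_instance ls xs os G T l"
  shows "valid w n m k"
proof -
  note enc = encode_instance_nth[where ls = ls and xs = xs and os = os and G = G and T = T
    and l = l, folded n_def m_def k_def w_def]
  have G: "is_game_structure G" and l: "l \<in> set ls"
    and sets: "set ls = states G" "set xs = alphabet G" "set os = observations G"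
    and dist: "distinct ls" "distinct xs" "distinct os"
    using I by (auto simp: Buchi_instance_def)
  have ls: "ls ! q \<in> states G" if "q < n" for q using that sets by (auto simp: n_def)
  have eq: "\<exists>q0<n. \<forall>q<n. ls ! q = x \<longleftrightarrow> q = q0" if "x \<in> set ls" for x
    using that dist(1) unfolding n_def by (metis in_set_conv_nth nth_eq_iff_index_eq)
  have "initial G \<in> set ls" using G sets by (simp add: is_game_structure_def)
  from eq[OF this] have 1: "\<exists>q0<n. \<forall>q<n. w ! initial_pos n m k q \<longleftrightarrow> q = q0"
    using enc(2) by simp
  from eq[OF l] have 2: "\<exists>l<n. \<forall>q<n. w ! start_pos n m k q \<longleftrightarrow> q = l"
    using enc(6) by simp
  have 3: "\<exists>q'<n. w ! trans_pos n m k q \<sigma> q'" if q: "q < n" "\<sigma> < m" for q \<sigma>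
  proof -
    have "xs ! \<sigma> \<in> alphabet G" using q sets by (auto simp: m_def)
    then obtain x where x: "(ls ! q, xs ! \<sigma>, x) \<in> transitions G"
      using ls[OF q(1)] G unfolding is_game_structure_def by blast
    then have "x \<in> set ls" using G sets by (auto simp: is_game_structure_def)
    then obtain q' where "q' < n" "ls ! q' = x" by (auto simp: in_set_conv_nth n_def)
    then show ?thesis using enc(3)[OF q] x by auto
  qed
  have 4: "\<exists>q<n. w ! gamma_pos n m k b q" if "b < k" for b
  proof -
    have b: "os ! b \<in> observations G" using that sets by (auto simp: k_def)
    then obtain x where x: "x \<in> gamma G (os ! b)" using G unfolding is_game_structure_def by blast
    then have "x \<in> set ls" using G sets b unfolding is_game_structure_def by blast
    then obtain q where "q < n" "ls ! q = x" by (auto simp: in_set_conv_nth n_def)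
    then show ?thesis using enc(4)[OF that] x by auto
  qed
  have 5: "\<exists>b<k. \<forall>b'<k. w ! gamma_pos n m k b' q \<longleftrightarrow> b' = b" if q: "q < n" for q
  proof -
    note ob = obs_of_eq_iff[OF G ls[OF q]]
    have "obs_of G (ls ! q) \<in> set os" using ob sets by blast
    then obtain b where b: "b < k" "os ! b = obs_of G (ls ! q)" by (auto simp: in_set_conv_nth k_def)
    have "w ! gamma_pos n m k b' q \<longleftrightarrow> b' = b" if b': "b' < k" for b'
    proof -
      have "os ! b' \<in> observations G" using b' sets by (auto simp: k_def)
      then have "w ! gamma_pos n m k b' q \<longleftrightarrow> os ! b' = obs_of G (ls ! q)"
        using enc(4)[OF b' q] ob[of "os ! b'"] by auto
      also have "\<dots> \<longleftrightarrow> b' = b" using b b' dist(3) unfolding k_def by (metis nth_eq_iff_index_eq)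
      finally show ?thesis .
    qed
    then show ?thesis using b by blast
  qed
  show ?thesis unfolding valid_def using enc(1) 1 2 3 4 5 by blast
qed

text \<open>Indexing by the enumerations \<open>ls\<close> and \<open>xs\<close> is an isomorphism
  from the game read off the code to \<open>G\<close>, which carries winning beliefs from one to the
  other.\<close>

lemma almost_winning_iff_accepting:
  assumes I: "Buchi_instance ls xs os G T l"
  shows "almost_winning G (Buchi G T) l \<longleftrightarrow> accepting (encode_instance ls xs os G T l)"
proof -
  define n m k w where "n = length ls" and "m = length xs" and "k = length os"
    and "w = encode_instance ls xs os G T l"
  note enc = encode_instance_nth[where ls = ls and xs = xs and os = os and G = G and T = T
    and l = l, folded n_def m_def k_def w_def]
  have valid: "valid w n m k" unfolding n_def m_def k_def w_def by (rule instance_valid[OF I])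
  have G: "is_game_structure G" and T: "T \<subseteq> observations G" and l: "l \<in> set ls"
    and sets: "set ls = states G" "set xs = alphabet G" "set os = observations G"
    and dist: "distinct ls" "distinct xs" "distinct os"
    using I by (auto simp: Buchi_instance_def)
  let ?H = "index_game w n m k" and ?U = "index_target w n m k"
  have ls: "ls ! q \<in> states G" if "q < n" for q using that sets by (auto simp: n_def)
  have obs: "obs_of G (ls ! q) = os ! obs_of ?H q" "obs_of ?H q < k" if q: "q < n" for q
  proof -
    let ?b = "obs_of ?H q"
    have b: "?b < k" "w ! gamma_pos n m k ?b q" using obs_of_index_game[OF valid q, of ?b] by auto
    then have "ls ! q \<in> gamma G (os ! ?b)" using enc(4) q by simp
    moreover have "os ! ?b \<in> observations G" using b(1) sets by (auto simp: k_def)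
    ultimately show "obs_of G (ls ! q) = os ! ?b" using obs_of_eq_iff[OF G ls[OF q]] by blast
    show "?b < k" by (rule b(1))
  qed
  interpret game_iso ?H ?U G T "(!) ls" "(!) xs"
  proof
    show "bij_betw ((!) ls) (states ?H) (states G)"
      using bij_betw_nth[OF dist(1), of "{..<n}"] sets by (simp add: index_game_def n_def)
    show "bij_betw ((!) xs) (alphabet ?H) (alphabet G)"
      using bij_betw_nth[OF dist(2), of "{..<m}"] sets by (simp add: index_game_def m_def)
    show "transitions ?H \<subseteq> states ?H \<times> alphabet ?H \<times> states ?H" by (auto simp: index_game_def)
    show "transitions G \<subseteq> states G \<times> alphabet G \<times> states G" using G by (simp add: is_game_structure_def)
  next
    fix q \<sigma> q' assume "q \<in> states ?H" "\<sigma> \<in> alphabet ?H" "q' \<in> states ?H"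
    then show "(ls ! q, xs ! \<sigma>, ls ! q') \<in> transitions G \<longleftrightarrow> (q, \<sigma>, q') \<in> transitions ?H"
      using enc(3) by (simp add: index_game_def)
  next
    fix q q' assume "q \<in> states ?H" "q' \<in> states ?H"
    then have "q < n" "q' < n" by (simp_all add: index_game_def)
    then show "obs_of G (ls ! q) = obs_of G (ls ! q') \<longleftrightarrow> obs_of ?H q = obs_of ?H q'"
      using obs nth_eq_iff_index_eq[OF dist(3)] by (simp add: k_def)
  next
    fix q assume "q \<in> states ?H"
    then have "q < n" by (simp add: index_game_def)
    then show "obs_of G (ls ! q) \<in> T \<longleftrightarrow> obs_of ?H q \<in> ?U"
      using obs[of q] enc(5) by (simp add: index_target_def)
  qed
  obtain l' where l': "l' < n" "ls ! l' = l" using l by (auto simp: in_set_conv_nth n_def)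
  have start: "w ! start_pos n m k q \<longleftrightarrow> q = l'" if "q < n" for q
    using that l' enc(6)[OF that] nth_eq_iff_index_eq[OF dist(1)] by (auto simp: n_def)
  have "almost_winning G (Buchi G T) l \<longleftrightarrow> {l'} \<in> winning_beliefs ?H ?U"
    using almost_winning_iff[OF G T] singleton_winning_iff[of l'] l l' sets by (simp add: index_game_def)
  also have "\<dots> \<longleftrightarrow> accepting w"
  proof
    show "{l'} \<in> winning_beliefs ?H ?U \<Longrightarrow> accepting w"
      using valid l' start unfolding accepting_def by blast
    assume "accepting w"
    then obtain n' m' k' q where *: "valid w n' m' k'" "q < n'" "w ! start_pos n' m' k' q"
      "{q} \<in> winning_beliefs (index_game w n' m' k') (index_target w n' m' k')"
      unfolding accepting_def by blast
    have "n' = n \<and> m' = m \<and> k' = k"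
      using *(1) valid by (intro header_unique) (auto simp: valid_def shape_def)
    then show "{l'} \<in> winning_beliefs ?H ?U" using * start by auto
  qed
  finally show ?thesis by (simp add: w_def)
qed

text \<open>Indices serve as names of states, letters and observations, and encoding them reproduces
  the tables. This gives the inclusion of the accepting words in the language.\<close>

lemma valid_is_code:
  assumes valid: "valid w n m k"
  obtains q0 l where "Buchi_instance [0..<n] [0..<m] [0..<k] (start_in (index_game w n m k) q0)
    (index_target w n m k) l"
    "encode_instance [0..<n] [0..<m] [0..<k] (start_in (index_game w n m k) q0) (index_target w n m k) l = w"
proof -
  obtain q0 l where q0: "q0 < n" "\<And>q. q < n \<Longrightarrow> w ! initial_pos n m k q \<longleftrightarrow> q = q0"
    and l: "l < n" "\<And>q. q < n \<Longrightarrow> w ! start_pos n m k q \<longleftrightarrow> q = l"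
    using valid unfolding valid_def by blast
  let ?H = "start_in (index_game w n m k) q0" and ?U = "index_target w n m k"
  have fields: "states ?H = {..<n}" "alphabet ?H = {..<m}" "observations ?H = {..<k}" "initial ?H = q0"
    "transitions ?H = {(q, \<sigma>, q'). q < n \<and> \<sigma> < m \<and> q' < n \<and> w ! trans_pos n m k q \<sigma> q'}"
    "gamma ?H = (\<lambda>b. {q. q < n \<and> w ! gamma_pos n m k b q})"
    by (simp_all add: index_game_def)
  have "Buchi_instance [0..<n] [0..<m] [0..<k] ?H ?U l"
    unfolding Buchi_instance_def fields using index_game_structure[OF valid q0(1)] l(1)
    by (auto simp: index_target_def)
  moreover have "encode_instance [0..<n] [0..<m] [0..<k] ?H ?U l = w"
  proof (rule shape_eqI[where n = n and m = m and k = k])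
    note enc = encode_instance_nth[where ls = "[0..<n]" and xs = "[0..<m]" and os = "[0..<k]" and G = ?H
      and T = ?U and l = l, unfolded length_upt diff_zero]
    show "shape (encode_instance [0..<n] [0..<m] [0..<k] ?H ?U l) n m k" by (rule enc)
    show "shape w n m k" using valid by (simp add: valid_def)
    show "encode_instance [0..<n] [0..<m] [0..<k] ?H ?U l ! initial_pos n m k q = w ! initial_pos n m k q"
      if "q < n" for q
      using enc(2)[OF that] q0(2)[OF that] that by (simp add: fields del: select_convs)
    show "encode_instance [0..<n] [0..<m] [0..<k] ?H ?U l ! trans_pos n m k q \<sigma> q' = w ! trans_pos n m k q \<sigma> q'"
      if "q < n" "\<sigma> < m" "q' < n" for q \<sigma> q'
      using enc(3)[OF that] that unfolding fields by simp
    show "encode_instance [0..<n] [0..<m] [0..<k] ?H ?U l ! gamma_pos n m k b q = w ! gamma_pos n m k b q"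
      if "b < k" "q < n" for b q
      using enc(4)[OF that] that unfolding fields by simp
    show "encode_instance [0..<n] [0..<m] [0..<k] ?H ?U l ! target_pos n m k b = w ! target_pos n m k b"
      if "b < k" for b
      using enc(5)[OF that] that by (simp add: index_target_def)
    show "encode_instance [0..<n] [0..<m] [0..<k] ?H ?U l ! start_pos n m k q = w ! start_pos n m k q"
      if "q < n" for q
      using enc(6)[OF that] l(2)[OF that] that by simp
  qed
  ultimately show ?thesis using that by blast
qed

theorem problem_eq_accepting: "almost_winning_Buchi_problem = {w. accepting w}"
proof (intro set_eqI iffI)
  fix w assume "w \<in> almost_winning_Buchi_problem"
  then obtain ls xs os T l and G :: "(nat, nat, nat) game_structure" where
    "w = encode_instance ls xs os G T l" "Buchi_instance ls xs os G T l" "almost_winning G (Buchi G T) l"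
    unfolding almost_winning_Buchi_problem_def by blast
  then show "w \<in> {w. accepting w}"
    by (metis almost_winning_iff_accepting mem_Collect_eq)
next
  fix w assume w: "w \<in> {w. accepting w}"
  then obtain n m k where "valid w n m k" unfolding accepting_def by blast
  then obtain q0 l where I: "Buchi_instance [0..<n] [0..<m] [0..<k] (start_in (index_game w n m k) q0)
    (index_target w n m k) l"
    and code: "encode_instance [0..<n] [0..<m] [0..<k] (start_in (index_game w n m k) q0)
      (index_target w n m k) l = w"
    using valid_is_code by blast
  have aw: "almost_winning (start_in (index_game w n m k) q0)
    (Buchi (start_in (index_game w n m k) q0) (index_target w n m k)) l"
    using almost_winning_iff_accepting[OF I] w code by simp
  show "w \<in> almost_winning_Buchi_problem"
    unfolding almost_winning_Buchi_problem_def
    by (intro CollectI exI conjI) (rule code[symmetric], rule I, rule aw)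
qed

section \<open>Arithmetic by iterated definitions\<close>

definition Disj :: "fm \<Rightarrow> fm \<Rightarrow> fm" where "Disj \<phi> \<psi> = Neg (And (Neg \<phi>) (Neg \<psi>))"
definition Impl :: "fm \<Rightarrow> fm \<Rightarrow> fm" where "Impl \<phi> \<psi> = Neg (And \<phi> (Neg \<psi>))"
definition Equiv :: "fm \<Rightarrow> fm \<Rightarrow> fm" where "Equiv \<phi> \<psi> = And (Impl \<phi> \<psi>) (Impl \<psi> \<phi>)"
definition Forall :: "nat \<Rightarrow> fm \<Rightarrow> fm" where "Forall v \<phi> = Neg (Ex v (Neg \<phi>))"
definition Equal :: "nat \<Rightarrow> nat \<Rightarrow> fm" where "Equal i j = And (Neg (Less i j)) (Neg (Less j i))"
text \<open>The extra argument \<open>f\<close> is the variable to be bound. It is passed explicitly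
  because \<open>wf_fm\<close> forbids binding a variable that is already in use.\<close>

definition Zero :: "nat \<Rightarrow> nat \<Rightarrow> fm" where "Zero i f = Neg (Ex f (Less f i))"
definition Succ :: "nat \<Rightarrow> nat \<Rightarrow> nat \<Rightarrow> fm" where
  "Succ i j f = And (Less i j) (Neg (Ex f (And (Less i f) (Less f j))))"

lemma sem_connectives [simp]:
  "sem N w A e (Disj \<phi> \<psi>) \<longleftrightarrow> sem N w A e \<phi> \<or> sem N w A e \<psi>"
  "sem N w A e (Impl \<phi> \<psi>) \<longleftrightarrow> (sem N w A e \<phi> \<longrightarrow> sem N w A e \<psi>)"
  "sem N w A e (Equiv \<phi> \<psi>) \<longleftrightarrow> (sem N w A e \<phi> \<longleftrightarrow> sem N w A e \<psi>)"
  "sem N w A e (Forall v \<phi>) \<longleftrightarrow> (\<forall>x<N. sem N w A (e(v := x)) \<phi>)"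
  "sem N w A e (Equal i j) \<longleftrightarrow> e i = e j"
  by (auto simp: Disj_def Impl_def Equiv_def Forall_def Equal_def)

lemma sem_Zero [simp]: "e i < N \<Longrightarrow> f \<noteq> i \<Longrightarrow> sem N w A e (Zero i f) \<longleftrightarrow> e i = 0"
  by (auto simp: Zero_def)

lemma sem_Succ [simp]:
  assumes "e j < N" "f \<noteq> i" "f \<noteq> j"
  shows "sem N w A e (Succ i j f) \<longleftrightarrow> e j = Suc (e i)"
proof
  assume "sem N w A e (Succ i j f)"
  then have 1: "e i < e j" and 2: "\<not> (\<exists>x<N. e i < x \<and> x < e j)" using assms by (auto simp: Succ_def)
  show "e j = Suc (e i)"
  proof (rule ccontr)
    assume "e j \<noteq> Suc (e i)"
    then have "Suc (e i) < e j" using 1 by simp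
    then show False using 2 assms(1) by (meson lessI less_trans)
  qed
qed (use assms in \<open>auto simp: Succ_def\<close>)

lemma syntax_connectives [simp]:
  "fv (Disj \<phi> \<psi>) = fv \<phi> \<union> fv \<psi>" "fv (Impl \<phi> \<psi>) = fv \<phi> \<union> fv \<psi>" "fv (Equiv \<phi> \<psi>) = fv \<phi> \<union> fv \<psi>"
  "fv (Forall v \<phi>) = fv \<phi> - {v}" "fv (Equal i j) = {i, j}" "fv (Zero i f) = {i} - {f}"
    "fv (Succ i j f) = {i, j} \<union> ({i, j} - {f})"
  "rels (Disj \<phi> \<psi>) = rels \<phi> \<union> rels \<psi>" "rels (Impl \<phi> \<psi>) = rels \<phi> \<union> rels \<psi>" "rels (Equiv \<phi> \<psi>) = rels \<phi> \<union> rels \<psi>"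
  "rels (Forall v \<phi>) = rels \<phi>" "rels (Equal i j) = {}" "rels (Zero i f) = {}" "rels (Succ i j f) = {}"
  "wf_fm X (Disj \<phi> \<psi>) \<longleftrightarrow> wf_fm X \<phi> \<and> wf_fm X \<psi>" "wf_fm X (Impl \<phi> \<psi>) \<longleftrightarrow> wf_fm X \<phi> \<and> wf_fm X \<psi>"
  "wf_fm X (Equiv \<phi> \<psi>) \<longleftrightarrow> wf_fm X \<phi> \<and> wf_fm X \<psi>" "wf_fm X (Forall v \<phi>) \<longleftrightarrow> v \<notin> X \<and> wf_fm (insert v X) \<phi>"
  "wf_fm X (Equal i j)" "wf_fm X (Zero i f) \<longleftrightarrow> f \<notin> X" "wf_fm X (Succ i j f) \<longleftrightarrow> f \<notin> X"
  by (auto simp: Disj_def Impl_def Equiv_def Forall_def Equal_def Zero_def Succ_def)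

lemma rel_exec_Def:
  assumes "a < N" "b < N" "c < N"
  shows "rel N (exec N w (Def j \<phi>) A) j a b c \<longleftrightarrow> sem N w A (args a b c) \<phi>"
proof -
  have "((a * N + b) * N + c) div N = a * N + b" using assms by simp
  moreover have "((a * N + b) * N + c) div N ^ 2 = a"
    using assms by (simp add: power2_eq_square div_mult2_eq)
  ultimately show ?thesis using cell_less[OF assms] assms by (simp add: rel_def)
qed

text \<open>Relation \<open>0\<close> is the buffer for the next value of an iterated relation.\<close>

definition update :: "nat \<Rightarrow> fm \<Rightarrow> cmd" where
  "update j \<phi> = Def 0 \<phi> \<then> Def j (Rel 0 3 4 5)"

lemma args_simps [simp]: "args a b c 3 = a" "args a b c 4 = b" "args a b c 5 = c"
  by (simp_all add: args_def)

lemma args_less: "a < N \<Longrightarrow> b < N \<Longrightarrow> c < N \<Longrightarrow> args a b c i < N"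
  by (auto simp: args_def)

section \<open>Meaning of iterated definitions\<close>

definition holds :: "nat \<Rightarrow> (nat \<Rightarrow> nat \<Rightarrow> bool) \<Rightarrow> nat \<Rightarrow> (nat \<Rightarrow> nat \<Rightarrow> nat \<Rightarrow> bool) \<Rightarrow> bool" where
  "holds N A j P \<longleftrightarrow> (\<forall>a<N. \<forall>b<N. \<forall>c<N. rel N A j a b c \<longleftrightarrow> P a b c)"

lemma holdsD: "holds N A j P \<Longrightarrow> a < N \<Longrightarrow> b < N \<Longrightarrow> c < N \<Longrightarrow> rel N A j a b c \<longleftrightarrow> P a b c"
  by (simp add: holds_def)

lemma holds_cong: "A j = B j \<Longrightarrow> holds N A j P \<longleftrightarrow> holds N B j P"
  by (simp add: holds_def rel_def)

lemma holds_Def: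
  assumes "\<And>a b c. a < N \<Longrightarrow> b < N \<Longrightarrow> c < N \<Longrightarrow> sem N w A (args a b c) \<phi> \<longleftrightarrow> P a b c"
  shows "holds N (exec N w (Def j \<phi>) A) j P"
  using assms by (simp add: holds_def rel_exec_Def del: exec.simps)

lemma holds_update:
  assumes "\<And>a b c. a < N \<Longrightarrow> b < N \<Longrightarrow> c < N \<Longrightarrow> sem N w A (args a b c) \<phi> \<longleftrightarrow> P a b c" and "j \<noteq> 0"
  shows "holds N (exec N w (update j \<phi>) A) j P" and "i \<noteq> 0 \<Longrightarrow> i \<noteq> j \<Longrightarrow> exec N w (update j \<phi>) A i = A i"
proof -
  let ?B = "exec N w (Def 0 \<phi>) A"
  have eq: "exec N w (update j \<phi>) A = exec N w (Def j (Rel 0 3 4 5)) ?B" by (simp add: update_def)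
  show "holds N (exec N w (update j \<phi>) A) j P"
    unfolding eq
  proof (rule holds_Def)
    fix a b c assume "a < N" "b < N" "c < N"
    then show "sem N w ?B (args a b c) (Rel 0 3 4 5) \<longleftrightarrow> P a b c"
      using rel_exec_Def[of a N b c w 0 \<phi> A] assms(1) by simp
  qed
  show "i \<noteq> 0 \<Longrightarrow> i \<noteq> j \<Longrightarrow> exec N w (update j \<phi>) A i = A i"
    unfolding eq by simp
qed

text \<open>\<open>P t\<close> is the intended relation at stage \<open>t\<close>. The step has to
  be checked only for \<open>B\<close> that agree with \<open>A\<close> outside the relations
  \<open>0\<close> and \<open>j\<close>, as the loop changes nothing else.\<close>

lemma iterate_update:
  assumes j: "j \<noteq> 0" and init: "holds N A j (P 0)"
    and step: "\<And>B t. (\<And>i. i \<noteq> 0 \<Longrightarrow> i \<noteq> j \<Longrightarrow> B i = A i) \<Longrightarrow> holds N B j (P t) \<Longrightarrow>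
      (\<And>a b c. a < N \<Longrightarrow> b < N \<Longrightarrow> c < N \<Longrightarrow> sem N w B (args a b c) \<phi> \<longleftrightarrow> P (Suc t) a b c)"
  shows "holds N (exec N w (Loop v (update j \<phi>)) A) j (P N)"
    and "i \<noteq> 0 \<Longrightarrow> i \<noteq> j \<Longrightarrow> exec N w (Loop v (update j \<phi>)) A i = A i"
proof -
  let ?B = "\<lambda>t. (exec N w (update j \<phi>) ^^ t) A"
  have *: "holds N (?B t) j (P t) \<and> (\<forall>i. i \<noteq> 0 \<longrightarrow> i \<noteq> j \<longrightarrow> ?B t i = A i)" for t
  proof (induction t)
    case 0
    then show ?case using init by simp
  next
    case (Suc t)
    then have s: "\<And>a b c. a < N \<Longrightarrow> b < N \<Longrightarrow> c < N \<Longrightarrow> sem N w (?B t) (args a b c) \<phi> \<longleftrightarrow> P (Suc t) a b c"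
      by (intro step) auto
    show ?case using holds_update[OF s j] Suc by simp
  qed
  show "holds N (exec N w (Loop v (update j \<phi>)) A) j (P N)" using *[of N] by simp
  show "i \<noteq> 0 \<Longrightarrow> i \<noteq> j \<Longrightarrow> exec N w (Loop v (update j \<phi>)) A i = A i" using *[of N] by simp
qed

text \<open>Recursion on the first summand, \<open>Suc x + b = Suc (x + b)\<close>: stage
  \<open>t\<close> knows the sums whose first summand is below \<open>t\<close>.\<close>

definition plus_fm :: fm where
  "plus_fm = Disj (And (Zero 3 6) (Equal 4 5)) (Ex 6
    (Ex 7 (And (Succ 6 3 8) (And (Succ 7 5 8) (Rel 1 6 4 7)))))"

text \<open>Recursion on the first factor, \<open>Suc x * b = x * b + b\<close>, by means of the
  finished addition table.\<close>

definition times_fm :: fm where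
  "times_fm = Disj (And (Zero 3 6) (Zero 5 6)) (Ex 6
    (Ex 7 (And (Succ 6 3 8) (And (Rel 2 6 4 7) (Rel 1 7 4 5)))))"

text \<open>Relation \<open>3\<close> holds for \<open>a\<close>, \<open>i\<close> if the bit number \<open>i\<close> of \<open>a\<close> is set.\<close>

definition bit_fm :: fm where
  "bit_fm = Disj (And (Zero 4 6) (Ex 6 (Ex 7 (And (Rel 1 6 6 7) (Succ 7 3 8)))))
     (Ex 6 (Ex 7 (And (Succ 6 4 8) (And (Ex 8 (And (Rel 1 7 7 8) (Disj (Equal 8 3) (Succ 8 3 9))))
       (Rel 3 7 6 5)))))"

definition arith_cmd :: cmd where
  "arith_cmd = Loop 100 (update 1 plus_fm) \<then> Loop 100 (update 2 times_fm) \<then> Loop 100 (update 3 bit_fm)"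

definition arith :: "nat \<Rightarrow> (nat \<Rightarrow> nat \<Rightarrow> bool) \<Rightarrow> bool" where
  "arith N A \<longleftrightarrow> holds N A 1 (\<lambda>a b c. a + b = c) \<and> holds N A 2 (\<lambda>a b c. a * b = c) \<and>
     holds N A 3 (\<lambda>a i _. i \<in> set_decode a)"

lemma plus_step:
  assumes "holds N B 1 (\<lambda>a b c. a < t \<and> a + b = c)" "a < N" "b < N" "c < N"
  shows "sem N w B (args a b c) plus_fm \<longleftrightarrow> a < Suc t \<and> a + b = c"
proof -
  have "sem N w B (args a b c) plus_fm \<longleftrightarrow> a = 0 \<and> b = c \<or>
      (\<exists>x<N. \<exists>y<N. a = Suc x \<and> c = Suc y \<and> x < t \<and> x + b = y)"
    using assms(2-4) holdsD[OF assms(1)] by (simp add: plus_fm_def cong: conj_cong)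
  also have "\<dots> \<longleftrightarrow> a < Suc t \<and> a + b = c" using assms(2-4) by (cases a) auto
  finally show ?thesis .
qed

lemma times_step:
  assumes "holds N B 2 (\<lambda>a b c. a < t \<and> a * b = c)" "holds N B 1 (\<lambda>a b c. a + b = c)" "a < N" "b < N" "c < N"
  shows "sem N w B (args a b c) times_fm \<longleftrightarrow> a < Suc t \<and> a * b = c"
proof -
  have "sem N w B (args a b c) times_fm \<longleftrightarrow> a = 0 \<and> c = 0 \<or>
      (\<exists>x<N. \<exists>y<N. a = Suc x \<and> (x < t \<and> x * b = y) \<and> y + b = c)"
    using assms(3-5) holdsD[OF assms(1)] holdsD[OF assms(2)] by (simp add: times_fm_def cong: conj_cong)
  also have "\<dots> \<longleftrightarrow> a < Suc t \<and> a * b = c" using assms(3-5) by (cases a) auto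
  finally show ?thesis .
qed

text \<open>Bit \<open>0\<close> is oddness, and bit \<open>Suc x\<close> of \<open>a\<close> is bit
  \<open>x\<close> of \<open>a div 2\<close>; the formula names this half \<open>y\<close> by
  \<open>a = y + y\<close> or \<open>a = Suc (y + y)\<close>.\<close>

lemma bit_step:
  assumes "holds N B 3 (\<lambda>a i _. i < t \<and> i \<in> set_decode a)" "holds N B 1 (\<lambda>a b c. a + b = c)" "a < N" "i < N"
    "c < N"
  shows "sem N w B (args a i c) bit_fm \<longleftrightarrow> i < Suc t \<and> i \<in> set_decode a"
proof -
  have "sem N w B (args a i c) bit_fm \<longleftrightarrow> i = 0 \<and> (\<exists>x<N. \<exists>y<N. x + x = y \<and> a = Suc y) \<or>
      (\<exists>x<N. \<exists>y<N. i = Suc x \<and> (\<exists>z<N. y + y = z \<and> (z = a \<or> a = Suc z)) \<and> x < t \<and> x \<in> set_decode y)"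
    using assms(3-5) holdsD[OF assms(1)] holdsD[OF assms(2)] by (simp add: bit_fm_def cong: conj_cong)
  also have "\<dots> \<longleftrightarrow> i < Suc t \<and> i \<in> set_decode a"
  proof (cases i)
    case 0
    have "(\<exists>x<N. \<exists>y<N. x + x = y \<and> a = Suc y) \<longleftrightarrow> odd a"
    proof
      assume "odd a"
      then obtain x where "a = Suc (x + x)" by (auto elim!: oddE simp: mult_2)
      then show "\<exists>x<N. \<exists>y<N. x + x = y \<and> a = Suc y"
        using assms(3) by (intro exI[of _ x]) auto
    qed auto
    then show ?thesis using 0 by simp
  next
    case (Suc x)
    have y: "(\<exists>z<N. y + y = z \<and> (z = a \<or> a = Suc z)) \<longleftrightarrow> y = a div 2" for y
    proof -
      have "(\<exists>z<N. y + y = z \<and> (z = a \<or> a = Suc z)) \<longleftrightarrow> y + y < N \<and> (y + y = a \<or> a = Suc (y + y))" by blast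
      also have "\<dots> \<longleftrightarrow> y = a div 2"
      proof
        assume "y = a div 2"
        then have "a = y + y \<or> a = Suc (y + y)" by presburger
        then show "y + y < N \<and> (y + y = a \<or> a = Suc (y + y))" using assms(3) by auto
      qed auto
      finally show ?thesis .
    qed
    have "a div 2 < N" "x < N" using assms(3,4) Suc by simp_all
    then have "(\<exists>x'<N. \<exists>y<N. i = Suc x' \<and> y = a div 2 \<and> x' < t \<and> x' \<in> set_decode y) \<longleftrightarrow>
        x < t \<and> x \<in> set_decode (a div 2)"
      unfolding Suc by blast
    then show ?thesis unfolding y by (simp add: Suc)
  qed
  finally show ?thesis .
qed

text \<open>Because \<open>2 ^ i \<le> a\<close>. So quantifiers over the universe reach all
  elements of a set whose number lies in the universe.\<close>

lemma set_decode_less: "i \<in> set_decode a \<Longrightarrow> i < a"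
proof -
  assume i: "i \<in> set_decode a"
  then have "a div 2 ^ i \<noteq> 0" by (metis even_zero set_decode_def mem_Collect_eq)
  then have "2 ^ i \<le> a" by (meson div_less not_le)
  then show "i < a" by (meson less_exp less_le_trans)
qed

lemma arith_cmd:
  assumes "\<And>j. j \<noteq> 0 \<Longrightarrow> A j = (\<lambda>_. False)"
  shows "arith N (exec N w arith_cmd A)"
    and "i \<notin> {0, 1, 2, 3} \<Longrightarrow> exec N w arith_cmd A i = A i"
proof -
  have init: "holds N A j (\<lambda>_ _ _. False)" if "j \<noteq> 0" for j using assms[OF that]
    by (simp add: holds_def rel_def)
  let ?P = "\<lambda>t a b c. a < t \<and> a + b = c" and ?Q = "\<lambda>t a b c. a < t \<and> a * b = c"
    and ?R = "\<lambda>t a i c. i < t \<and> i \<in> set_decode a" 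
  define B where "B = exec N w (Loop 100 (update 1 plus_fm)) A"
  define C where "C = exec N w (Loop 100 (update 2 times_fm)) B"
  define D where "D = exec N w (Loop 100 (update 3 bit_fm)) C"
  have B1: "holds N B 1 (?P N)"
    unfolding B_def by (rule iterate_update(1)[where P = ?P]) (use init[of 1] plus_step in auto)
  have B: "i \<noteq> 0 \<Longrightarrow> i \<noteq> 1 \<Longrightarrow> B i = A i" for i
    unfolding B_def by (rule iterate_update(2)[where P = ?P]) (use init[of 1] plus_step in auto)
  \<comment> \<open>At stage \<open>N\<close> the condition that the argument is below the stage
    holds throughout the universe.\<close>
  have B1: "holds N B 1 (\<lambda>a b c. a + b = c)" using B1 by (auto simp: holds_def)
  have B2: "holds N B 2 (?Q 0)" using init[of 2] holds_cong[of B 2 A] B[of 2] by simp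
  have sC: "sem N w X (args a b c) times_fm \<longleftrightarrow> ?Q (Suc t) a b c"
    if "\<And>i. i \<noteq> 0 \<Longrightarrow> i \<noteq> 2 \<Longrightarrow> X i = B i" "holds N X 2 (?Q t)" "a < N" "b < N" "c < N" for X t a b c
  proof -
    have "holds N X 1 (\<lambda>a b c. a + b = c)" using B1 holds_cong[of X 1 B] that(1)[of 1] by simp
    then show ?thesis using times_step[OF that(2)] that(3-5) by simp
  qed
  have C2: "holds N C 2 (?Q N)"
    unfolding C_def by (rule iterate_update(1)[where P = ?Q]) (use B2 sC in auto)
  have C: "i \<noteq> 0 \<Longrightarrow> i \<noteq> 2 \<Longrightarrow> C i = B i" for i
    unfolding C_def by (rule iterate_update(2)[where P = ?Q]) (use B2 sC in auto)
  have C1: "holds N C 1 (\<lambda>a b c. a + b = c)" using B1 holds_cong[of C 1 B] C[of 1] by simp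
  have C2: "holds N C 2 (\<lambda>a b c. a * b = c)" using C2 by (auto simp: holds_def)
  have C3: "holds N C 3 (?R 0)" using init[of 3] holds_cong[of C 3 A] B[of 3] C[of 3] by simp
  have sD: "sem N w X (args a b c) bit_fm \<longleftrightarrow> ?R (Suc t) a b c"
    if "\<And>i. i \<noteq> 0 \<Longrightarrow> i \<noteq> 3 \<Longrightarrow> X i = C i" "holds N X 3 (?R t)" "a < N" "b < N" "c < N" for X t a b c
  proof -
    have "holds N X 1 (\<lambda>a b c. a + b = c)" using C1 holds_cong[of X 1 C] that(1)[of 1] by simp
    then show ?thesis using bit_step[OF that(2)] that(3-5) by simp
  qed
  have D3: "holds N D 3 (?R N)"
    unfolding D_def by (rule iterate_update(1)[where P = ?R]) (use C3 sD in auto)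
  have D: "i \<noteq> 0 \<Longrightarrow> i \<noteq> 3 \<Longrightarrow> D i = C i" for i
    unfolding D_def by (rule iterate_update(2)[where P = ?R]) (use C3 sD in auto)
  have D3: "holds N D 3 (\<lambda>a i _. i \<in> set_decode a)" using D3 by (auto simp: holds_def)
  have eq: "exec N w arith_cmd A = D" by (simp only: arith_cmd_def exec.simps(2) B_def C_def D_def)
  show "arith N (exec N w arith_cmd A)"
    unfolding eq arith_def using C1 C2 D3 holds_cong[of D 1 C] holds_cong[of D 2 C] D[of 1] D[of 2] by simp
  show "i \<notin> {0, 1, 2, 3} \<Longrightarrow> exec N w arith_cmd A i = A i"
    unfolding eq using B C D by simp
qed

subsection \<open>Terms\<close>

datatype tm = V nat | One | Plus tm tm | Times tm tm

primrec tval :: "(nat \<Rightarrow> nat) \<Rightarrow> tm \<Rightarrow> nat" where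
  "tval e (V i) = e i"
| "tval e One = 1"
| "tval e (Plus s t) = tval e s + tval e t"
| "tval e (Times s t) = tval e s * tval e t"

primrec tvars :: "tm \<Rightarrow> nat set" where
  "tvars (V i) = {i}"
| "tvars One = {}"
| "tvars (Plus s t) = tvars s \<union> tvars t"
| "tvars (Times s t) = tvars s \<union> tvars t"

text \<open>A product with a factor \<open>0\<close> may be small although the other factor is outside the universe.\<close>

primrec factors_less :: "nat \<Rightarrow> (nat \<Rightarrow> nat) \<Rightarrow> tm \<Rightarrow> bool" where
  "factors_less N e (V i) \<longleftrightarrow> True"
| "factors_less N e One \<longleftrightarrow> True"
| "factors_less N e (Plus s t) \<longleftrightarrow> factors_less N e s \<and> factors_less N e t"
| "factors_less N e (Times s t) \<longleftrightarrow> factors_less N e s \<and> factors_less N e t \<and> tval e s < N \<and> tval e t < N"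

text \<open>The variables from \<open>f\<close> on are fresh. Each level takes two of them for the
  values of its subterms, which must therefore lie in the universe.\<close>

primrec value_fm :: "tm \<Rightarrow> nat \<Rightarrow> nat \<Rightarrow> fm" where
  "value_fm (V i) v f = Equal i v"
| "value_fm One v f = Ex f (And (Zero f (f + 1)) (Succ f v (f + 1)))"
| "value_fm (Plus s t) v f = Ex f (Ex (f + 1) (And (value_fm s f (f + 2))
  (And (value_fm t (f + 1) (f + 2)) (Rel 1 f (f + 1) v))))"
| "value_fm (Times s t) v f = Ex f (Ex (f + 1) (And (value_fm s f (f + 2))
  (And (value_fm t (f + 1) (f + 2)) (Rel 2 f (f + 1) v))))"

lemma tval_cong: "(\<And>i. i \<in> tvars t \<Longrightarrow> e i = e' i) \<Longrightarrow> tval e t = tval e' t"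
  by (induction t) auto

lemma factors_less_cong: "(\<And>i. i \<in> tvars t \<Longrightarrow> e i = e' i) \<Longrightarrow> factors_less N e t = factors_less N e' t"
proof (induction t)
  case (Times s t)
  have "tval e s = tval e' s" by (rule tval_cong) (use Times.prems in simp)
  moreover have "tval e t = tval e' t" by (rule tval_cong) (use Times.prems in simp)
  moreover have "factors_less N e s = factors_less N e' s" by (rule Times.IH(1)) (use Times.prems in simp)
  moreover have "factors_less N e t = factors_less N e' t" by (rule Times.IH(2)) (use Times.prems in simp)
  ultimately show ?case by simp
next
  case (Plus s t)
  have "factors_less N e s = factors_less N e' s" by (rule Plus.IH(1)) (use Plus.prems in simp)
  moreover have "factors_less N e t = factors_less N e' t" by (rule Plus.IH(2)) (use Plus.prems in simp)
  ultimately show ?case by simp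
qed simp_all

lemma tval_upd [simp]: "v \<notin> tvars t \<Longrightarrow> tval (e(v := x)) t = tval e t"
  by (rule tval_cong) auto

lemma factors_less_upd [simp]: "v \<notin> tvars t \<Longrightarrow> factors_less N (e(v := x)) t = factors_less N e t"
  by (rule factors_less_cong) auto

lemma fresh_index:
  assumes "\<forall>i\<in>S. i < (f :: nat)"
  shows "f \<notin> S" "f + 1 \<notin> S" "Suc f \<notin> S" "\<forall>i\<in>S. i < f + 2"
proof -
  show "f \<notin> S" using assms by blast
  show *: "Suc f \<notin> S" using assms by (metis Suc_lessD less_irrefl)
  then show "f + 1 \<notin> S" by simp
  show "\<forall>i\<in>S. i < f + 2" using assms by (simp add: less_SucI)
qed

text \<open>A sum inside the universe has its summands there as well; for products
  \<open>factors_less\<close> supplies the witnesses.\<close>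

lemma sem_value_fm:
  assumes "arith N A" "\<And>i. e i < N" "factors_less N e t" "\<forall>i\<in>tvars t. i < f" "v < f"
  shows "sem N w A e (value_fm t v f) \<longleftrightarrow> tval e t = e v"
  using assms
proof (induction t arbitrary: e v f)
  case (V i)
  then show ?case by auto
next
  case One
  have "sem N w A e (value_fm One v f) \<longleftrightarrow> (\<exists>x<N. x = 0 \<and> e v = Suc x)"
    using One by (simp cong: conj_cong)
  also have "\<dots> \<longleftrightarrow> tval e One = e v" using One.prems(2)[of v] by auto
  finally show ?case .
next
  case (Plus s t)
  have fresh: "f \<notin> tvars s" "f \<notin> tvars t" "Suc f \<notin> tvars s" "Suc f \<notin> tvars t" "v \<noteq> f" "v \<noteq> Suc f"
    and vars: "\<forall>i\<in>tvars s. i < f + 2" "\<forall>i\<in>tvars t. i < f + 2"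
    using fresh_index[of "tvars s" f] fresh_index[of "tvars t" f] Plus.prems(4,5) by simp_all
  have plus: "rel N A 1 x y z \<longleftrightarrow> x + y = z" if "x < N" "y < N" "z < N" for x y z
    using Plus.prems(1) that by (simp add: arith_def holds_def)
  have "sem N w A (e(f := x, f + 1 := y)) (value_fm s f (f + 2)) \<longleftrightarrow> tval e s = x" if "x < N" "y < N" for x y
  proof -
    let ?e = "e(f := x, f + 1 := y)"
    have "sem N w A ?e (value_fm s (f) (f + 2)) \<longleftrightarrow> tval ?e s = ?e (f)"
    proof (rule Plus.IH(1))
      show "arith N A" by (rule Plus.prems(1))
      show "?e i < N" for i using that Plus.prems(2) by simp
      show "factors_less N ?e s" using fresh Plus.prems(3) by simp
    qed (use vars in simp_all)
    then show ?thesis using fresh by simp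
  qed
  moreover have "sem N w A (e(f := x, f + 1 := y)) (value_fm t (f + 1) (f + 2)) \<longleftrightarrow> tval e t = y"
    if "x < N" "y < N" for x y
  proof -
    let ?e = "e(f := x, f + 1 := y)"
    have "sem N w A ?e (value_fm t (f + 1) (f + 2)) \<longleftrightarrow> tval ?e t = ?e (f + 1)"
    proof (rule Plus.IH(2))
      show "arith N A" by (rule Plus.prems(1))
      show "?e i < N" for i using that Plus.prems(2) by simp
      show "factors_less N ?e t" using fresh Plus.prems(3) by simp
    qed (use vars in simp_all)
    then show ?thesis using fresh by simp
  qed
  ultimately have "sem N w A e (value_fm (Plus s t) v f) \<longleftrightarrow>
    (\<exists>x<N. \<exists>y<N. tval e s = x \<and> tval e t = y \<and> x + y = e v)"
    using plus fresh Plus.prems(2)[of v] by (simp cong: conj_cong)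
  also have "\<dots> \<longleftrightarrow> tval e (Plus s t) = e v" using Plus.prems(2)[of v] by auto
  finally show ?case .
next
  case (Times s t)
  have fresh: "f \<notin> tvars s" "f \<notin> tvars t" "Suc f \<notin> tvars s" "Suc f \<notin> tvars t" "v \<noteq> f" "v \<noteq> Suc f"
    and vars: "\<forall>i\<in>tvars s. i < f + 2" "\<forall>i\<in>tvars t. i < f + 2"
    using fresh_index[of "tvars s" f] fresh_index[of "tvars t" f] Times.prems(4,5) by simp_all
  have times: "rel N A 2 x y z \<longleftrightarrow> x * y = z" if "x < N" "y < N" "z < N" for x y z
    using Times.prems(1) that by (simp add: arith_def holds_def)
  have "sem N w A (e(f := x, f + 1 := y)) (value_fm s f (f + 2)) \<longleftrightarrow> tval e s = x" if "x < N" "y < N" for x y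
  proof -
    let ?e = "e(f := x, f + 1 := y)"
    have "sem N w A ?e (value_fm s (f) (f + 2)) \<longleftrightarrow> tval ?e s = ?e (f)"
    proof (rule Times.IH(1))
      show "arith N A" by (rule Times.prems(1))
      show "?e i < N" for i using that Times.prems(2) by simp
      show "factors_less N ?e s" using fresh Times.prems(3) by simp
    qed (use vars in simp_all)
    then show ?thesis using fresh by simp
  qed
  moreover have "sem N w A (e(f := x, f + 1 := y)) (value_fm t (f + 1) (f + 2)) \<longleftrightarrow> tval e t = y"
    if "x < N" "y < N" for x y
  proof -
    let ?e = "e(f := x, f + 1 := y)"
    have "sem N w A ?e (value_fm t (f + 1) (f + 2)) \<longleftrightarrow> tval ?e t = ?e (f + 1)"
    proof (rule Times.IH(2))
      show "arith N A" by (rule Times.prems(1))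
      show "?e i < N" for i using that Times.prems(2) by simp
      show "factors_less N ?e t" using fresh Times.prems(3) by simp
    qed (use vars in simp_all)
    then show ?thesis using fresh by simp
  qed
  ultimately have "sem N w A e (value_fm (Times s t) v f) \<longleftrightarrow>
    (\<exists>x<N. \<exists>y<N. tval e s = x \<and> tval e t = y \<and> x * y = e v)"
    using times fresh Times.prems(2)[of v] by (simp cong: conj_cong)
  also have "\<dots> \<longleftrightarrow> tval e (Times s t) = e v" using Times.prems(3) by auto
  finally show ?case .
qed

lemma range_shift: "\<forall>i\<in>S. 2 < i \<and> i < f \<Longrightarrow> \<forall>i\<in>S. 2 < i \<and> i < Suc (Suc f)"
  by (simp add: less_SucI)

lemma range_notin:
  assumes "\<forall>i\<in>S. 2 < i \<and> i < f"
  shows "0 \<notin> S \<and> Suc 0 \<notin> S \<and> 2 \<notin> S \<and> f \<notin> S \<and> Suc f \<notin> S"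
proof -
  have "x \<notin> S" if "\<not> (2 < x \<and> x < f)" for x using assms that by blast
  then show ?thesis by simp
qed

lemma value_fm_syntax:
  "rels (value_fm t v f) \<subseteq> {1, 2}"
  "\<forall>i\<in>tvars t. i < f \<Longrightarrow> v < f \<Longrightarrow> fv (value_fm t v f) \<subseteq> insert v (tvars t)"
  "\<forall>i\<in>insert v (tvars t \<union> X). 2 < i \<and> i < f \<Longrightarrow> wf_fm X (value_fm t v f)"
proof -
  show "rels (value_fm t v f) \<subseteq> {1, 2}"
    by (induction t arbitrary: v f) auto
  show "\<forall>i\<in>tvars t. i < f \<Longrightarrow> v < f \<Longrightarrow> fv (value_fm t v f) \<subseteq> insert v (tvars t)"
  proof (induction t arbitrary: v f)
    case (Plus s t)
    have "fv (value_fm s f (f + 2)) \<subseteq> insert f (tvars s)"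
      by (rule Plus.IH(1)) (use fresh_index(4)[of "tvars s" f] Plus.prems(1) in simp_all)
    moreover have "fv (value_fm t (f + 1) (f + 2)) \<subseteq> insert (f + 1) (tvars t)"
      by (rule Plus.IH(2)) (use fresh_index(4)[of "tvars t" f] Plus.prems(1) in simp_all)
    ultimately show ?case by auto
  next
    case (Times s t)
    have "fv (value_fm s f (f + 2)) \<subseteq> insert f (tvars s)"
      by (rule Times.IH(1)) (use fresh_index(4)[of "tvars s" f] Times.prems(1) in simp_all)
    moreover have "fv (value_fm t (f + 1) (f + 2)) \<subseteq> insert (f + 1) (tvars t)"
      by (rule Times.IH(2)) (use fresh_index(4)[of "tvars t" f] Times.prems(1) in simp_all)
    ultimately show ?case by auto
  qed auto
  show "\<forall>i\<in>insert v (tvars t \<union> X). 2 < i \<and> i < f \<Longrightarrow> wf_fm X (value_fm t v f)"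
  proof (induction t arbitrary: v f X)
    case (Plus s t)
    have "wf_fm (insert (f + 1) (insert f X)) (value_fm s f (f + 2))"
      by (rule Plus.IH(1)) (use range_shift[of "tvars s" f] range_shift[of X f] Plus.prems in auto)
    moreover have "wf_fm (insert (f + 1) (insert f X)) (value_fm t (f + 1) (f + 2))"
      by (rule Plus.IH(2)) (use range_shift[of "tvars t" f] range_shift[of X f] Plus.prems in auto)
    ultimately show ?case using Plus.prems range_notin[of X f] by auto
  next
    case (Times s t)
    have "wf_fm (insert (f + 1) (insert f X)) (value_fm s f (f + 2))"
      by (rule Times.IH(1)) (use range_shift[of "tvars s" f] range_shift[of X f] Times.prems in auto)
    moreover have "wf_fm (insert (f + 1) (insert f X)) (value_fm t (f + 1) (f + 2))"
      by (rule Times.IH(2)) (use range_shift[of "tvars t" f] range_shift[of X f] Times.prems in auto)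
    ultimately show ?case using Times.prems range_notin[of X f] by auto
  qed auto
qed

text \<open>If the value of the term is not below \<open>N\<close> there is no witness, in agreement
  with \<open>reads\<close> as soon as \<open>w\<close> is shorter than \<open>N\<close>.\<close>

definition read_fm :: "bool \<Rightarrow> tm \<Rightarrow> nat \<Rightarrow> fm" where
  "read_fm b t f = Ex f (And (value_fm t f (f + 1)) (Input b f))"

lemma sem_read_fm:
  assumes "arith N A" "\<And>i. e i < N" "factors_less N e t" "\<forall>i\<in>tvars t. i < f" "length w < N"
  shows "sem N w A e (read_fm b t f) \<longleftrightarrow> reads w b (tval e t)"
proof -
  have f: "f \<notin> tvars t" using assms(4) by blast
  have "sem N w A (e(f := x)) (value_fm t f (f + 1)) \<longleftrightarrow> tval e t = x" if "x < N" for x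
  proof -
    have "sem N w A (e(f := x)) (value_fm t f (f + 1)) \<longleftrightarrow> tval (e(f := x)) t = (e(f := x)) f"
      by (rule sem_value_fm) (use assms f that in \<open>simp_all add: less_SucI\<close>)
    then show ?thesis using f by simp
  qed
  then have "sem N w A e (read_fm b t f) \<longleftrightarrow> (\<exists>x<N. tval e t = x \<and> reads w b x)"
    by (simp add: read_fm_def reads_def cong: conj_cong)
  also have "\<dots> \<longleftrightarrow> reads w b (tval e t)" using assms(5) by (auto simp: reads_def)
  finally show ?thesis .
qed

lemma read_fm_syntax:
  "rels (read_fm b t f) \<subseteq> {1, 2}"
  "\<forall>i\<in>tvars t. i < f \<Longrightarrow> fv (read_fm b t f) \<subseteq> tvars t"
  "\<forall>i\<in>tvars t \<union> X. 2 < i \<and> i < f \<Longrightarrow> 2 < f \<Longrightarrow> wf_fm X (read_fm b t f)"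
proof -
  show "rels (read_fm b t f) \<subseteq> {1, 2}" using value_fm_syntax(1) by (simp add: read_fm_def)
  show "fv (read_fm b t f) \<subseteq> tvars t" if "\<forall>i\<in>tvars t. i < f"
  proof -
    have "\<forall>i\<in>tvars t. i < f + 1" using that by (simp add: less_SucI)
    then have "fv (value_fm t f (f + 1)) \<subseteq> insert f (tvars t)" by (rule value_fm_syntax(2)) simp
    then show ?thesis by (auto simp: read_fm_def)
  qed
  show "wf_fm X (read_fm b t f)" if "\<forall>i\<in>tvars t \<union> X. 2 < i \<and> i < f" "2 < f"
  proof -
    have "\<forall>i\<in>insert f (tvars t \<union> insert f X). 2 < i \<and> i < f + 1" using that by (simp add: ball_Un less_SucI)
    then have "wf_fm (insert f X) (value_fm t f (f + 1))" by (rule value_fm_syntax(3))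
    moreover have "f \<notin> X" using that by blast
    ultimately show ?thesis by (simp add: read_fm_def)
  qed
qed

subsection \<open>Reading the tables of a code\<close>

definition base_tm :: "nat \<Rightarrow> nat \<Rightarrow> nat \<Rightarrow> tm" where
  "base_tm n m k = Plus (Plus (Plus (V n) (V m)) (V k)) (Plus One (Plus One One))"

definition initial_tm :: "nat \<Rightarrow> nat \<Rightarrow> nat \<Rightarrow> nat \<Rightarrow> tm" where
  "initial_tm n m k q = Plus (base_tm n m k) (V q)"

definition trans_tm :: "nat \<Rightarrow> nat \<Rightarrow> nat \<Rightarrow> nat \<Rightarrow> nat \<Rightarrow> nat \<Rightarrow> tm" where
  "trans_tm n m k q \<sigma> q' = Plus (Plus (base_tm n m k) (V n))
     (Plus (Times (Plus (Times (V q) (V m)) (V \<sigma>)) (V n)) (V q'))"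

definition tables_tm :: "nat \<Rightarrow> nat \<Rightarrow> nat \<Rightarrow> tm" where
  "tables_tm n m k = Plus (Plus (base_tm n m k) (V n)) (Times (Times (V n) (V m)) (V n))"

definition gamma_tm :: "nat \<Rightarrow> nat \<Rightarrow> nat \<Rightarrow> nat \<Rightarrow> nat \<Rightarrow> tm" where
  "gamma_tm n m k b q = Plus (tables_tm n m k) (Plus (Times (V b) (V n)) (V q))"

definition target_tm :: "nat \<Rightarrow> nat \<Rightarrow> nat \<Rightarrow> nat \<Rightarrow> tm" where
  "target_tm n m k b = Plus (Plus (tables_tm n m k) (Times (V k) (V n))) (V b)"

definition start_tm :: "nat \<Rightarrow> nat \<Rightarrow> nat \<Rightarrow> nat \<Rightarrow> tm" where
  "start_tm n m k q = Plus (Plus (Plus (tables_tm n m k) (Times (V k) (V n))) (V k)) (V q)"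

lemmas position_tm_defs = base_tm_def initial_tm_def trans_tm_def tables_tm_def gamma_tm_def target_tm_def
  start_tm_def

lemma tval_positions [simp]:
  "tval e (initial_tm n m k q) = initial_pos (e n) (e m) (e k) (e q)"
  "tval e (trans_tm n m k q \<sigma> q') = trans_pos (e n) (e m) (e k) (e q) (e \<sigma>) (e q')"
  "tval e (gamma_tm n m k b q) = gamma_pos (e n) (e m) (e k) (e b) (e q)"
  "tval e (target_tm n m k b) = target_pos (e n) (e m) (e k) (e b)"
  "tval e (start_tm n m k q) = start_pos (e n) (e m) (e k) (e q)"
  by (simp_all add: position_tm_defs initial_pos_def trans_pos_def gamma_pos_def target_pos_def start_pos_def)

lemma tvars_positions [simp]:
  "tvars (initial_tm n m k q) = {n, m, k, q}"
  "tvars (trans_tm n m k q \<sigma> q') = {n, m, k, q, \<sigma>, q'}"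
  "tvars (gamma_tm n m k b q) = {n, m, k, b, q}"
  "tvars (target_tm n m k b) = {n, m, k, b}"
  "tvars (start_tm n m k q) = {n, m, k, q}"
  by (auto simp: position_tm_defs)

text \<open>The variables \<open>3\<close>, \<open>4\<close>, \<open>5\<close> are the candidate
  sizes; \<open>7\<close> and \<open>8\<close> name the positions where the second and third unary
  numbers end.\<close>

definition header_fm :: fm where
  "header_fm = And (Input False 3) (And (Forall 6 (Impl (Less 6 3) (Input True 6)))
     (Ex 7 (And (value_fm (Plus (Plus (V 3) One) (V 4)) 7 9) (And (Input False 7)
       (And (Forall 6 (Impl (And (Less 3 6) (Less 6 7)) (Input True 6)))
     (Ex 8 (And (value_fm (Plus (Plus (Plus (Plus (V 3) One) (V 4)) One) (V 5)) 8 9) (And (Input False 8)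
       (Forall 6 (Impl (And (Less 7 6) (Less 6 8)) (Input True 6)))))))))))"

lemma sem_header_fm:
  assumes A: "arith N A" and w: "length w < N" and abc: "a < N" "b < N" "c < N"
  shows "sem N w A (args a b c) header_fm \<longleftrightarrow> header w a b c"
proof -
  have all: "(\<forall>x<N. x < z \<longrightarrow> R x) \<longleftrightarrow> (\<forall>x<z. R x)" "(\<forall>x<N. y < x \<and> x < z \<longrightarrow> R x) \<longleftrightarrow> (\<forall>x. y < x \<and> x < z \<longrightarrow> R x)"
    if "z < N" for R and y z :: nat
    using that by (meson less_trans)+
  have v1: "sem N w A ((args a b c)(7 := x)) (value_fm (Plus (Plus (V 3) One) (V 4)) 7 9) \<longleftrightarrow> a + 1 + b = x"
    if "x < N" for x
    by (subst sem_value_fm[OF A]) (use abc that args_less[OF abc] in auto)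
  have v2: "sem N w A ((args a b c)(7 := x, 8 := y))
    (value_fm (Plus (Plus (Plus (Plus (V 3) One) (V 4)) One) (V 5)) 8 9) \<longleftrightarrow> a + 1 + b + 1 + c = y"
    if "x < N" "y < N" for x y
    by (subst sem_value_fm[OF A]) (use abc that args_less[OF abc] in auto)
  have "sem N w A (args a b c) header_fm \<longleftrightarrow>
     reads w False a \<and> (\<forall>x<N. x < a \<longrightarrow> reads w True x) \<and>
     (\<exists>y<N. a + 1 + b = y \<and> reads w False y \<and> (\<forall>x<N. a < x \<and> x < y \<longrightarrow> reads w True x) \<and>
     (\<exists>z<N. a + 1 + b + 1 + c = z \<and> reads w False z \<and> (\<forall>x<N. y < x \<and> x < z \<longrightarrow> reads w True x)))"
    using v1 v2 by (simp add: header_fm_def reads_def del: value_fm.simps cong: conj_cong)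
  also have "\<dots> \<longleftrightarrow> reads w False a \<and> (\<forall>x<N. x < a \<longrightarrow> reads w True x) \<and>
     a + 1 + b < N \<and> reads w False (a + 1 + b) \<and> (\<forall>x<N. a < x \<and> x < a + 1 + b \<longrightarrow> reads w True x) \<and>
     a + 1 + b + 1 + c < N \<and> reads w False (a + 1 + b + 1 + c) \<and>
     (\<forall>x<N. a + 1 + b < x \<and> x < a + 1 + b + 1 + c \<longrightarrow> reads w True x)"
    by blast
  also have "\<dots> \<longleftrightarrow> reads w False a \<and> (\<forall>x<a. reads w True x) \<and>
     a + 1 + b < N \<and> reads w False (a + 1 + b) \<and> (\<forall>x. a < x \<and> x < a + 1 + b \<longrightarrow> reads w True x) \<and>
     a + 1 + b + 1 + c < N \<and> reads w False (a + 1 + b + 1 + c) \<and>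
     (\<forall>x. a + 1 + b < x \<and> x < a + 1 + b + 1 + c \<longrightarrow> reads w True x)"
  proof (cases "a + 1 + b + 1 + c < N")
    case True
    then have "a + 1 + b < N" by simp
    then show ?thesis
      by (simp only: all(1)[OF abc(1)] all(2)[OF \<open>a + 1 + b < N\<close>] all(2)[OF True])
  next
    case False
    then show ?thesis by (simp only: simp_thms)
  qed
  also have "\<dots> \<longleftrightarrow> header w a b c"
  proof -
    \<comment> \<open>This absorbs the conditions that the intermediate sums lie in the
      universe.\<close>
    have "reads w False y \<Longrightarrow> y < N" for y using w by (simp add: reads_def)
    then show ?thesis unfolding header_def by blast
  qed
  finally show ?thesis .
qed

text \<open>A definition has only the free variables \<open>3\<close>, \<open>4\<close>,
  \<open>5\<close>. The sizes are therefore recovered through relation \<open>4\<close>, which has a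
  unique solution by \<open>header_unique\<close>.\<close>

definition with_dims :: "fm \<Rightarrow> fm" where
  "with_dims \<phi> = Ex 6 (Ex 7 (Ex 8 (And (Rel 4 6 7 8) \<phi>)))"

definition trans_fm :: fm where
  "trans_fm = with_dims (And (Less 3 6) (And (Less 4 7)
    (And (Less 5 6) (read_fm True (trans_tm 6 7 8 3 4 5) 9))))"

definition same_obs_fm :: fm where
  "same_obs_fm = with_dims (And (Less 3 6) (And (Less 4 6) (Ex 9 (And (Less 9 8)
     (And (read_fm True (gamma_tm 6 7 8 9 3) 10) (read_fm True (gamma_tm 6 7 8 9 4) 10))))))"

definition target_fm :: fm where
  "target_fm = with_dims (And (Less 3 6) (Ex 9 (And (Less 9 8)
     (And (read_fm True (gamma_tm 6 7 8 9 3) 10) (read_fm True (target_tm 6 7 8 9) 10)))))"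

definition length_fm :: fm where
  "length_fm = Ex 6 (And (value_fm (start_tm 3 4 5 3) 6 7)
     (Forall 7 (Equiv (Less 7 6) (Disj (Input True 7) (Input False 7)))))"

definition valid_fm :: fm where
  "valid_fm =
     And (Ex 6 (And (Less 6 3) (Forall 7 (Impl (Less 7 3)
       (Equiv (read_fm True (initial_tm 3 4 5 7) 8) (Equal 7 6))))))
    (And (Ex 6 (And (Less 6 3) (Forall 7 (Impl (Less 7 3)
      (Equiv (read_fm True (start_tm 3 4 5 7) 8) (Equal 7 6))))))
    (And (Forall 6 (Impl (Less 6 3) (Forall 7 (Impl (Less 7 4)
      (Ex 8 (And (Less 8 3) (read_fm True (trans_tm 3 4 5 6 7 8) 9)))))))
    (And (Forall 6 (Impl (Less 6 5) (Ex 7 (And (Less 7 3) (read_fm True (gamma_tm 3 4 5 6 7) 8)))))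
         (Forall 6 (Impl (Less 6 3) (Ex 7 (And (Less 7 5) (Forall 8 (Impl (Less 8 5)
            (Equiv (read_fm True (gamma_tm 3 4 5 8 6) 9) (Equal 8 7)))))))))))"

section \<open>Meaning of the formulas for the tables\<close>

locale header_word =
  fixes w :: "bool list" and n m k N :: nat and A :: "nat \<Rightarrow> nat \<Rightarrow> bool"
  assumes header: "header w n m k" and N: "N = 2 ^ length w" and arith: "arith N A"
begin

lemma length_less: "length w < N"
  unfolding N by simp

lemma dims_length: "n + 1 + m + 1 + k < length w"
  using header by (auto simp: header_def reads_def)

lemma dims_less: "n < N" "m < N" "k < N"
  using dims_length length_less by linarith+

text \<open>Supplies \<open>factors_less\<close> before the length of the word has been checked: the
  header alone has more than \<open>n + m\<close> bits, and
  \<open>n * m \<le> 2 ^ (n + m)\<close>.\<close>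

lemma product_less: "n * m < N"
proof -
  have "n * m \<le> 2 ^ n * 2 ^ m" by (intro mult_le_mono) (simp_all add: less_imp_le)
  also have "\<dots> = 2 ^ (n + m)" by (simp add: power_add)
  also have "\<dots> < 2 ^ length w" using dims_length by (intro power_strict_increasing) auto
  finally show ?thesis by (simp add: N)
qed

lemma pair_less: "q < n \<Longrightarrow> \<sigma> < m \<Longrightarrow> q * m + \<sigma> < N"
  using index_less[of q n \<sigma> m] product_less by simp

lemma read_positions:
  assumes e: "\<And>i. e i < N" "e x = n" "e y = m" "e z = k" and xyz: "x < f" "y < f" "z < f"
  shows "q < f \<Longrightarrow> sem N w A e (read_fm b (initial_tm x y z q) f) \<longleftrightarrow> reads w b (initial_pos n m k (e q))"
    and "q < f \<Longrightarrow> \<sigma> < f \<Longrightarrow> q' < f \<Longrightarrow> e q < n \<Longrightarrow> e \<sigma> < m \<Longrightarrow>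
      sem N w A e (read_fm b (trans_tm x y z q \<sigma> q') f) \<longleftrightarrow> reads w b (trans_pos n m k (e q) (e \<sigma>) (e q'))"
    and "o' < f \<Longrightarrow> q < f \<Longrightarrow> sem N w A e (read_fm b (gamma_tm x y z o' q) f) \<longleftrightarrow>
      reads w b (gamma_pos n m k (e o') (e q))"
    and "o' < f \<Longrightarrow> sem N w A e (read_fm b (target_tm x y z o') f) \<longleftrightarrow> reads w b (target_pos n m k (e o'))"
    and "q < f \<Longrightarrow> sem N w A e (read_fm b (start_tm x y z q) f) \<longleftrightarrow> reads w b (start_pos n m k (e q))"
proof -
  have R: "sem N w A e (read_fm b t f) \<longleftrightarrow> reads w b (tval e t)"
    if "factors_less N e t" "\<forall>i\<in>tvars t. i < f" for t
    by (rule sem_read_fm[OF arith e(1) that length_less])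
  show "sem N w A e (read_fm b (initial_tm x y z q) f) \<longleftrightarrow> reads w b (initial_pos n m k (e q))" if "q < f"
  proof -
    have "factors_less N e (initial_tm x y z q)" by (simp add: position_tm_defs)
    then show ?thesis using R[of "initial_tm x y z q"] that xyz e by simp
  qed
  show "sem N w A e (read_fm b (trans_tm x y z q \<sigma> q') f) \<longleftrightarrow> reads w b (trans_pos n m k (e q) (e \<sigma>) (e q'))"
    if "q < f" "\<sigma> < f" "q' < f" "e q < n" "e \<sigma> < m"
  proof -
    have "factors_less N e (trans_tm x y z q \<sigma> q')"
      using e dims_less pair_less[OF that(4,5)] by (simp add: position_tm_defs)
    then show ?thesis using R[of "trans_tm x y z q \<sigma> q'"] that xyz e by simp
  qed
  show "sem N w A e (read_fm b (gamma_tm x y z o' q) f) \<longleftrightarrow> reads w b (gamma_pos n m k (e o') (e q))"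
    if "o' < f" "q < f"
  proof -
    have "factors_less N e (gamma_tm x y z o' q)"
      using e dims_less product_less by (simp add: position_tm_defs)
    then show ?thesis using R[of "gamma_tm x y z o' q"] that xyz e by simp
  qed
  show "sem N w A e (read_fm b (target_tm x y z o') f) \<longleftrightarrow> reads w b (target_pos n m k (e o'))" if "o' < f"
  proof -
    have "factors_less N e (target_tm x y z o')"
      using e dims_less product_less by (simp add: position_tm_defs)
    then show ?thesis using R[of "target_tm x y z o'"] that xyz e by simp
  qed
  show "sem N w A e (read_fm b (start_tm x y z q) f) \<longleftrightarrow> reads w b (start_pos n m k (e q))" if "q < f"
  proof -
    have "factors_less N e (start_tm x y z q)"
      using e dims_less product_less by (simp add: position_tm_defs)
    then show ?thesis using R[of "start_tm x y z q"] that xyz e by simp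
  qed
qed

lemma sem_length_fm: "sem N w A (args n m k) length_fm \<longleftrightarrow> length w = start_pos n m k n"
proof -
  have e: "((args n m k)(6 := x)) i < N" if "x < N" for i x
    using args_less[OF dims_less] that by simp
  have "factors_less N ((args n m k)(6 := x)) (start_tm 3 4 5 3)" for x
    using dims_less product_less by (simp add: position_tm_defs)
  then have "sem N w A ((args n m k)(6 := x)) (value_fm (start_tm 3 4 5 3) 6 7) \<longleftrightarrow> start_pos n m k n = x"
    if "x < N" for x
  proof -
    let ?e = "(args n m k)(6 := x)"
    have "sem N w A ?e (value_fm (start_tm 3 4 5 3) 6 7) \<longleftrightarrow> tval ?e (start_tm 3 4 5 3) = ?e 6"
    proof (rule sem_value_fm[OF arith])
      show "?e i < N" for i by (rule e[OF that])
      show "factors_less N ?e (start_tm 3 4 5 3)" by fact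
    qed simp_all
    then show ?thesis by simp
  qed
  then have "sem N w A (args n m k) length_fm \<longleftrightarrow>
      (\<exists>x<N. start_pos n m k n = x \<and> (\<forall>y<N. y < x \<longleftrightarrow> y < length w \<and> w ! y \<or> y < length w \<and> \<not> w ! y))"
    by (simp add: length_fm_def cong: conj_cong)
  also have "\<dots> \<longleftrightarrow> length w = start_pos n m k n"
  proof
    assume "\<exists>x<N. start_pos n m k n = x \<and> (\<forall>y<N. y < x \<longleftrightarrow> y < length w \<and> w ! y \<or> y < length w \<and> \<not> w ! y)"
    then obtain x where x: "x < N" "start_pos n m k n = x" "\<forall>y<N. y < x \<longleftrightarrow> y < length w" by blast
    \<comment> \<open>Taking \<open>y = length w\<close> or \<open>y = x\<close>, both below
      \<open>N\<close>, would contradict the equivalence.\<close>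
    then have "\<not> length w < x" "\<not> x < length w" using length_less by blast+
    with x(2) show "length w = start_pos n m k n" by linarith
  qed (use length_less in auto)
  finally show ?thesis .
qed

end

locale shape_word = header_word +
  assumes len: "length w = start_pos n m k n"
begin

lemma positions_less:
  "q < n \<Longrightarrow> initial_pos n m k q < length w"
  "q < n \<Longrightarrow> \<sigma> < m \<Longrightarrow> q' < n \<Longrightarrow> trans_pos n m k q \<sigma> q' < length w"
  "b < k \<Longrightarrow> q < n \<Longrightarrow> gamma_pos n m k b q < length w"
  "b < k \<Longrightarrow> target_pos n m k b < length w"
  "q < n \<Longrightarrow> start_pos n m k q < length w"
proof -
  show "trans_pos n m k q \<sigma> q' < length w" if "q < n" "\<sigma> < m" "q' < n"
    using index_less[OF index_less[OF that(1,2)] that(3)] by (simp add: len trans_pos_def start_pos_def)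
  show "gamma_pos n m k b q < length w" if "b < k" "q < n"
    using index_less[OF that] by (simp add: len gamma_pos_def start_pos_def)
qed (simp_all add: len initial_pos_def target_pos_def start_pos_def)

lemma reads_positions:
  "q < n \<Longrightarrow> reads w True (initial_pos n m k q) \<longleftrightarrow> w ! initial_pos n m k q"
  "q < n \<Longrightarrow> \<sigma> < m \<Longrightarrow> q' < n \<Longrightarrow> reads w True (trans_pos n m k q \<sigma> q') \<longleftrightarrow> w ! trans_pos n m k q \<sigma> q'"
  "b < k \<Longrightarrow> q < n \<Longrightarrow> reads w True (gamma_pos n m k b q) \<longleftrightarrow> w ! gamma_pos n m k b q"
  "b < k \<Longrightarrow> reads w True (target_pos n m k b) \<longleftrightarrow> w ! target_pos n m k b"
  "q < n \<Longrightarrow> reads w True (start_pos n m k q) \<longleftrightarrow> w ! start_pos n m k q"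
  using positions_less by (simp_all add: reads_def)

lemma shape: "shape w n m k"
  using header len by (simp add: shape_def)

lemma sem_valid_fm: "sem N w A (args n m k) valid_fm \<longleftrightarrow> valid w n m k"
proof -
  have ex: "(\<exists>x<N. x < y \<and> P x) \<longleftrightarrow> (\<exists>x<y. P x)" if "y < N" for P and y
    using that less_trans by blast
  have all: "(\<forall>x<N. x < y \<longrightarrow> P x) \<longleftrightarrow> (\<forall>x<y. P x)" if "y < N" for P and y
    using that less_trans by blast
  have e: "args n m k i < N" for i by (rule args_less[OF dims_less])
  have *: "x < N" if "x < n \<or> x < m \<or> x < k" for x using that dims_less by auto
  show ?thesis
    unfolding valid_fm_def valid_def
    by (simp add: shape ex all dims_less e * read_positions reads_positions cong: conj_cong imp_cong)
qed

end

subsection \<open>Beliefs as numbers\<close>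

text \<open>A belief \<open>S\<close> is the number \<open>set_encode S\<close>. Relation \<open>4\<close> recognises the sizes of the game, \<open>5\<close> is the
  transition relation, \<open>6\<close> relates states with equal observations, \<open>7\<close> contains the target states,
  \<open>9\<close> the beliefs that are still considered safe, and \<open>10\<close> the stages of the inner least fixpoint.
  The variables \<open>100\<close> and \<open>101\<close> count iterations and occur in no formula.\<close>

definition subset_fm :: fm where
  "subset_fm = Forall 6 (Impl (Rel 3 3 6 6) (Rel 6 6 6 6))"

text \<open>Facts about fewer than three elements are stored as ternary relations and queried with a
  repeated argument.\<close>

definition belief_fm :: "nat \<Rightarrow> nat \<Rightarrow> nat \<Rightarrow> nat \<Rightarrow> nat \<Rightarrow> fm" where
  "belief_fm s \<sigma> q t f = Forall f (Equiv (Rel 3 t f f)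
     (And (Rel 6 q f f) (Ex (f + 1) (And (Rel 3 s (f + 1) f) (Rel 5 (f + 1) \<sigma> f)))))"

definition allowed_fm :: "nat \<Rightarrow> nat \<Rightarrow> nat \<Rightarrow> fm" where
  "allowed_fm s \<sigma> f = Forall f (Forall (f + 1) (Impl (And (Rel 3 s f f) (Rel 5 f \<sigma> (f + 1)))
     (Ex (f + 2) (And (belief_fm s \<sigma> (f + 1) (f + 2) (f + 3)) (Rel 9 (f + 2) (f + 2) (f + 2))))))"

text \<open>Letters are recognised by the transitions they label: a valid word has at least one
  state, and every letter has a transition from it.\<close>

definition letter_fm :: "nat \<Rightarrow> nat \<Rightarrow> fm" where
  "letter_fm \<sigma> f = Ex f (Ex (f + 1) (Rel 5 f \<sigma> (f + 1)))"

definition reach_fm :: fm where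
  "reach_fm = And subset_fm (And (Rel 3 3 4 4) (Disj (Rel 7 4 4 4)
     (Ex 6 (And (letter_fm 6 7) (And (allowed_fm 3 6 7)
       (Forall 7 (Impl (Rel 5 4 6 7) (Ex 8 (And (belief_fm 3 6 7 8 9) (Rel 10 8 7 7))))))))))"

definition safe_fm :: fm where
  "safe_fm = And subset_fm (And (Ex 6 (And (letter_fm 6 7) (allowed_fm 3 6 7)))
     (Forall 6 (Impl (Rel 3 3 6 6) (Rel 10 3 6 6))))"

definition tables_cmd :: cmd where
  "tables_cmd = arith_cmd \<then> Def 4 header_fm \<then> Def 5 trans_fm \<then> Def 6 same_obs_fm \<then> Def 7 target_fm"

text \<open>\<open>Less 3 3\<close> is never true, so relation \<open>10\<close> restarts from the
  empty set in each outer round.\<close>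

definition safe_cmd :: cmd where
  "safe_cmd = Def 10 (Less 3 3) \<then> Loop 101 (update 10 reach_fm) \<then> update 9 safe_fm"

definition winning_cmd :: cmd where
  "winning_cmd = tables_cmd \<then> Def 9 subset_fm \<then> Loop 100 safe_cmd"

definition accepting_fm :: fm where
  "accepting_fm = Ex 3 (Ex 4 (Ex 5 (And (Rel 4 3 4 5) (And length_fm (And valid_fm
     (Ex 6 (And (Less 6 3) (And (read_fm True (start_tm 3 4 5 6) 7)
       (Ex 7 (And (Forall 8 (Equiv (Rel 3 7 8 8) (Equal 8 6))) (Rel 9 7 7 7)))))))))))"

lemma set_encode_less: "S \<subseteq> {..<n} \<Longrightarrow> set_encode S < 2 ^ n"
proof -
  assume S: "S \<subseteq> {..<n}"
  have "set_encode S \<le> (\<Sum>i<n. 2 ^ i)"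
    unfolding set_encode_def by (rule sum_mono2) (use S in auto)
  also have "\<dots> < 2 ^ n" by (induction n) auto
  finally show ?thesis .
qed

locale valid_word =
  fixes w :: "bool list" and n m k N :: nat
  assumes valid: "valid w n m k" and N: "N = 2 ^ length w"
begin

abbreviation "H \<equiv> index_game w n m k"
abbreviation "U \<equiv> index_target w n m k"

lemma shape_word: "arith N B \<Longrightarrow> shape_word w n m k N B"
  using valid N by unfold_locales (auto simp: valid_def shape_def)

lemma length_eq: "length w = start_pos n m k n"
  using valid by (simp add: valid_def shape_def)

lemma dims_less: "n < N" "m < N" "k < N"
proof -
  have "length w < N" by (simp add: N)
  then show "n < N" "m < N" "k < N" by (simp_all add: length_eq start_pos_def)
qed

lemma states_H: "states H = {..<n}" and alphabet_H: "alphabet H = {..<m}"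
  by (simp_all add: index_game_def)

lemma transitions_H: "(q, \<sigma>, q') \<in> transitions H \<longleftrightarrow> q < n \<and> \<sigma> < m \<and> q' < n \<and> w ! trans_pos n m k q \<sigma> q'"
  by (simp add: index_game_def)

lemma ex_transition: "q < n \<Longrightarrow> \<sigma> < m \<Longrightarrow> \<exists>q'<n. (q, \<sigma>, q') \<in> transitions H"
  using valid unfolding transitions_H valid_def by blast

lemma n_pos: "0 < n"
  using valid by (auto simp: valid_def)

definition tables :: "(nat \<Rightarrow> nat \<Rightarrow> bool) \<Rightarrow> bool" where
  "tables B \<longleftrightarrow> arith N B \<and> holds N B 5 (\<lambda>q \<sigma> q'. (q, \<sigma>, q') \<in> transitions H) \<and>
     holds N B 6 (\<lambda>q q' _. q < n \<and> q' < n \<and> obs_of H q = obs_of H q') \<and>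
     holds N B 7 (\<lambda>q _ _. q < n \<and> obs_of H q \<in> U)"

lemma tables_rel:
  assumes "tables B" "a < N" "b < N" "c < N"
  shows "rel N B 3 a b c \<longleftrightarrow> b \<in> set_decode a"
    and "rel N B 5 a b c \<longleftrightarrow> (a, b, c) \<in> transitions H"
    and "rel N B 6 a b c \<longleftrightarrow> a < n \<and> b < n \<and> obs_of H a = obs_of H b"
    and "rel N B 7 a b c \<longleftrightarrow> a < n \<and> obs_of H a \<in> U"
  using assms by (simp_all add: tables_def arith_def holds_def)

lemma tables_cong:
  assumes "tables A" "\<And>i. i \<noteq> 0 \<Longrightarrow> i \<noteq> 9 \<Longrightarrow> i \<noteq> 10 \<Longrightarrow> B i = A i"
  shows "tables B"
  using assms holds_cong[of B 1 A N] holds_cong[of B 2 A N] holds_cong[of B 3 A N] holds_cong[of B 5 A N]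
    holds_cong[of B 6 A N] holds_cong[of B 7 A N]
  by (simp add: tables_def arith_def)

lemma sem_with_dims:
  assumes "holds N B 4 (header w)"
  shows "sem N w B e (with_dims \<phi>) \<longleftrightarrow> sem N w B (e(6 := n, 7 := m, 8 := k)) \<phi>"
proof -
  have "header w x y z \<longleftrightarrow> x = n \<and> y = m \<and> z = k" for x y z
    using header_unique[of w x y z n m k] valid by (auto simp: valid_def shape_def)
  then have "sem N w B e (with_dims \<phi>) \<longleftrightarrow> (\<exists>x<N. \<exists>y<N. \<exists>z<N. (x = n \<and> y = m \<and> z = k) \<and>
    sem N w B (e(6 := x, 7 := y, 8 := z)) \<phi>)"
    using holdsD[OF assms] by (simp add: with_dims_def cong: conj_cong)
  also have "\<dots> \<longleftrightarrow> sem N w B (e(6 := n, 7 := m, 8 := k)) \<phi>"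
    using dims_less by blast
  finally show ?thesis .
qed

lemma sem_tables:
  assumes B: "arith N B" "holds N B 4 (header w)" and abc: "a < N" "b < N" "c < N"
  shows "sem N w B (args a b c) trans_fm \<longleftrightarrow> (a, b, c) \<in> transitions H"
    and "sem N w B (args a b c) same_obs_fm \<longleftrightarrow> a < n \<and> b < n \<and> obs_of H a = obs_of H b"
    and "sem N w B (args a b c) target_fm \<longleftrightarrow> a < n \<and> obs_of H a \<in> U"
proof -
  interpret W: shape_word w n m k N B by (rule shape_word[OF B(1)])
  let ?e = "(args a b c)(6 := n, 7 := m, 8 := k)"
  have e: "?e i < N" for i using args_less[OF abc] dims_less by simp
  have e': "(?e(9 := x)) i < N" if "x < N" for x i using e[of i] that by simp
  show "sem N w B (args a b c) trans_fm \<longleftrightarrow> (a, b, c) \<in> transitions H"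
    unfolding trans_fm_def sem_with_dims[OF B(2)] transitions_H
    by (simp add: W.read_positions[OF e] W.reads_positions cong: conj_cong)
  have "sem N w B (args a b c) same_obs_fm \<longleftrightarrow> a < n \<and> b < n \<and>
      (\<exists>x<N. x < k \<and> w ! gamma_pos n m k x a \<and> w ! gamma_pos n m k x b)"
    unfolding same_obs_fm_def sem_with_dims[OF B(2)]
    by (simp add: W.read_positions[OF e'] W.reads_positions cong: conj_cong)
  also have "\<dots> \<longleftrightarrow> a < n \<and> b < n \<and> obs_of H a = obs_of H b"
    using obs_of_index_game[OF valid, of a] obs_of_index_game[OF valid, of b] dims_less(3)
    by (metis less_trans)
  finally show "sem N w B (args a b c) same_obs_fm \<longleftrightarrow> a < n \<and> b < n \<and> obs_of H a = obs_of H b" .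
  have "sem N w B (args a b c) target_fm \<longleftrightarrow> a < n \<and>
      (\<exists>x<N. x < k \<and> w ! gamma_pos n m k x a \<and> w ! target_pos n m k x)"
    unfolding target_fm_def sem_with_dims[OF B(2)]
    by (simp add: W.read_positions[OF e'] W.reads_positions cong: conj_cong)
  also have "\<dots> \<longleftrightarrow> a < n \<and> obs_of H a \<in> U"
    using obs_of_index_game[OF valid, of a] dims_less(3) unfolding index_target_def mem_Collect_eq
    by (metis less_trans)
  finally show "sem N w B (args a b c) target_fm \<longleftrightarrow> a < n \<and> obs_of H a \<in> U" .
qed

lemma next_belief_less: "x \<in> next_belief H S \<sigma> q \<Longrightarrow> x < n"
  by (auto simp: next_belief_def post_def transitions_H)

text \<open>A code has at least as many bits as the game has states, so bit masks of beliefs lie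
  below \<open>N\<close>.\<close>

lemma ex_number:
  assumes "S \<subseteq> {..<n}"
  shows "\<exists>t<N. set_decode t = S"
proof -
  have "finite S" using assms by (rule finite_subset) simp
  moreover have "n \<le> length w" by (simp add: length_eq start_pos_def)
  then have "set_encode S < N"
    using set_encode_less[OF assms] N by (meson le_trans less_le_trans one_le_numeral power_increasing)
  ultimately show ?thesis by (intro exI[of _ "set_encode S"]) simp
qed

lemma set_decode_eq_iff:
  assumes "t < N" "S \<subseteq> {..<N}"
  shows "set_decode t = S \<longleftrightarrow> (\<forall>x<N. x \<in> set_decode t \<longleftrightarrow> x \<in> S)"
  using set_decode_less[of _ t] assms by fastforce

lemma sem_belief_fm:
  assumes B: "tables B" and e: "\<And>i. e i < N" and q: "e q < n" and f: "s < f" "\<sigma> < f" "q < f" "t < f"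
  shows "sem N w B e (belief_fm s \<sigma> q t f) \<longleftrightarrow> set_decode (e t) = next_belief H (set_decode (e s)) (e \<sigma>) (e q)"
proof -
  have "sem N w B e (belief_fm s \<sigma> q t f) \<longleftrightarrow> (\<forall>x<N. x \<in> set_decode (e t) \<longleftrightarrow>
      (e q < n \<and> x < n \<and> obs_of H (e q) = obs_of H x) \<and>
        (\<exists>y<N. y \<in> set_decode (e s) \<and> (y, e \<sigma>, x) \<in> transitions H))"
    using tables_rel[OF B] e f by (simp add: belief_fm_def cong: conj_cong)
  also have "\<dots> \<longleftrightarrow> (\<forall>x<N. x \<in> set_decode (e t) \<longleftrightarrow> x \<in> next_belief H (set_decode (e s)) (e \<sigma>) (e q))"
  proof -
    have "(e q < n \<and> x < n \<and> obs_of H (e q) = obs_of H x) \<and>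
      (\<exists>y<N. y \<in> set_decode (e s) \<and> (y, e \<sigma>, x) \<in> transitions H)
        \<longleftrightarrow> x \<in> next_belief H (set_decode (e s)) (e \<sigma>) (e q)" for x
      using q dims_less(1) unfolding next_belief_def post_def mem_Collect_eq transitions_H by (metis less_trans)
    then show ?thesis by simp
  qed
  also have "\<dots> \<longleftrightarrow> set_decode (e t) = next_belief H (set_decode (e s)) (e \<sigma>) (e q)"
    using set_decode_eq_iff[OF e[of t], of "next_belief H (set_decode (e s)) (e \<sigma>) (e q)"] next_belief_less
      dims_less(1)
    by (meson lessThan_iff less_trans subsetI)
  finally show ?thesis .
qed

lemma ex_next_belief:
  "(\<exists>t<N. set_decode t = next_belief H S \<sigma> q \<and> P (set_decode t)) \<longleftrightarrow> P (next_belief H S \<sigma> q)"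
  using ex_number[of "next_belief H S \<sigma> q"] next_belief_less by (metis lessThan_iff subsetI)

lemma sem_allowed_fm:
  assumes B: "tables B" "holds N B 9 (\<lambda>s _ _. set_decode s \<in> Y)" and e: "\<And>i. e i < N" and f: "s < f" "\<sigma> < f"
  shows "sem N w B e (allowed_fm s \<sigma> f) \<longleftrightarrow> allowed H Y (set_decode (e s)) (e \<sigma>)"
proof -
  have bel: "sem N w B (e(f := x, f + 1 := y, f + 2 := t)) (belief_fm s \<sigma> (f + 1) (f + 2) (f + 3)) \<longleftrightarrow>
      set_decode t = next_belief H (set_decode (e s)) (e \<sigma>) y" if "x < N" "y < N" "t < N" "y < n" for x y t
    by (subst sem_belief_fm[OF B(1)]) (use e f that in auto)
  have "sem N w B e (allowed_fm s \<sigma> f) \<longleftrightarrow> (\<forall>x<N. \<forall>y<N. x \<in> set_decode (e s) \<and> (x, e \<sigma>, y) \<in> transitions H \<longrightarrow>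
      (\<exists>t<N. set_decode t = next_belief H (set_decode (e s)) (e \<sigma>) y \<and> set_decode t \<in> Y))"
  proof -
    have "sem N w B (e(f := x, f + 1 := y)) (Ex (f + 2)
      (And (belief_fm s \<sigma> (f + 1) (f + 2) (f + 3)) (Rel 9 (f + 2) (f + 2) (f + 2))))
      \<longleftrightarrow> (\<exists>t<N. set_decode t = next_belief H (set_decode (e s)) (e \<sigma>) y \<and> set_decode t \<in> Y)"
      if "x < N" "y < N" "(x, e \<sigma>, y) \<in> transitions H" for x y
      using bel[OF that(1,2)] that(3) holdsD[OF B(2)] by (simp add: transitions_H cong: conj_cong)
    then show ?thesis
      using tables_rel[OF B(1)] e f by (simp add: allowed_fm_def del: sem.simps(6) cong: conj_cong imp_cong)
  qed
  also have "\<dots> \<longleftrightarrow> allowed H Y (set_decode (e s)) (e \<sigma>)"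
    unfolding ex_next_belief[where P = "\<lambda>S. S \<in> Y"] allowed_def transitions_H using dims_less(1)
      by (meson less_trans)
  finally show ?thesis .
qed

lemma sem_letter_fm:
  assumes B: "tables B" and e: "\<And>i. e i < N" and f: "\<sigma> < f"
  shows "sem N w B e (letter_fm \<sigma> f) \<longleftrightarrow> e \<sigma> < m"
proof -
  have "sem N w B e (letter_fm \<sigma> f) \<longleftrightarrow> (\<exists>x<N. \<exists>y<N. (x, e \<sigma>, y) \<in> transitions H)"
    using tables_rel[OF B] e f by (simp add: letter_fm_def cong: conj_cong)
  also have "\<dots> \<longleftrightarrow> e \<sigma> < m"
    using ex_transition[OF n_pos, of "e \<sigma>"] dims_less(1) n_pos unfolding transitions_H by (meson less_trans)
  finally show ?thesis .
qed

lemma sem_subset_fm: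
  assumes B: "tables B" and abc: "a < N" "b < N" "c < N"
  shows "sem N w B (args a b c) subset_fm \<longleftrightarrow> set_decode a \<subseteq> states H"
proof -
  have "sem N w B (args a b c) subset_fm \<longleftrightarrow> (\<forall>x<N. x \<in> set_decode a \<longrightarrow> x < n)"
    using tables_rel[OF B] abc by (simp add: subset_fm_def cong: imp_cong)
  also have "\<dots> \<longleftrightarrow> set_decode a \<subseteq> states H"
    unfolding states_H using set_decode_less abc(1) by (meson lessThan_iff less_trans subset_iff)
  finally show ?thesis .
qed

lemma sem_reach_fm:
  assumes B: "tables B" "holds N B 9 (\<lambda>s _ _. set_decode s \<in> Y)" "holds N B 10 (\<lambda>s q _. (set_decode s, q) \<in> X)"
    and abc: "a < N" "b < N" "c < N"
  shows "sem N w B (args a b c) reach_fm \<longleftrightarrow> (set_decode a, b) \<in> reach_step H U Y X"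
proof -
  have e: "((args a b c)(6 := \<sigma>)) i < N" if "\<sigma> < N" for \<sigma> i using args_less[OF abc] that by simp
  have e': "((args a b c)(6 := \<sigma>, 7 := y, 8 := t)) i < N" if "\<sigma> < N" "y < N" "t < N" for \<sigma> y t i
    using args_less[OF abc] that by simp
  have bel: "sem N w B ((args a b c)(6 := \<sigma>, 7 := y, 8 := t)) (belief_fm 3 6 7 8 9) \<longleftrightarrow>
      set_decode t = next_belief H (set_decode a) \<sigma> y" if "\<sigma> < N" "y < N" "t < N" "y < n" for \<sigma> y t
    by (subst sem_belief_fm[OF B(1) e'[OF that(1-3)]]) (use that in auto)
  have succ: "sem N w B ((args a b c)(6 := \<sigma>, 7 := y)) (Ex 8 (And (belief_fm 3 6 7 8 9) (Rel 10 8 7 7))) \<longleftrightarrow>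
      (next_belief H (set_decode a) \<sigma> y, y) \<in> X" if "\<sigma> < N" "y < N" "(b, \<sigma>, y) \<in> transitions H" for \<sigma> y
  proof -
    have "sem N w B ((args a b c)(6 := \<sigma>, 7 := y)) (Ex 8 (And (belief_fm 3 6 7 8 9) (Rel 10 8 7 7))) \<longleftrightarrow>
        (\<exists>t<N. set_decode t = next_belief H (set_decode a) \<sigma> y \<and> (set_decode t, y) \<in> X)"
      using bel[OF that(1,2)] that holdsD[OF B(3)] by (simp add: transitions_H cong: conj_cong)
    then show ?thesis using ex_next_belief[where P = "\<lambda>S. (S, y) \<in> X"] by simp
  qed
  have let1: "sem N w B ((args a b c)(6 := \<sigma>)) (letter_fm 6 7) \<longleftrightarrow> \<sigma> < m" if "\<sigma> < N" for \<sigma>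
  proof -
    have "sem N w B ((args a b c)(6 := \<sigma>)) (letter_fm 6 7) \<longleftrightarrow> ((args a b c)(6 := \<sigma>)) 6 < m"
      by (rule sem_letter_fm[OF B(1)]) (rule e[OF that], simp)
    then show ?thesis by simp
  qed
  have all1: "sem N w B ((args a b c)(6 := \<sigma>)) (allowed_fm 3 6 7) \<longleftrightarrow> allowed H Y (set_decode a) \<sigma>" if "\<sigma> < N"
    for \<sigma>
  proof -
    have "sem N w B ((args a b c)(6 := \<sigma>)) (allowed_fm 3 6 7) \<longleftrightarrow>
        allowed H Y (set_decode (((args a b c)(6 := \<sigma>)) 3)) (((args a b c)(6 := \<sigma>)) 6)"
      by (rule sem_allowed_fm[OF B(1,2)]) (rule e[OF that], simp_all)
    then show ?thesis by simp
  qed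
  have sub: "sem N w B (args a b c) subset_fm \<longleftrightarrow> set_decode a \<subseteq> states H" by (rule sem_subset_fm[OF B(1) abc])
  have "sem N w B (args a b c) reach_fm \<longleftrightarrow> set_decode a \<subseteq> states H \<and> b \<in> set_decode a \<and>
    ((b < n \<and> obs_of H b \<in> U) \<or>
      (\<exists>\<sigma><N. \<sigma> < m \<and> allowed H Y (set_decode a) \<sigma> \<and>
        (\<forall>y<N. (b, \<sigma>, y) \<in> transitions H \<longrightarrow> (next_belief H (set_decode a) \<sigma> y, y) \<in> X)))"
    unfolding reach_fm_def sem.simps(5) sub sem_connectives
    using let1 all1 succ tables_rel[OF B(1)] abc
    by (simp del: sem.simps(6) cong: conj_cong imp_cong add: sem.simps(6)[of N w B "args a b c" 6])
  also have "\<dots> \<longleftrightarrow> (set_decode a, b) \<in> reach_step H U Y X"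
  proof -
    have "b < n" if "set_decode a \<subseteq> states H" "b \<in> set_decode a" using that by (auto simp: states_H)
    moreover have "y < N" if "(b, \<sigma>, y) \<in> transitions H" for \<sigma> y using that dims_less(1)
      by (simp add: transitions_H)
    moreover have "\<sigma> < N" if "\<sigma> < m" for \<sigma> using that dims_less(2) by simp
    ultimately show ?thesis
      unfolding reach_step_def alphabet_H mem_Collect_eq case_prod_conv Bex_def lessThan_iff by blast
  qed
  finally show ?thesis .
qed

lemma sem_safe_fm:
  assumes B: "tables B" "holds N B 9 (\<lambda>s _ _. set_decode s \<in> Y)"
      "holds N B 10 (\<lambda>s q _. (set_decode s, q) \<in> lfp (reach_step H U Y))"
    and abc: "a < N" "b < N" "c < N"
  shows "sem N w B (args a b c) safe_fm \<longleftrightarrow> set_decode a \<in> safe_step H U Y"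
proof -
  have e: "((args a b c)(6 := \<sigma>)) i < N" if "\<sigma> < N" for \<sigma> i using args_less[OF abc] that by simp
  have let1: "sem N w B ((args a b c)(6 := \<sigma>)) (letter_fm 6 7) \<longleftrightarrow> \<sigma> < m" if "\<sigma> < N" for \<sigma>
  proof -
    have "sem N w B ((args a b c)(6 := \<sigma>)) (letter_fm 6 7) \<longleftrightarrow> ((args a b c)(6 := \<sigma>)) 6 < m"
      by (rule sem_letter_fm[OF B(1)]) (rule e[OF that], simp)
    then show ?thesis by simp
  qed
  have all1: "sem N w B ((args a b c)(6 := \<sigma>)) (allowed_fm 3 6 7) \<longleftrightarrow> allowed H Y (set_decode a) \<sigma>" if "\<sigma> < N"
    for \<sigma>
  proof -
    have "sem N w B ((args a b c)(6 := \<sigma>)) (allowed_fm 3 6 7) \<longleftrightarrow>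
        allowed H Y (set_decode (((args a b c)(6 := \<sigma>)) 3)) (((args a b c)(6 := \<sigma>)) 6)"
      by (rule sem_allowed_fm[OF B(1,2)]) (rule e[OF that], simp_all)
    then show ?thesis by simp
  qed
  have sub: "sem N w B (args a b c) subset_fm \<longleftrightarrow> set_decode a \<subseteq> states H" by (rule sem_subset_fm[OF B(1) abc])
  have "sem N w B (args a b c) safe_fm \<longleftrightarrow> set_decode a \<subseteq> states H \<and>
    (\<exists>\<sigma><N. \<sigma> < m \<and> allowed H Y (set_decode a) \<sigma>) \<and>
      (\<forall>q<N. q \<in> set_decode a \<longrightarrow> (set_decode a, q) \<in> lfp (reach_step H U Y))"
    unfolding safe_fm_def sem.simps(5) sub
    using let1 all1 tables_rel[OF B(1)] holdsD[OF B(3)] abc by (simp cong: conj_cong imp_cong)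
  also have "\<dots> \<longleftrightarrow> set_decode a \<in> safe_step H U Y"
    using dims_less(2) set_decode_less[of _ a] abc(1)
    unfolding safe_step_def alphabet_H mem_Collect_eq Bex_def Ball_def lessThan_iff by (meson less_trans)
  finally show ?thesis .
qed

end

subsection \<open>Correctness and complexity\<close>

primrec targets :: "cmd \<Rightarrow> nat set" where
  "targets (Def j \<phi>) = {j}"
| "targets (c \<then> d) = targets c \<union> targets d"
| "targets (Loop v c) = targets c"

lemma exec_unchanged: "i \<notin> targets c \<Longrightarrow> exec N w c A i = A i"
proof (induction c arbitrary: A)
  case (Loop v c)
  have "(exec N w c ^^ t) A i = A i" for t
    by (induction t) (use Loop in auto)
  then show ?case by simp
qed auto

lemma targets_update [simp]: "targets (update j \<phi>) = {0, j}"
  by (auto simp: update_def)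

lemma arith_cong: "A 1 = B 1 \<Longrightarrow> A 2 = B 2 \<Longrightarrow> A 3 = B 3 \<Longrightarrow> arith N A \<longleftrightarrow> arith N B"
  using holds_cong[of A 1 B N] holds_cong[of A 2 B N] holds_cong[of A 3 B N] by (simp add: arith_def)

lemma exec_tables:
  fixes w :: "bool list"
  defines "N \<equiv> 2 ^ length w"
  defines "B \<equiv> exec N w tables_cmd (\<lambda>_ _. False)"
  shows "arith N B" "holds N B 4 (header w)" "valid w n m k \<Longrightarrow> valid_word.tables w n m k N B"
proof -
  define A1 where "A1 = exec N w arith_cmd (\<lambda>_ _. False)"
  define A4 where "A4 = exec N w (Def 4 header_fm) A1"
  define A5 where "A5 = exec N w (Def 5 trans_fm) A4"
  define A6 where "A6 = exec N w (Def 6 same_obs_fm) A5"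
  have B: "B = exec N w (Def 7 target_fm) A6"
    by (simp only: B_def tables_cmd_def exec.simps(2) A1_def A4_def A5_def A6_def)
  have len: "length w < N" by (simp add: N_def)
  have A1: "arith N A1" unfolding A1_def by (rule arith_cmd(1)) simp
  have A4: "A4 i = A1 i" if "i \<noteq> 4" for i using that by (simp add: A4_def)
  have A5: "A5 i = A4 i" if "i \<noteq> 5" for i using that by (simp add: A5_def)
  have A6: "A6 i = A5 i" if "i \<noteq> 6" for i using that by (simp add: A6_def)
  have A7: "B i = A6 i" if "i \<noteq> 7" for i using that by (simp add: B)
  have ar4: "arith N A4" using A1 arith_cong[of A4 A1 N] A4 by simp
  have ar5: "arith N A5" using ar4 arith_cong[of A5 A4 N] A5 by simp
  have ar6: "arith N A6" using ar5 arith_cong[of A6 A5 N] A6 by simp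
  show ar7: "arith N B" using ar6 arith_cong[of B A6 N] A7 by simp
  have h4: "holds N A4 4 (header w)"
    unfolding A4_def by (rule holds_Def) (rule sem_header_fm[OF A1 len])
  have h5: "holds N A5 4 (header w)" using h4 holds_cong[of A5 4 A4 N] A5 by simp
  have h6: "holds N A6 4 (header w)" using h5 holds_cong[of A6 4 A5 N] A6 by simp
  show h7: "holds N B 4 (header w)" using h6 holds_cong[of B 4 A6 N] A7 by simp
  assume valid: "valid w n m k"
  interpret valid_word w n m k N by unfold_locales (use valid in \<open>simp_all add: N_def\<close>)
  have t5: "holds N A5 5 (\<lambda>q \<sigma> q'. (q, \<sigma>, q') \<in> transitions H)"
    unfolding A5_def by (rule holds_Def) (rule sem_tables(1)[OF ar4 h4])
  have t6: "holds N A6 6 (\<lambda>q q' _. q < n \<and> q' < n \<and> obs_of H q = obs_of H q')"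
    unfolding A6_def by (rule holds_Def) (rule sem_tables(2)[OF ar5 h5])
  have t7: "holds N B 7 (\<lambda>q _ _. q < n \<and> obs_of H q \<in> U)"
    unfolding B by (rule holds_Def) (rule sem_tables(3)[OF ar6 h6])
  show "tables B"
    unfolding tables_def using ar7 t5 t6 t7 holds_cong[of B 5 A5 N] holds_cong[of B 6 A6 N] A6[of 5]
      A7[of 5] A7[of 6] by simp
qed

context valid_word
begin

text \<open>\<open>2 ^ n * n \<le> 2 ^ (n + n)\<close>, and the header together with the table of
  the initial state already has \<open>2 * n\<close> bits. Hence \<open>N\<close> rounds suffice for
  either fixpoint.\<close>

lemma card_bounds: "card (Pow (states H) \<times> states H) \<le> N" "card (Pow (states H)) \<le> N"
proof -
  have "n \<le> 2 ^ n" by (simp add: less_imp_le)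
  then have "2 ^ n * n \<le> 2 ^ n * (2 ^ n :: nat)" by simp
  also have "\<dots> = 2 ^ (n + n)" by (simp add: power_add)
  also have "\<dots> \<le> 2 ^ length w" by (intro power_increasing) (simp_all add: length_eq start_pos_def)
  finally have "2 ^ n * n \<le> N" by (simp add: N)
  then show "card (Pow (states H) \<times> states H) \<le> N" by (simp add: states_H card_cartesian_product card_Pow)
  have "2 ^ n \<le> N" unfolding N by (intro power_increasing) (simp_all add: length_eq start_pos_def)
  then show "card (Pow (states H)) \<le> N" by (simp add: states_H card_Pow)
qed

text \<open>During the inner loop relation \<open>9\<close> is constant, so the inner iteration
  computes the least fixpoint for a fixed \<open>Y\<close>.\<close>

lemma exec_safe_cmd:
  assumes B: "tables B" "holds N B 9 (\<lambda>s _ _. set_decode s \<in> Y)"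
  shows "holds N (exec N w safe_cmd B) 9 (\<lambda>s _ _. set_decode s \<in> safe_step H U Y)"
proof -
  define C where "C = exec N w (Def 10 (Less 3 3)) B"
  define D where "D = exec N w (Loop 101 (update 10 reach_fm)) C"
  let ?P = "\<lambda>t s q (_ :: nat). (set_decode s, q) \<in> (reach_step H U Y ^^ t) {}"
  have C: "C i = B i" if "i \<noteq> 10" for i using that by (simp add: C_def)
  have C10: "holds N C 10 (?P 0)" unfolding C_def by (rule holds_Def) simp
  have step: "sem N w E (args a b c) reach_fm \<longleftrightarrow> ?P (Suc t) a b c"
    if E: "\<And>i. i \<noteq> 0 \<Longrightarrow> i \<noteq> 10 \<Longrightarrow> E i = C i" "holds N E 10 (?P t)" and abc: "a < N" "b < N" "c < N" for E t a b c
  proof -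
    have "tables E" by (rule tables_cong[OF B(1)]) (use E C in simp)
    moreover have "holds N E 9 (\<lambda>s _ _. set_decode s \<in> Y)"
      using B(2) holds_cong[of E 9 B N] E(1)[of 9] C[of 9] by simp
    ultimately show ?thesis using sem_reach_fm[OF _ _ E(2) abc] by simp
  qed
  have D10: "holds N D 10 (?P N)"
    unfolding D_def by (rule iterate_update(1)[where P = ?P]) (use C10 step in auto)
  have D: "D i = C i" if "i \<noteq> 0" "i \<noteq> 10" for i
    unfolding D_def by (rule exec_unchanged) (use that in simp)
  have fin: "finite (Pow (states H) \<times> states H)" by (simp add: states_H)
  have "(reach_step H U Y ^^ N) {} = lfp (reach_step H U Y)"
    by (rule lfp_eq_funpow[OF mono_reach_step _ fin card_bounds(1)]) (auto simp: reach_step_def)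
  with D10 have D10: "holds N D 10 (\<lambda>s q _. (set_decode s, q) \<in> lfp (reach_step H U Y))" by simp
  have tD: "tables D" by (rule tables_cong[OF B(1)]) (use D C in simp)
  have D9: "holds N D 9 (\<lambda>s _ _. set_decode s \<in> Y)"
    using B(2) holds_cong[of D 9 B N] D[of 9] C[of 9] by simp
  have "exec N w safe_cmd B = exec N w (update 9 safe_fm) D"
    by (simp only: safe_cmd_def exec.simps(2) C_def D_def)
  then show ?thesis
    using holds_update(1)[where N = N and w = w and A = D and j = 9
      and \<phi> = safe_fm, OF sem_safe_fm[OF tD D9 D10]] by simp
qed

lemma exec_winning_cmd:
  "holds N (exec N w winning_cmd (\<lambda>_ _. False)) 9 (\<lambda>s _ _. set_decode s \<in> winning_beliefs H U)"
proof -
  define B where "B = exec N w tables_cmd (\<lambda>_ _. False)"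
  define C where "C = exec N w (Def 9 subset_fm) B"
  have tB: "tables B" using exec_tables(3)[OF valid] unfolding B_def N .
  have tC: "tables C" by (rule tables_cong[OF tB]) (simp add: C_def)
  have "holds N C 9 (\<lambda>s _ _. set_decode s \<subseteq> states H)"
    unfolding C_def by (rule holds_Def) (rule sem_subset_fm[OF tB])
  then have C9: "holds N C 9 (\<lambda>s _ _. set_decode s \<in> Pow (states H))" by simp
  have "tables ((exec N w safe_cmd ^^ t) C) \<and>
      holds N ((exec N w safe_cmd ^^ t) C) 9 (\<lambda>s _ _. set_decode s \<in> (safe_step H U ^^ t) (Pow (states H)))"
        for t
  proof (induction t)
    case 0
    then show ?case using tC C9 by simp
  next
    case (Suc t)
    have unchanged: "exec N w safe_cmd X i = X i" if "i \<noteq> 0" "i \<noteq> 9" "i \<noteq> 10" for X i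
      by (rule exec_unchanged) (use that in \<open>simp add: safe_cmd_def\<close>)
    have "tables (exec N w safe_cmd ((exec N w safe_cmd ^^ t) C))"
      by (rule tables_cong[OF conjunct1[OF Suc]]) (rule unchanged)
    then show ?case using exec_safe_cmd Suc by simp
  qed
  moreover have "(safe_step H U ^^ N) (Pow (states H)) = gfp (safe_step H U)"
    by (rule gfp_eq_funpow[OF mono_safe_step _ _ card_bounds(2)]) (auto simp: safe_step_def states_H)
  moreover have "exec N w winning_cmd (\<lambda>_ _. False) = (exec N w safe_cmd ^^ N) C"
    by (simp only: winning_cmd_def exec.simps(2,3) B_def C_def)
  ultimately show ?thesis unfolding winning_beliefs_def by metis
qed

lemma sem_start_belief:
  assumes B: "arith N B" "holds N B 9 (\<lambda>s _ _. set_decode s \<in> winning_beliefs H U)"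
  shows "sem N w B (args n m k) (Ex 6 (And (Less 6 3) (And (read_fm True (start_tm 3 4 5 6) 7)
       (Ex 7 (And (Forall 8 (Equiv (Rel 3 7 8 8) (Equal 8 6))) (Rel 9 7 7 7)))))) \<longleftrightarrow>
    (\<exists>l<n. w ! start_pos n m k l \<and> {l} \<in> winning_beliefs H U)"
proof -
  interpret W: shape_word w n m k N B by (rule shape_word[OF B(1)])
  have e: "((args n m k)(6 := l)) i < N" if "l < N" for l i using args_less[OF dims_less] that by simp
  have bit: "rel N B 3 a b c \<longleftrightarrow> b \<in> set_decode a" if "a < N" "b < N" "c < N" for a b c
    using B(1) that by (simp add: arith_def holds_def)
  have "sem N w B (args n m k) (Ex 6 (And (Less 6 3) (And (read_fm True (start_tm 3 4 5 6) 7)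
       (Ex 7 (And (Forall 8 (Equiv (Rel 3 7 8 8) (Equal 8 6))) (Rel 9 7 7 7)))))) \<longleftrightarrow>
    (\<exists>l<N. l < n \<and> w ! start_pos n m k l \<and>
      (\<exists>t<N. (\<forall>x<N. x \<in> set_decode t \<longleftrightarrow> x = l) \<and> set_decode t \<in> winning_beliefs H U))"
    using bit holdsD[OF B(2)] by (simp add: W.read_positions[OF e] W.reads_positions cong: conj_cong)
  also have "\<dots> \<longleftrightarrow> (\<exists>l<N. l < n \<and> w ! start_pos n m k l \<and>
      (\<exists>t<N. set_decode t = {l} \<and> set_decode t \<in> winning_beliefs H U))"
  proof -
    have "(\<forall>x<N. x \<in> set_decode t \<longleftrightarrow> x = l) \<longleftrightarrow> set_decode t = {l}" if "t < N" "l < N" for t l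
      using set_decode_eq_iff[OF that(1), of "{l}"] that(2) by simp
    then show ?thesis by (simp cong: conj_cong)
  qed
  also have "\<dots> \<longleftrightarrow> (\<exists>l<n. w ! start_pos n m k l \<and> {l} \<in> winning_beliefs H U)"
  proof -
    have *: "(\<exists>t<N. set_decode t = {l} \<and> set_decode t \<in> winning_beliefs H U) \<longleftrightarrow> {l} \<in> winning_beliefs H U"
      if l: "l < n" for l
    proof -
      obtain t where "t < N" "set_decode t = {l}" using ex_number[of "{l}"] l by auto
      then show ?thesis by metis
    qed
    have less: "l < N" if "l < n" for l using that dims_less(1) by simp
    show ?thesis
    proof (rule iff_exI)
      fix l
      show "l < N \<and> l < n \<and> w ! start_pos n m k l \<and>
          (\<exists>t<N. set_decode t = {l} \<and> set_decode t \<in> winning_beliefs H U) \<longleftrightarrow>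
        l < n \<and> w ! start_pos n m k l \<and> {l} \<in> winning_beliefs H U"
        by (cases "l < n") (simp_all only: * less simp_thms)
    qed
  qed
  finally show ?thesis .
qed

end

lemma decided_iff_accepting: "decided winning_cmd accepting_fm w \<longleftrightarrow> accepting w"
proof -
  define N where "N = (2 :: nat) ^ length w"
  define B where "B = exec N w tables_cmd (\<lambda>_ _. False)"
  define E where "E = exec N w winning_cmd (\<lambda>_ _. False)"
  have E: "E i = B i" if "i \<notin> {0, 9, 10}" for i
  proof -
    have "E = exec N w (Def 9 subset_fm \<then> Loop 100 safe_cmd) B"
      by (simp only: E_def B_def winning_cmd_def exec.simps(2))
    then show ?thesis using that exec_unchanged[of i "Def 9 subset_fm \<then> Loop 100 safe_cmd"]
      by (simp add: safe_cmd_def del: exec.simps)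
  qed
  have ar: "arith N E" using exec_tables(1)[of w] arith_cong[of E B N] E by (simp add: B_def N_def)
  have h: "holds N E 4 (header w)" using exec_tables(2)[of w] holds_cong[of E 4 B N] E
    by (simp add: B_def N_def)
  let ?\<psi> = "Ex 6 (And (Less 6 3) (And (read_fm True (start_tm 3 4 5 6) 7)
       (Ex 7 (And (Forall 8 (Equiv (Rel 3 7 8 8) (Equal 8 6))) (Rel 9 7 7 7)))))"
  have body: "sem N w E (args n m k) length_fm \<and> sem N w E (args n m k) valid_fm \<and> sem N w E (args n m k) ?\<psi> \<longleftrightarrow>
      valid w n m k \<and> (\<exists>l<n. w ! start_pos n m k l \<and>
        {l} \<in> winning_beliefs (index_game w n m k) (index_target w n m k))"
    if "header w n m k" for n m k
  proof -
    interpret header_word w n m k N E by unfold_locales (use that ar in \<open>simp_all add: N_def\<close>)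
    show ?thesis
    \<comment> \<open>The case split follows the order of the conjuncts: a wrong length already
      falsifies \<open>length_fm\<close>, and invalid tables falsify \<open>valid_fm\<close>. So the
      value of relation \<open>9\<close> matters only for valid words, where it is known.\<close>
    proof (cases "length w = start_pos n m k n")
      case True
      then interpret shape_word w n m k N E by unfold_locales
      show ?thesis
      proof (cases "valid w n m k")
        case v: True
        interpret V: valid_word w n m k N by unfold_locales (use v in \<open>simp_all add: N_def\<close>)
        have "holds N E 9 (\<lambda>s _ _. set_decode s \<in> winning_beliefs (index_game w n m k) (index_target w n m k))"
          using V.exec_winning_cmd unfolding E_def .
        from V.sem_start_belief[OF ar this] show ?thesis
          using sem_length_fm sem_valid_fm True v by blast
      next
        case False
        then show ?thesis using sem_valid_fm by blast
      qed
    next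
      case False
      then have "\<not> valid w n m k" by (simp add: valid_def shape_def)
      then show ?thesis using False sem_length_fm by blast
    qed
  qed
  have args: "(\<lambda>_. 0)(3 := x, 4 := y, 5 := z) = args x y z" for x y z by (simp add: args_def)
  have "decided winning_cmd accepting_fm w \<longleftrightarrow> sem N w E (\<lambda>_. 0) accepting_fm"
    by (simp add: decided_def E_def N_def Let_def)
  also have "\<dots> \<longleftrightarrow> (\<exists>n<N. \<exists>m<N. \<exists>k<N. header w n m k \<and>
      sem N w E (args n m k) length_fm \<and> sem N w E (args n m k) valid_fm \<and> sem N w E (args n m k) ?\<psi>)"
    using holdsD[OF h] unfolding accepting_fm_def sem.simps(5,6) sem.simps(3)[of N w E _ 4] args
    by (simp del: sem.simps(5,6) cong: conj_cong)
  also have "\<dots> \<longleftrightarrow> accepting w"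
  proof
    assume "accepting w"
    then obtain n m k l where *: "valid w n m k" "l < n" "w ! start_pos n m k l"
      "{l} \<in> winning_beliefs (index_game w n m k) (index_target w n m k)"
      unfolding accepting_def by blast
    interpret V: valid_word w n m k N by unfold_locales (use * in \<open>simp_all add: N_def\<close>)
    have "header w n m k" using *(1) by (simp add: valid_def shape_def)
    with body[OF this] * V.dims_less show "\<exists>n<N. \<exists>m<N. \<exists>k<N. header w n m k \<and>
      sem N w E (args n m k) length_fm \<and> sem N w E (args n m k) valid_fm \<and> sem N w E (args n m k) ?\<psi>" by blast
  next
    assume "\<exists>n<N. \<exists>m<N. \<exists>k<N. header w n m k \<and>
      sem N w E (args n m k) length_fm \<and> sem N w E (args n m k) valid_fm \<and> sem N w E (args n m k) ?\<psi>"
    then show "accepting w" using body unfolding accepting_def by blast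
  qed
  finally show ?thesis .
qed

section \<open>Well-formedness of the definitions\<close>

lemma fv_tables:
  "fv header_fm \<subseteq> {3, 4, 5}" "fv trans_fm \<subseteq> {3, 4, 5}" "fv same_obs_fm \<subseteq> {3, 4, 5}" "fv target_fm \<subseteq> {3, 4, 5}"
proof -
  show "fv header_fm \<subseteq> {3, 4, 5}"
    using value_fm_syntax(2)[of "Plus (Plus (V 3) One) (V 4)" 9 7]
      value_fm_syntax(2)[of "Plus (Plus (Plus (Plus (V 3) One) (V 4)) One) (V 5)" 9 8]
    unfolding header_fm_def by (auto simp del: value_fm.simps)
  show "fv trans_fm \<subseteq> {3, 4, 5}"
    using read_fm_syntax(2)[of "trans_tm 6 7 8 3 4 5" 9 True]
    unfolding trans_fm_def with_dims_def by auto
  show "fv same_obs_fm \<subseteq> {3, 4, 5}"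
    using read_fm_syntax(2)[of "gamma_tm 6 7 8 9 3" 10 True] read_fm_syntax(2)[of "gamma_tm 6 7 8 9 4" 10 True]
    unfolding same_obs_fm_def with_dims_def by auto
  show "fv target_fm \<subseteq> {3, 4, 5}"
    using read_fm_syntax(2)[of "gamma_tm 6 7 8 9 3" 10 True] read_fm_syntax(2)[of "target_tm 6 7 8 9" 10 True]
    unfolding target_fm_def with_dims_def by auto
qed

lemma rels_read: "j > 2 \<Longrightarrow> j \<notin> rels (read_fm b t f)" "j > 2 \<Longrightarrow> j \<notin> rels (value_fm t v f)"
  using read_fm_syntax(1)[of b t f] value_fm_syntax(1)[of t v f] by auto

lemma wf_winning_cmd: "wf_cmd {} winning_cmd"
proof -
  have "wf_cmd {} arith_cmd"
    by (auto simp: arith_cmd_def update_def plus_fm_def times_fm_def bit_fm_def)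
  moreover have "wf_cmd {} (Def 4 header_fm)"
    using fv_tables(1) by (simp add: header_fm_def rels_read value_fm_syntax(3) del: value_fm.simps fv.simps)
  moreover have "wf_cmd {} (Def 5 trans_fm)"
    using fv_tables(2) by (simp add: trans_fm_def with_dims_def rels_read read_fm_syntax(3) del: fv.simps)
  moreover have "wf_cmd {} (Def 6 same_obs_fm)"
    using fv_tables(3) by (simp add: same_obs_fm_def with_dims_def rels_read read_fm_syntax(3) del: fv.simps)
  moreover have "wf_cmd {} (Def 7 target_fm)"
    using fv_tables(4) by (simp add: target_fm_def with_dims_def rels_read read_fm_syntax(3) del: fv.simps)
  moreover have "wf_cmd {} (Def 9 subset_fm)" by (auto simp: subset_fm_def)
  moreover have "wf_cmd {} (Loop 100 safe_cmd)"
    by (auto simp: safe_cmd_def update_def reach_fm_def safe_fm_def subset_fm_def belief_fm_def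
      allowed_fm_def letter_fm_def)
  ultimately show ?thesis by (simp only: winning_cmd_def tables_cmd_def wf_cmd.simps simp_thms)
qed

lemma wf_accepting_fm: "wf_fm {} accepting_fm"
  by (simp add: accepting_fm_def length_fm_def valid_fm_def read_fm_syntax(3) value_fm_syntax(3) del:
    value_fm.simps)

text \<open>The language uses natural numbers as names; the second conjunct extends its meaning to
  instances over arbitrary types.\<close>

theorem theorem4p14:
  "almost_winning_Buchi_problem \<in> EXPTIME \<and>
   (\<forall>(G :: ('s, 'a, 'o) game_structure) T l ls xs os. Buchi_instance ls xs os G T l \<longrightarrow>
      (encode_instance ls xs os G T l \<in> almost_winning_Buchi_problem \<longleftrightarrow>
       almost_winning G (Buchi G T) l))"
proof
  show "almost_winning_Buchi_problem \<in> EXPTIME"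
    using decided_in_EXPTIME[OF wf_winning_cmd wf_accepting_fm]
    by (simp only: decided_iff_accepting problem_eq_accepting)
  show "\<forall>(G :: ('s, 'a, 'o) game_structure) T l ls xs os. Buchi_instance ls xs os G T l \<longrightarrow>
      (encode_instance ls xs os G T l \<in> almost_winning_Buchi_problem \<longleftrightarrow>
       almost_winning G (Buchi G T) l)"
    unfolding problem_eq_accepting mem_Collect_eq by (simp add: almost_winning_iff_accepting)
qed

end
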